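(* Let $\mathscr{M}=\{(a,b)\in\mathbb{R}^2: 0\le a\le \tfrac12,\ b\ge\sqrt{1-a^2}\}$. For $(a,b)\in\mathscr{M}$, let $\Gamma=\Gamma(a,b)=\mathbb{Z}(1,0)\oplus\mathbb{Z}(a,b)$, let $T_\Gamma=\mathbb{R}^2/\Gamma$, and let $g_\Gamma$ be the flat metric on $T_\Gamma$ induced from the Euclidean metric on $\mathbb{R}^2$. Then for all $(a,b)\in\mathscr{M}$, $$\Lambda_1(T_\Gamma,[g_\Gamma])\le \frac{8\pi^2}{\sqrt6\,b}\,\frac{\sqrt{2+a^2+b^2+L}}{a^2+b^2+L}\Big(a^2+b^2+\frac{L}{3}\Big),\qquad L:=\sqrt{(a^2+b^2)(8+a^2+b^2)}.$$ Moreover, when $a^2+b^2>1$, the inequality is strict.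
   Context: For a closed surface $M$ with a smooth Riemannian metric $g$, let $A(g)$ denote the area of $(M,g)$, and let $\lambda_1(g)>0$ denote the first positive eigenvalue of the Laplace–Beltrami operator $\Delta_g$, with the sign convention that $\Delta_g$ has nonnegative spectrum. The conformal class of $g$ is $[g]=\{\omega g:\omega>0\}$, where $\omega$ ranges over smooth positive functions on $M$. The first conformal eigenvalue of $[g]$ is $$\Lambda_1(M,[g])=\sup_{g'\in[g]}\lambda_1(g')A(g').$$ *)

theory Defs
  imports "HOL-Analysis.Analysis"
begin

text \<open>
  Tensors on the torus \<open>\<real>\<^sup>2/\<Gamma>\<close> are represented by their lifts: a function on the torus is a
  \<open>\<Gamma>\<close>-periodic function on the plane, and a Riemannian metric is a \<open>\<Gamma>\<close>-periodic field of
  Gram matrices with respect to the standard coordinate frame. Since the covering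
  \<open>\<real>\<^sup>2 \<rightarrow> \<real>\<^sup>2/\<Gamma>\<close> is a local diffeomorphism, smoothness and the Laplace--Beltrami
  operator may be computed on lifts.
\<close>

definition lattice :: "real^2 \<Rightarrow> real^2 \<Rightarrow> (real^2) set" where
  "lattice u v = {of_int m *\<^sub>R u + of_int n *\<^sub>R v | m n :: int. True}"

definition fundamental_domain :: "real^2 \<Rightarrow> real^2 \<Rightarrow> (real^2) set" where
  "fundamental_domain u v = {s *\<^sub>R u + t *\<^sub>R v | s t :: real. s \<in> {0..<1} \<and> t \<in> {0..<1}}"

definition periodic :: "(real^2) set \<Rightarrow> (real^2 \<Rightarrow> 'a) \<Rightarrow> bool" where
  "periodic \<Gamma> f \<longleftrightarrow> (\<forall>x. \<forall>\<gamma>\<in>\<Gamma>. f (x + \<gamma>) = f x)"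

definition partial_deriv :: "2 \<Rightarrow> (real^2 \<Rightarrow> real) \<Rightarrow> real^2 \<Rightarrow> real" where
  "partial_deriv i f x = frechet_derivative f (at x) (axis i 1)"

primrec C_k :: "nat \<Rightarrow> (real^2 \<Rightarrow> real) \<Rightarrow> bool" where
  "C_k 0 f \<longleftrightarrow> continuous_on UNIV f"
| "C_k (Suc k) f \<longleftrightarrow> (\<forall>x. f differentiable (at x)) \<and> (\<forall>i. C_k k (partial_deriv i f))"

definition smooth :: "(real^2 \<Rightarrow> real) \<Rightarrow> bool" where
  "smooth f \<longleftrightarrow> (\<forall>k. C_k k f)"

text \<open>The coordinate formula
  \<open>\<Delta>\<^sub>g f = - (det g)\<^sup>-\<^sup>1\<^sup>/\<^sup>2 \<Sum>\<^sub>i \<partial>\<^sub>i (\<Sum>\<^sub>j (det g)\<^sup>1\<^sup>/\<^sup>2 g\<^sup>i\<^sup>j \<partial>\<^sub>j f)\<close>; the leading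
  minus sign makes the spectrum nonnegative.\<close>

definition laplace_beltrami ::
    "(real^2 \<Rightarrow> real^2^2) \<Rightarrow> (real^2 \<Rightarrow> real) \<Rightarrow> real^2 \<Rightarrow> real" where
  "laplace_beltrami g f x =
     - (1 / sqrt (det (g x))) *
       (\<Sum>i\<in>UNIV. partial_deriv i
          (\<lambda>y. \<Sum>j\<in>UNIV. sqrt (det (g y)) * matrix_inv (g y) $ i $ j * partial_deriv j f y) x)"

definition is_eigenvalue :: "(real^2) set \<Rightarrow> (real^2 \<Rightarrow> real^2^2) \<Rightarrow> real \<Rightarrow> bool" where
  "is_eigenvalue \<Gamma> g l \<longleftrightarrow>
     (\<exists>f. smooth f \<and> periodic \<Gamma> f \<and> (\<exists>x. f x \<noteq> 0) \<and>
          (\<forall>x. laplace_beltrami g f x = l * f x))"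

definition lambda1 :: "(real^2) set \<Rightarrow> (real^2 \<Rightarrow> real^2^2) \<Rightarrow> real" where
  "lambda1 \<Gamma> g = (LEAST l. l > 0 \<and> is_eigenvalue \<Gamma> g l)"

definition area :: "real^2 \<Rightarrow> real^2 \<Rightarrow> (real^2 \<Rightarrow> real^2^2) \<Rightarrow> real" where
  "area u v g = (LINT x:fundamental_domain u v|lborel. sqrt (det (g x)))"

definition conformal_class ::
    "(real^2) set \<Rightarrow> (real^2 \<Rightarrow> real^2^2) \<Rightarrow> (real^2 \<Rightarrow> real^2^2) set" where
  "conformal_class \<Gamma> g =
     {(\<lambda>x. \<omega> x *\<^sub>R g x) | \<omega>. smooth \<omega> \<and> periodic \<Gamma> \<omega> \<and> (\<forall>x. \<omega> x > 0)}"

text \<open>Extended-real-valued, so that the supremum is meaningful without knowing in advance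
  that it is finite.\<close>

definition first_conformal_eigenvalue ::
    "real^2 \<Rightarrow> real^2 \<Rightarrow> (real^2 \<Rightarrow> real^2^2) \<Rightarrow> ereal" where
  "first_conformal_eigenvalue u v g =
     (SUP h\<in>conformal_class (lattice u v) g. ereal (lambda1 (lattice u v) h * area u v h))"

definition flat_metric :: "real^2 \<Rightarrow> real^2^2" where
  "flat_metric = (\<lambda>_. mat 1)"

definition moduli_space :: "(real \<times> real) set" where
  "moduli_space = {(a, b). 0 \<le> a \<and> a \<le> 1 / 2 \<and> b \<ge> sqrt (1 - a\<^sup>2)}"

end

theory Submission imports Defs begin

text \<open>
  Write \<open>r = a\<^sup>2 + b\<^sup>2\<close>, \<open>q\<^sup>2 = 2 / (2 + r + L)\<close> and \<open>p\<^sup>2 = 1 - q\<^sup>2\<close>, and map the torus to the unit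
  sphere of \<open>\<complex>\<^sup>2\<close> by \<open>\<phi> = (p e\<^sup>i\<^sup>\<alpha>, q e\<^sup>i\<^sup>\<beta>)\<close>, where \<open>\<alpha>\<close> and \<open>\<beta>\<close> are the two basic phases; this
  map is not conformal, and it is harmonic only if \<open>r = 1\<close>. By Hersch's argument, every conformal metric
  admits a Moebius transformation after which the components of \<open>\<phi>\<close> have mean zero, so that
  \<open>\<lambda>\<^sub>1\<close> times the area is at most the Dirichlet energy of the transformed map. The balancing
  transformation is found as a minimum of a coercive function of the parameter \<open>t\<close> in the unit
  ball. The energy is a multiple of \<open>(1 - \<bar>t\<bar>\<^sup>2)\<close> times the average of \<open>(1 - \<langle>t, \<phi>\<rangle>)\<^sup>-\<^sup>2\<close>. A shear of
  the torus turns the latter into the average of \<open>Y\<^sup>-\<^sup>3\<^sup>/\<^sup>2\<close> for a function \<open>Y\<close> of the form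
  \<open>S - \<tau> cos \<theta>\<close>; interpolating between the averages of \<open>Y\<^sup>-\<^sup>1\<close> and \<open>Y\<^sup>-\<^sup>2\<close> leaves an algebraic
  inequality whose extremal case is the stated bound.

  For \<open>r > 1\<close> the transformed map can be improved: along a suitable tangential variation, the first
  derivative of the energy is a nonzero multiple of \<open>1 - \<bar>t\<bar>\<^sup>2\<close>, independently of the metric. The gain
  is bounded below away from the unit sphere, and near the sphere the energy itself stays below
  the bound by a fixed factor.

  That \<open>\<lambda>\<^sub>1\<close> exists and satisfies the Rayleigh inequality is proved by the direct method: along a
  maximizing sequence for the inverse Rayleigh quotient, the Fourier coefficients converge to a
  nonzero solution of the eigenvalue equation, and the equation itself gains decay, so that the
  limit is smooth.
\<close>

section \<open>Smooth functions on the plane\<close>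

text \<open>The weight q^2 minimizes (1 + (r - 1) Q) / ((1 - Q) sqrt Q) over 0 < Q < 1, to which the
  energy bound is proportional. Its critical point solves (r - 1) Q^2 + (r + 2) Q = 1, and the
  square root of the discriminant in the solution for r > 1 is L; r = 1 gives Q = 1/3. In the
  algebraic inequality, equality is possible where the second component of t vanishes and the first
  satisfies p^2 |t_1|^2 = 1 - 3 Q: there Y is constant and the interpolation loses nothing.
  Strictness has to survive a supremum, so that a strict inequality for each single metric would not
  do: every gain must be bounded below by a quantity free of the conformal factor. The cubic weight
  X^3 in the variation serves this, as it reduces the first variation to means of characters, which
  vanish. In dimension two the Dirichlet energy is conformally invariant, so the metric enters only
  as the weight \<open>w\<close> of the mean square. \<open>lambda1\<close> is the least element of
  a set of numbers; the extremal value must therefore be attained, and by a smooth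
  eigenfunction.\<close>

lemma partial_deriv_eqI:
  assumes "(f has_derivative f') (at x)"
  shows "partial_deriv i f x = f' (axis i 1)"
  using frechet_derivative_at[OF assms] by (simp add: partial_deriv_def)

lemma partial_deriv_const [simp]: "partial_deriv i (\<lambda>x. c) = (\<lambda>x. 0)"
  by (rule ext, rule partial_deriv_eqI[THEN trans]) (auto intro!: derivative_eq_intros)

lemma
  assumes "f differentiable (at x)" "g differentiable (at x)"
  shows partial_deriv_add:
      "partial_deriv i (\<lambda>x. f x + g x) x = partial_deriv i f x + partial_deriv i g x"
    and partial_deriv_diff:
      "partial_deriv i (\<lambda>x. f x - g x) x = partial_deriv i f x - partial_deriv i g x"
    and partial_deriv_mult:
      "partial_deriv i (\<lambda>x. f x * g x) x = partial_deriv i f x * g x + f x * partial_deriv i g x"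
proof -
  have f: "(f has_derivative frechet_derivative f (at x)) (at x)"
    and g: "(g has_derivative frechet_derivative g (at x)) (at x)"
    using assms frechet_derivative_works by blast+
  show "partial_deriv i (\<lambda>x. f x + g x) x = partial_deriv i f x + partial_deriv i g x"
    using partial_deriv_eqI[OF has_derivative_add[OF f g]] by (simp add: partial_deriv_def)
  show "partial_deriv i (\<lambda>x. f x - g x) x = partial_deriv i f x - partial_deriv i g x"
    using partial_deriv_eqI[OF has_derivative_diff[OF f g]] by (simp add: partial_deriv_def)
  show "partial_deriv i (\<lambda>x. f x * g x) x = partial_deriv i f x * g x + f x * partial_deriv i g x"
    using partial_deriv_eqI[OF has_derivative_mult[OF f g]] by (simp add: partial_deriv_def)
qed

lemma partial_deriv_cmult:
  assumes "f differentiable (at x)"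
  shows "partial_deriv i (\<lambda>x. c * f x) x = c * partial_deriv i f x"
  using partial_deriv_mult[OF differentiable_const assms, of i c] by simp

lemma partial_deriv_inverse:
  assumes "f differentiable (at x)" "f x \<noteq> 0"
  shows "partial_deriv i (\<lambda>x. inverse (f x)) x = - (partial_deriv i f x * (inverse (f x) * inverse (f x)))"
proof -
  have f: "(f has_derivative frechet_derivative f (at x)) (at x)"
    using assms frechet_derivative_works by blast
  show ?thesis
    using partial_deriv_eqI[OF Deriv.has_derivative_inverse[OF assms(2) f]]
    by (simp add: partial_deriv_def)
qed

lemma C_k_differentiable: "C_k (Suc k) f \<Longrightarrow> f differentiable (at x)"
  by simp

lemma C_k_continuous: "C_k k f \<Longrightarrow> continuous_on UNIV f"
  by (cases k)
    (auto simp: continuous_on_eq_continuous_at intro: differentiable_imp_continuous_within)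

lemma C_k_SucD: "C_k (Suc k) f \<Longrightarrow> C_k k f"
proof (induction k arbitrary: f)
  case 0
  then show ?case using C_k_continuous[OF 0] by simp
next
  case (Suc k)
  then show ?case by (metis C_k.simps(2))
qed

lemma C_k_const: "C_k k (\<lambda>x. c)"
  by (induction k arbitrary: c) simp_all

lemma C_k_add: "C_k k f \<Longrightarrow> C_k k g \<Longrightarrow> C_k k (\<lambda>x. f x + g x)"
proof (induction k arbitrary: f g)
  case (Suc k)
  have "partial_deriv i (\<lambda>x. f x + g x) = (\<lambda>x. partial_deriv i f x + partial_deriv i g x)" for i
    using Suc.prems by (intro ext partial_deriv_add) auto
  with Suc show ?case by auto
qed (auto intro: continuous_intros)

lemma C_k_mult: "C_k k f \<Longrightarrow> C_k k g \<Longrightarrow> C_k k (\<lambda>x. f x * g x)"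
proof (induction k arbitrary: f g)
  case (Suc k)
  have "partial_deriv i (\<lambda>x. f x * g x)
      = (\<lambda>x. partial_deriv i f x * g x + f x * partial_deriv i g x)" for i
    using Suc.prems by (intro ext partial_deriv_mult) auto
  moreover have "C_k k f" "C_k k g" using Suc.prems C_k_SucD by blast+
  ultimately show ?case using Suc by (auto intro!: C_k_add)
qed (auto intro: continuous_intros)

lemma C_k_inverse: "C_k k f \<Longrightarrow> (\<And>x. f x \<noteq> 0) \<Longrightarrow> C_k k (\<lambda>x. inverse (f x))"
proof (induction k arbitrary: f)
  case (Suc k)
  have eq: "partial_deriv i (\<lambda>x. inverse (f x))
      = (\<lambda>x. (-1) * (partial_deriv i f x * (inverse (f x) * inverse (f x))))" for i
    using Suc.prems by (intro ext) (simp add: partial_deriv_inverse)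
  have "C_k k f" using Suc.prems C_k_SucD by blast
  then have "C_k k (\<lambda>x. (-1) * (partial_deriv i f x * (inverse (f x) * inverse (f x))))" for i
    using Suc by (intro C_k_mult C_k_const) auto
  then have "C_k k (partial_deriv i (\<lambda>x. inverse (f x)))" for i
    unfolding eq .
  moreover have "(\<lambda>x. inverse (f x)) differentiable (at x)" for x
    using Suc.prems by (auto intro: differentiable_inverse)
  ultimately show ?case by simp
qed (auto intro!: continuous_intros)

lemma smooth_const: "smooth (\<lambda>x. c)"
  by (simp add: smooth_def C_k_const)

lemma smooth_add: "smooth f \<Longrightarrow> smooth g \<Longrightarrow> smooth (\<lambda>x. f x + g x)"
  by (simp add: smooth_def C_k_add)

lemma smooth_mult: "smooth f \<Longrightarrow> smooth g \<Longrightarrow> smooth (\<lambda>x. f x * g x)"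
  by (simp add: smooth_def C_k_mult)

lemma smooth_inverse: "smooth f \<Longrightarrow> (\<And>x. f x \<noteq> 0) \<Longrightarrow> smooth (\<lambda>x. inverse (f x))"
  by (simp add: smooth_def C_k_inverse)

lemma smooth_diff: "smooth f \<Longrightarrow> smooth g \<Longrightarrow> smooth (\<lambda>x. f x - g x)"
  using smooth_add[OF _ smooth_mult[OF smooth_const[of "-1"]], of f g] by simp

lemma smooth_differentiable: "smooth f \<Longrightarrow> f differentiable (at x)"
  unfolding smooth_def using C_k_differentiable by blast

lemma smooth_partial_deriv: "smooth f \<Longrightarrow> smooth (partial_deriv i f)"
  unfolding smooth_def by (metis C_k.simps(2))

lemma smooth_continuous: "smooth f \<Longrightarrow> continuous_on UNIV f"
  unfolding smooth_def using C_k_continuous by blast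

text \<open>A class of differentiable functions that is closed under partial derivatives consists of
  smooth functions, by induction on the order. Trigonometric functions and Fourier series thus need
  no formula for higher derivatives.\<close>

lemma smooth_coinduct:
  assumes "f \<in> S"
    and "\<And>g x. g \<in> S \<Longrightarrow> g differentiable (at x)"
    and "\<And>g i. g \<in> S \<Longrightarrow> partial_deriv i g \<in> S"
  shows "smooth f"
proof -
  have "C_k k g" if "g \<in> S" for k g
    using that
  proof (induction k arbitrary: g)
    case 0
    then show ?case using assms(2)
      by (auto simp: continuous_on_eq_continuous_at intro: differentiable_imp_continuous_within)
  next
    case (Suc k)
    then show ?case using assms by auto
  qed
  then show ?thesis using assms(1) by (auto simp: smooth_def)
qed

lemma
  fixes c :: "real^2"
  shows differentiable_trig: "(\<lambda>x. A * cos (c \<bullet> x) + B * sin (c \<bullet> x)) differentiable (at x)"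
    and partial_deriv_trig: "partial_deriv i (\<lambda>x. A * cos (c \<bullet> x) + B * sin (c \<bullet> x))
      = (\<lambda>x. (B * c $ i) * cos (c \<bullet> x) + (- A * c $ i) * sin (c \<bullet> x))"
proof -
  have d: "((\<lambda>x. A * cos (c \<bullet> x) + B * sin (c \<bullet> x)) has_derivative
      (\<lambda>h. A * (- sin (c \<bullet> x) * (c \<bullet> h)) + B * (cos (c \<bullet> x) * (c \<bullet> h)))) (at x)" for x
    by (auto intro!: derivative_eq_intros simp: algebra_simps)
  show "(\<lambda>x. A * cos (c \<bullet> x) + B * sin (c \<bullet> x)) differentiable (at x)"
    using d differentiable_def by blast
  show "partial_deriv i (\<lambda>x. A * cos (c \<bullet> x) + B * sin (c \<bullet> x))
      = (\<lambda>x. (B * c $ i) * cos (c \<bullet> x) + (- A * c $ i) * sin (c \<bullet> x))"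
    by (rule ext, subst partial_deriv_eqI[OF d])
      (simp add: inner_axis' inner_axis algebra_simps)
qed

lemma smooth_trig:
  fixes c :: "real^2"
  shows "smooth (\<lambda>x. A * cos (c \<bullet> x) + B * sin (c \<bullet> x))"
proof (rule smooth_coinduct)
  show "(\<lambda>x. A * cos (c \<bullet> x) + B * sin (c \<bullet> x)) \<in> {\<lambda>x. A * cos (c \<bullet> x) + B * sin (c \<bullet> x) | A B. True}"
    by blast
  fix g i assume "g \<in> {\<lambda>x. A * cos (c \<bullet> x) + B * sin (c \<bullet> x) | A B. True}"
  then obtain A B where "g = (\<lambda>x. A * cos (c \<bullet> x) + B * sin (c \<bullet> x))" by blast
  then show "partial_deriv i g \<in> {\<lambda>x. A * cos (c \<bullet> x) + B * sin (c \<bullet> x) | A B. True}"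
    using partial_deriv_trig[of i A c B] by blast
qed (use differentiable_trig in auto)

lemma partial_deriv_cos:
  fixes c :: "real^2"
  shows "partial_deriv i (\<lambda>x. A * cos (c \<bullet> x)) = (\<lambda>x. - A * c $ i * sin (c \<bullet> x))"
  using partial_deriv_trig[of i A c 0] by simp

lemma partial_deriv_sin:
  fixes c :: "real^2"
  shows "partial_deriv i (\<lambda>x. A * sin (c \<bullet> x)) = (\<lambda>x. A * c $ i * cos (c \<bullet> x))"
  using partial_deriv_trig[of i 0 c A] by simp

lemma smooth_cos: "smooth (\<lambda>x. A * cos (c \<bullet> x))" and smooth_sin: "smooth (\<lambda>x. A * sin (c \<bullet> x))"
  using smooth_trig[of A c 0] smooth_trig[of 0 c A] by simp_all

section \<open>Averages and characters on the torus\<close>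

locale torus =
  fixes a b :: real
  assumes b_pos: "0 < b"
begin

definition \<Gamma> :: "(real^2) set" where
  "\<Gamma> = lattice (vector [1, 0]) (vector [a, b])"

definition pt :: "real \<times> real \<Rightarrow> real^2" where
  "pt z = vector [fst z + a * snd z, b * snd z]"

text \<open>Integration in lattice coordinates gives the normalised mean over the torus; the
  Jacobian \<open>b\<close> appears only in \<open>area_conformal\<close>.\<close>

definition avg :: "(real^2 \<Rightarrow> 'a::banach) \<Rightarrow> 'a" where
  "avg f = integral (cbox (0, 0) (1, 1)) (\<lambda>z. f (pt z))"

text \<open>The vectors of the dual lattice: they pair integrally with the periods, which makes
  \<open>ch k\<close> periodic.\<close>

definition freq :: "int \<times> int \<Rightarrow> real^2" where
  "freq k = vector [of_int (fst k), (of_int (snd k) - a * of_int (fst k)) / b]"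

definition ch :: "int \<times> int \<Rightarrow> real^2 \<Rightarrow> complex" where
  "ch k x = cis ((2 * pi) *\<^sub>R freq k \<bullet> x)"

lemma pt_eq: "pt (s, t) = s *\<^sub>R vector [1, 0] + t *\<^sub>R vector [a, b]"
  by (simp add: pt_def vec_eq_iff forall_2)

lemma freq_inner_pt: "freq k \<bullet> pt (s, t) = of_int (fst k) * s + of_int (snd k) * t"
  using b_pos by (simp add: freq_def pt_def inner_vec_def sum_2 field_simps)

lemma pt_surj: "\<exists>s t. x = pt (s, t)"
proof -
  have "x = pt (x $ 1 - a * (x $ 2 / b), x $ 2 / b)"
    using b_pos by (simp add: pt_def vec_eq_iff forall_2)
  then show ?thesis by blast
qed

lemma continuous_on_pt [continuous_intros]:
  "continuous_on S f \<Longrightarrow> continuous_on S (\<lambda>x. pt (f x))"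
proof -
  have "pt z = fst z *\<^sub>R vector [1, 0] + snd z *\<^sub>R vector [a, b]" for z
    using pt_eq[of "fst z" "snd z"] by simp
  then show "continuous_on S f \<Longrightarrow> continuous_on S (\<lambda>x. pt (f x))"
    by (auto intro!: continuous_intros)
qed

lemma continuous_on_comp_pt:
  "continuous_on UNIV f \<Longrightarrow> continuous_on S (\<lambda>z. f (pt z))"
  by (rule continuous_on_compose2[OF _ continuous_on_pt[OF continuous_on_id]]) auto

lemma periodic_pt:
  assumes "periodic \<Gamma> f"
  shows "f (pt (s + of_int m, t + of_int n)) = f (pt (s, t))"
proof -
  have "pt (s + of_int m, t + of_int n)
      = pt (s, t) + (of_int m *\<^sub>R vector [1, 0] + of_int n *\<^sub>R vector [a, b])"
    by (simp add: pt_eq algebra_simps)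
  moreover have "of_int m *\<^sub>R vector [1, 0] + of_int n *\<^sub>R vector [a, b] \<in> \<Gamma>"
    by (auto simp: \<Gamma>_def lattice_def)
  ultimately show ?thesis using assms by (simp add: periodic_def)
qed

text \<open>The point \<open>z\<close> does not depend on \<open>f\<close>, so several periodic
  functions can be moved into the box at once; the corner is free, which later allows a box centred
  at a given point.\<close>

lemma periodic_box:
  fixes x :: "real^2" and s0 t0 :: real
  obtains z where "z \<in> cbox (s0, t0) (s0 + 1, t0 + 1)" "\<And>f. periodic \<Gamma> f \<Longrightarrow> f x = f (pt z)"
proof -
  obtain s t where x: "x = pt (s, t)" using pt_surj by blast
  define z where "z = (s + of_int (- \<lfloor>s - s0\<rfloor>), t + of_int (- \<lfloor>t - t0\<rfloor>))"
  have "z \<in> cbox (s0, t0) (s0 + 1, t0 + 1)"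
    unfolding z_def by (auto simp: cbox_Pair_eq) linarith+
  moreover have "f x = f (pt z)" if "periodic \<Gamma> f" for f :: "real^2 \<Rightarrow> 'z"
    unfolding z_def x periodic_pt[OF that] ..
  ultimately show ?thesis using that by blast
qed

lemma periodic_bounded:
  fixes f :: "real^2 \<Rightarrow> 'z::real_normed_vector"
  assumes "continuous_on UNIV f" "periodic \<Gamma> f"
  obtains M where "M > 0" "\<And>x. norm (f x) \<le> M"
proof -
  have "compact ((\<lambda>z. f (pt z)) ` cbox (0, 0) (0 + 1, 0 + 1))"
    by (intro compact_continuous_image continuous_on_comp_pt assms compact_cbox)
  then have "bounded ((\<lambda>z. f (pt z)) ` cbox (0, 0) (0 + 1, 0 + 1))" by (rule compact_imp_bounded)
  then obtain M where M: "M > 0" "\<And>z. z \<in> cbox (0, 0) (0 + 1, 0 + 1) \<Longrightarrow> norm (f (pt z)) \<le> M"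
    unfolding bounded_pos by auto
  have "norm (f x) \<le> M" for x
  proof -
    obtain z where "z \<in> cbox (0, 0) (0 + 1, 0 + 1)" "f x = f (pt z)"
      using periodic_box[of 0 0 x] assms(2) by metis
    then show ?thesis using M(2) by simp
  qed
  with M(1) show ?thesis using that by blast
qed

lemma periodic_comp: "periodic \<Gamma> f \<Longrightarrow> periodic \<Gamma> (\<lambda>x. F (f x))"
  by (simp add: periodic_def)

lemma periodic_comp2: "periodic \<Gamma> f \<Longrightarrow> periodic \<Gamma> g \<Longrightarrow> periodic \<Gamma> (\<lambda>x. F (f x) (g x))"
  by (simp add: periodic_def)

lemma periodic_const: "periodic \<Gamma> (\<lambda>x. c)"
  by (simp add: periodic_def)

lemma periodic_partial_deriv:
  assumes "\<And>x. f differentiable (at x)" "periodic \<Gamma> f"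
  shows "periodic \<Gamma> (partial_deriv i f)"
  unfolding periodic_def
proof (intro allI ballI)
  fix x g assume g: "g \<in> \<Gamma>"
  have "(f has_derivative frechet_derivative f (at (x + g))) (at (x + g))"
    using assms frechet_derivative_works by blast
  then have "((\<lambda>y. f (y + g)) has_derivative frechet_derivative f (at (x + g))) (at x)"
    by (rule has_derivative_compose[of "\<lambda>y. y + g" "\<lambda>h. h" x UNIV f, simplified, rotated])
      (auto intro!: derivative_eq_intros)
  moreover have "(\<lambda>y. f (y + g)) = f" using assms(2) g by (auto simp: periodic_def)
  ultimately show "partial_deriv i f (x + g) = partial_deriv i f x"
    using partial_deriv_eqI by (simp add: partial_deriv_def)
qed

section \<open>Mean values over a period\<close>

lemma integrable_pt:
  fixes f :: "real^2 \<Rightarrow> 'z::banach"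
  shows "continuous_on UNIV f \<Longrightarrow> (\<lambda>z. f (pt z)) integrable_on cbox (u, u') (v, v')"
  by (intro integrable_continuous continuous_on_comp_pt)

lemma avg_add:
  "continuous_on UNIV f \<Longrightarrow> continuous_on UNIV g \<Longrightarrow> avg (\<lambda>x. f x + g x) = avg f + avg g"
  by (simp add: avg_def integral_add integrable_pt)

lemma avg_diff:
  "continuous_on UNIV f \<Longrightarrow> continuous_on UNIV g \<Longrightarrow> avg (\<lambda>x. f x - g x) = avg f - avg g"
  by (simp add: avg_def integral_diff integrable_pt)

lemma avg_bounded_linear:
  "bounded_linear L \<Longrightarrow> continuous_on UNIV f \<Longrightarrow> avg (\<lambda>x. L (f x)) = L (avg f)"
  unfolding avg_def using integral_linear[OF integrable_pt, of f L]
  by (auto simp: o_def)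

lemma avg_cmult:
  fixes f :: "real^2 \<Rightarrow> 'z::{banach,real_normed_algebra}"
  shows "continuous_on UNIV f \<Longrightarrow> avg (\<lambda>x. c * f x) = c * avg f"
  by (rule avg_bounded_linear[OF bounded_linear_mult_right])

lemma avg_sum:
  "finite I \<Longrightarrow> (\<And>i. i \<in> I \<Longrightarrow> continuous_on UNIV (f i)) \<Longrightarrow> avg (\<lambda>x. \<Sum>i\<in>I. f i x) = (\<Sum>i\<in>I. avg (f i))"
  unfolding avg_def by (intro integral_sum integrable_pt)

lemma avg_const [simp]: "avg (\<lambda>x. c) = c"
proof -
  have "measure lborel (cbox (0::real, 0::real) (1, 1)) = 1" by (simp add: content_Pair)
  then show ?thesis by (simp add: avg_def)
qed

lemma avg_mono:
  fixes f :: "real^2 \<Rightarrow> real"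
  shows "continuous_on UNIV f \<Longrightarrow> continuous_on UNIV g \<Longrightarrow> (\<And>x. f x \<le> g x) \<Longrightarrow> avg f \<le> avg g"
  unfolding avg_def by (intro integral_le integrable_pt) auto

lemma avg_nonneg:
  fixes f :: "real^2 \<Rightarrow> real"
  shows "continuous_on UNIV f \<Longrightarrow> (\<And>x. 0 \<le> f x) \<Longrightarrow> 0 \<le> avg f"
  using avg_mono[of "\<lambda>x. 0" f] by simp

lemma avg_norm_le:
  fixes f :: "real^2 \<Rightarrow> 'z::banach"
  assumes "continuous_on UNIV f" "continuous_on UNIV g" "\<And>x. norm (f x) \<le> g x"
  shows "norm (avg f) \<le> avg g"
  unfolding avg_def by (intro integral_norm_bound_integral integrable_pt assms)

lemma avg_norm_bound:
  fixes f :: "real^2 \<Rightarrow> 'z::banach"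
  assumes "continuous_on UNIV f" "\<And>x. norm (f x) \<le> M"
  shows "norm (avg f) \<le> M"
  using avg_norm_le[OF assms(1) continuous_on_const[of _ M]] assms(2) by simp

lemma avg_eq_0_imp:
  fixes f :: "real^2 \<Rightarrow> real"
  assumes f: "continuous_on UNIV f" "periodic \<Gamma> f" "\<And>x. 0 \<le> f x" and 0: "avg f = 0"
  shows "f x = 0"
proof -
  have "((\<lambda>z. f (pt z)) has_integral 0) (cbox (0, 0) (0 + 1, 0 + 1))"
    using integrable_integral[OF integrable_pt[OF f(1)], of 0 0 1 1] 0 by (simp add: avg_def)
  moreover have "box (0::real, 0::real) (0 + 1, 0 + 1) \<noteq> {}"
    by (auto simp: box_ne_empty Basis_prod_def)
  ultimately have *: "f (pt z) = 0" if "z \<in> cbox (0, 0) (0 + 1, 0 + 1)" for z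
    using that f by (intro has_integral_0_cbox_imp_0[of "(0, 0)" "(0 + 1, 0 + 1)" "\<lambda>z. f (pt z)"]
      continuous_on_comp_pt)
  obtain z where "z \<in> cbox (0, 0) (0 + 1, 0 + 1)" "f x = f (pt z)"
    using periodic_box[of 0 0 x] f(2) by metis
  then show ?thesis using * by simp
qed

lemma avg_pos:
  fixes f :: "real^2 \<Rightarrow> real"
  assumes f: "continuous_on UNIV f" "periodic \<Gamma> f" "\<And>x. 0 \<le> f x" and "f x \<noteq> 0"
  shows "0 < avg f"
  using avg_eq_0_imp[OF f] avg_nonneg[OF f(1,3)] assms(4) by (metis order_le_less)

text \<open>Weierstrass M-test: the finite partial sums converge uniformly, so that continuity and
  the mean pass to the limit.\<close>

lemma
  fixes g :: "'k \<Rightarrow> real^2 \<Rightarrow> 'z::banach"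
  assumes bound: "\<And>k x. norm (g k x) \<le> M k" and M: "M summable_on UNIV"
    and cont: "\<And>k. continuous_on UNIV (g k)"
  shows continuous_on_infsum: "continuous_on UNIV (\<lambda>x. \<Sum>\<^sub>\<infinity>k. g k x)"
    and avg_infsum: "((\<lambda>k. avg (g k)) has_sum avg (\<lambda>x. \<Sum>\<^sub>\<infinity>k. g k x)) UNIV"
proof -
  have ul: "uniform_limit Y (\<lambda>X y. \<Sum>k\<in>X. g k y) (\<lambda>y. \<Sum>\<^sub>\<infinity>k. g k y) (finite_subsets_at_top UNIV)" for Y
    by (rule Weierstrass_m_test_general[OF bound M])
  show "continuous_on UNIV (\<lambda>x. \<Sum>\<^sub>\<infinity>k. g k x)"
    by (rule uniform_limit_theorem[OF _ ul])
      (auto intro!: always_eventually continuous_on_sum cont)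
  have ul': "uniform_limit (cbox (0, 0) (1, 1)) (\<lambda>X z. \<Sum>k\<in>X. g k (pt z))
      (\<lambda>z. \<Sum>\<^sub>\<infinity>k. g k (pt z)) (finite_subsets_at_top UNIV)"
    by (rule Weierstrass_m_test_general[OF bound M])
  have cont': "continuous_on (cbox (0, 0) (1, 1)) (\<lambda>z. \<Sum>k\<in>X. g k (pt z))" for X
    by (intro continuous_on_sum continuous_on_comp_pt cont)
  obtain I J where IJ: "\<And>X. ((\<lambda>z. \<Sum>k\<in>X. g k (pt z)) has_integral I X) (cbox (0, 0) (1, 1))"
      "((\<lambda>z. \<Sum>\<^sub>\<infinity>k. g k (pt z)) has_integral J) (cbox (0, 0) (1, 1))"
      "(I \<longlongrightarrow> J) (finite_subsets_at_top UNIV)"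
    using uniform_limit_integral_cbox[OF ul' cont' finite_subsets_at_top_neq_bot] by blast
  have "J = avg (\<lambda>x. \<Sum>\<^sub>\<infinity>k. g k x)" using IJ(2) by (simp add: avg_def integral_unique)
  moreover have "I X = (\<Sum>k\<in>X. avg (g k))" if "finite X" for X
  proof -
    have "I X = avg (\<lambda>x. \<Sum>k\<in>X. g k x)" using IJ(1)[of X] by (simp add: avg_def integral_unique)
    then show ?thesis using avg_sum[OF that cont] by simp
  qed
  ultimately show "((\<lambda>k. avg (g k)) has_sum avg (\<lambda>x. \<Sum>\<^sub>\<infinity>k. g k x)) UNIV"
    unfolding has_sum_def using IJ(3)
    by (auto elim!: Lim_transform_eventually intro!: eventually_finite_subsets_at_top_weakI)
qed

lemma avg_iterated:
  fixes f :: "real^2 \<Rightarrow> 'z::banach"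
  assumes "continuous_on UNIV f"
  shows "avg f = integral {0..1} (\<lambda>s. integral {0..1} (\<lambda>t. f (pt (s, t))))"
    and "avg f = integral {0..1} (\<lambda>t. integral {0..1} (\<lambda>s. f (pt (s, t))))"
proof -
  show 1: "avg f = integral {0..1} (\<lambda>s. integral {0..1} (\<lambda>t. f (pt (s, t))))"
    using integral_prod_continuous[OF continuous_on_comp_pt[OF assms], of 0 0 1 1]
    by (simp add: avg_def)
  have "continuous_on (cbox (0, 0) (1, 1)) (\<lambda>(s, t). f (pt (s, t)))"
    using continuous_on_comp_pt[OF assms] by (simp add: case_prod_beta')
  from integral_swap_continuous[OF this]
  show "avg f = integral {0..1} (\<lambda>t. integral {0..1} (\<lambda>s. f (pt (s, t))))"
    unfolding 1 by simp
qed

text \<open>The fundamental theorem of calculus along the two periods (1, 0) and (a, b). The second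
  one yields the mean of a \<partial>1 f + b \<partial>2 f, from which \<partial>2 f is recovered
  since b > 0.\<close>

lemma avg_partial_deriv:
  assumes f: "smooth f" "periodic \<Gamma> f"
  shows "avg (partial_deriv i f) = 0"
proof -
  define F where "F x = frechet_derivative f (at x)" for x
  have F: "(f has_derivative F x) (at x)" for x
    unfolding F_def using smooth_differentiable[OF f(1)] frechet_derivative_works by blast
  have lin: "linear (F x)" for x using F has_derivative_linear by blast
  have F1: "F x (vector [1, 0]) = partial_deriv 1 f x" for x
  proof -
    have "vector [1, 0] = (axis 1 1 :: real^2)" by (simp add: vec_eq_iff forall_2 axis_def)
    then show ?thesis by (simp add: partial_deriv_def F_def)
  qed
  have F2: "F x (vector [a, b]) = a * partial_deriv 1 f x + b * partial_deriv 2 f x" for x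
  proof -
    have "vector [a, b] = a *\<^sub>R (axis 1 1 :: real^2) + b *\<^sub>R axis 2 1"
      by (simp add: vec_eq_iff forall_2 axis_def)
    then show ?thesis
      by (simp add: partial_deriv_def F_def[symmetric] linear_add[OF lin] linear_cmul[OF lin])
  qed
  note cont = smooth_continuous[OF smooth_partial_deriv[OF f(1)]]
  have "((\<lambda>s. f (pt (s, t))) has_vector_derivative partial_deriv 1 f (pt (s, t))) (at s within S)"
    for s t S
  proof -
    have "((\<lambda>s. pt (s, t)) has_derivative (\<lambda>h. h *\<^sub>R vector [1, 0])) (at s within S)"
      unfolding pt_eq by (auto intro!: derivative_eq_intros)
    from has_derivative_compose[OF this F] show ?thesis
      unfolding has_vector_derivative_def by (simp add: linear_cmul[OF lin] F1)
  qed
  then have "((\<lambda>s. partial_deriv 1 f (pt (s, t))) has_integral f (pt (1, t)) - f (pt (0, t))) {0..1}" for t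
    by (intro fundamental_theorem_of_calculus) auto
  moreover have "f (pt (1, t)) = f (pt (0, t))" for t
    using periodic_pt[OF f(2), of 0 1 t 0] by simp
  ultimately have "integral {0..1} (\<lambda>s. partial_deriv 1 f (pt (s, t))) = 0" for t
    using integral_unique by fastforce
  then have 1: "avg (partial_deriv 1 f) = 0"
    unfolding avg_iterated(2)[OF cont] by simp
  have "((\<lambda>t. f (pt (s, t))) has_vector_derivative
      a * partial_deriv 1 f (pt (s, t)) + b * partial_deriv 2 f (pt (s, t))) (at t within S)"
    for s t S
  proof -
    have "((\<lambda>t. pt (s, t)) has_derivative (\<lambda>h. h *\<^sub>R vector [a, b])) (at t within S)"
      unfolding pt_eq by (auto intro!: derivative_eq_intros)
    from has_derivative_compose[OF this F] show ?thesis
      unfolding has_vector_derivative_def by (simp add: linear_cmul[OF lin] F2)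
  qed
  then have "((\<lambda>t. a * partial_deriv 1 f (pt (s, t)) + b * partial_deriv 2 f (pt (s, t)))
      has_integral f (pt (s, 1)) - f (pt (s, 0))) {0..1}" for s
    by (intro fundamental_theorem_of_calculus) auto
  moreover have "f (pt (s, 1)) = f (pt (s, 0))" for s
    using periodic_pt[OF f(2), of s 0 0 1] by simp
  ultimately have "integral {0..1}
      (\<lambda>t. a * partial_deriv 1 f (pt (s, t)) + b * partial_deriv 2 f (pt (s, t))) = 0" for s
    using integral_unique by fastforce
  then have "avg (\<lambda>x. a * partial_deriv 1 f x + b * partial_deriv 2 f x) = 0"
    by (subst avg_iterated(1)) (auto intro!: continuous_on_add continuous_on_mult_left cont)
  then have "a * avg (partial_deriv 1 f) + b * avg (partial_deriv 2 f) = 0"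
    by (simp add: avg_add avg_cmult cont continuous_on_mult_left)
  then have "avg (partial_deriv 2 f) = 0" using 1 b_pos by simp
  with 1 show ?thesis using exhaust_2[of i] by auto
qed

section \<open>Characters and uniqueness of Fourier coefficients\<close>

lemma ch_pt: "ch k (pt (s, t)) = cis (2 * pi * (of_int (fst k) * s + of_int (snd k) * t))"
  by (simp add: ch_def freq_inner_pt)

lemma continuous_ch [continuous_intros]: "continuous_on S (ch k)"
  unfolding ch_def by (intro continuous_intros)

lemma norm_ch [simp]: "norm (ch k x) = 1"
  by (simp add: ch_def)

lemma ch_0 [simp]: "ch 0 x = 1" "ch (0, 0) x = 1"
  by (simp_all add: ch_def freq_def inner_vec_def sum_2)

lemma freq_add: "freq (k + l) = freq k + freq l"
  and freq_uminus: "freq (- k) = - freq k"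
  by (simp_all add: freq_def vec_eq_iff forall_2 algebra_simps add_divide_distrib diff_divide_distrib)

lemma ch_add: "ch (k + l) x = ch k x * ch l x"
  by (simp add: ch_def freq_add inner_add_left cis_mult algebra_simps)

lemma ch_uminus: "ch (- k) x = cnj (ch k x)"
  by (simp add: ch_def freq_uminus cis_cnj)

lemma periodic_ch: "periodic \<Gamma> (ch k)"
  unfolding periodic_def
proof (intro allI ballI)
  fix x g assume "g \<in> \<Gamma>"
  then obtain m n :: int where "g = pt (of_int m, of_int n)"
    by (auto simp: \<Gamma>_def lattice_def pt_eq)
  then have "(2 * pi) *\<^sub>R freq k \<bullet> g = 2 * pi * of_int (fst k * m + snd k * n)"
    by (simp add: freq_inner_pt)
  then have "(2 * pi) *\<^sub>R freq k \<bullet> (x + g)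
      = (2 * pi) *\<^sub>R freq k \<bullet> x + 2 * pi * of_int (fst k * m + snd k * n)"
    by (metis inner_add_right)
  then show "ch k (x + g) = ch k x"
    unfolding ch_def cis_mult[symmetric]
    by (simp add: cis_mult[symmetric] cis_multiple_2pi del: of_int_add of_int_mult)
qed

lemma cos_freq_diff:
  "complex_of_real (cos ((2 * pi) *\<^sub>R freq k \<bullet> (x - y)))
    = (ch k x * cnj (ch k y) + ch (- k) x * ch k y) / 2"
proof -
  have "ch k x * cnj (ch k y) = cis ((2 * pi) *\<^sub>R freq k \<bullet> (x - y))"
    unfolding ch_def cis_cnj cis_mult inner_diff_right by simp
  moreover have "ch (- k) x * ch k y = cnj (cis ((2 * pi) *\<^sub>R freq k \<bullet> (x - y)))"
    unfolding ch_def cis_cnj cis_mult inner_diff_right freq_uminus by simp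
  ultimately show ?thesis
    by (simp add: complex_eq_iff)
qed

text \<open>The powers of the trigonometric polynomial \<open>T\<close> concentrate their mass near \<open>y\<close>: \<open>T > 1\<close>
  near \<open>y\<close>, and \<open>\<bar>T\<bar> \<le> 1\<close> where \<open>h\<close> is not known to be positive.\<close>

lemma fourier_coeffs_0_imp_nonpos:
  fixes h :: "real^2 \<Rightarrow> real"
  assumes h: "continuous_on UNIV h" "periodic \<Gamma> h"
    and coeff: "\<And>k. avg (\<lambda>x. of_real (h x) * ch k x) = 0"
  shows "h y \<le> 0"
proof (rule ccontr)
  assume "\<not> h y \<le> 0"
  define d where "d = h y / 2"
  have d: "d > 0" "h y > d" using \<open>\<not> h y \<le> 0\<close> by (auto simp: d_def)
  obtain s0 t0 where y: "y = pt (s0, t0)" using pt_surj by blast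
  define U where "U = {x. d < h x}"
  have U: "open U" "y \<in> U" "\<And>x. x \<in> U \<Longrightarrow> h x > d"
    using d(2) open_Collect_less[OF continuous_on_const h(1)] by (auto simp: U_def)
  define \<kappa> where "\<kappa> x = (cos ((2 * pi) *\<^sub>R freq (1, 0) \<bullet> (x - y))
    + cos ((2 * pi) *\<^sub>R freq (0, 1) \<bullet> (x - y))) / 2" for x
  have \<kappa>_complex: "complex_of_real (\<kappa> x) = (ch (1, 0) x * cnj (ch (1, 0) y) + ch (- (1, 0)) x * ch (1, 0) y
      + ch (0, 1) x * cnj (ch (0, 1) y) + ch (- (0, 1)) x * ch (0, 1) y) / 4" for x
    unfolding \<kappa>_def of_real_divide of_real_add cos_freq_diff
    by (simp add: add_divide_distrib)
  have \<kappa>_pt: "\<kappa> (pt (s, t)) = (cos (2 * pi * (s - s0)) + cos (2 * pi * (t - t0))) / 2" for s t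
    by (simp add: \<kappa>_def y inner_diff_right freq_inner_pt right_diff_distrib)
  have \<kappa>_cont: "continuous_on S \<kappa>" for S
    unfolding \<kappa>_def by (intro continuous_intros) simp_all
  have \<kappa>_periodic: "periodic \<Gamma> \<kappa>"
  proof -
    have "periodic \<Gamma> (\<lambda>x. Re ((ch (1, 0) x * cnj (ch (1, 0) y) + ch (- (1, 0)) x * ch (1, 0) y
      + ch (0, 1) x * cnj (ch (0, 1) y) + ch (- (0, 1)) x * ch (0, 1) y) / 4))"
      using periodic_ch[unfolded periodic_def, rule_format] by (simp add: periodic_def)
    then show ?thesis unfolding \<kappa>_complex[symmetric] by simp
  qed
  define K where "K = pt ` cbox (s0 - 1/2, t0 - 1/2) (s0 - 1/2 + 1, t0 - 1/2 + 1) - U"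
  have "compact K" unfolding K_def
    by (intro compact_diff compact_continuous_image continuous_on_pt continuous_on_id
        compact_cbox U(1))
  have \<kappa>_less: "\<kappa> x < 1" if xK: "x \<in> K" for x
  proof (rule ccontr)
    assume "\<not> \<kappa> x < 1"
    obtain s t where st: "x = pt (s, t)" "\<bar>s - s0\<bar> \<le> 1/2" "\<bar>t - t0\<bar> \<le> 1/2"
    proof -
      obtain z where z: "x = pt z" "z \<in> cbox (s0 - 1/2, t0 - 1/2) (s0 - 1/2 + 1, t0 - 1/2 + 1)"
        using xK unfolding K_def by blast
      then have "s0 - 1/2 \<le> fst z" "fst z \<le> s0 - 1/2 + 1" "t0 - 1/2 \<le> snd z" "snd z \<le> t0 - 1/2 + 1"
        by (auto simp: cbox_Pair_eq)
      then have "\<bar>fst z - s0\<bar> \<le> 1/2" "\<bar>snd z - t0\<bar> \<le> 1/2"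
        unfolding abs_le_iff by linarith+
      then show ?thesis using that[of "fst z" "snd z"] z(1) by simp
    qed
    have eq: "u = 0" if u: "cos (2 * pi * u) = 1" "\<bar>u\<bar> \<le> 1/2" for u :: real
    proof -
      obtain n :: int where "2 * pi * u = of_int n * 2 * pi"
        using u(1) unfolding cos_one_2pi_int by blast
      then have "u = real_of_int n" by simp
      moreover from this u(2) have "\<bar>real_of_int n\<bar> < 1" by simp
      then have "n = 0" by linarith
      ultimately show ?thesis by simp
    qed
    have sum: "c = 1 \<and> d = 1" if "\<not> (c + d) / 2 < 1" "c \<le> 1" "d \<le> 1" for c d :: real
      using that by auto
    have "cos (2 * pi * (s - s0)) = 1" "cos (2 * pi * (t - t0)) = 1"
      using sum[OF _ cos_le_one cos_le_one] \<open>\<not> \<kappa> x < 1\<close> unfolding st(1) \<kappa>_pt by blast+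
    then have "s - s0 = 0" "t - t0 = 0" using eq[OF _ st(2)] eq[OF _ st(3)] by simp_all
    then have "x = y" using st(1) y by simp
    then show False using xK U(2) by (simp add: K_def)
  qed
  obtain \<rho> where \<rho>: "0 \<le> \<rho>" "\<rho> < 1" "\<And>x. x \<in> K \<Longrightarrow> \<kappa> x \<le> \<rho>"
  proof (cases "K = {}")
    case True
    then show ?thesis using that[of 0] by simp
  next
    case False
    then obtain x0 where "x0 \<in> K" "\<And>x. x \<in> K \<Longrightarrow> \<kappa> x \<le> \<kappa> x0"
      using continuous_attains_sup[OF \<open>compact K\<close> _ \<kappa>_cont] by blast
    then show ?thesis using that[of "max 0 (\<kappa> x0)"] \<kappa>_less by fastforce
  qed
  define T where "T x = \<kappa> x + (1 - \<rho>)" for x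
  have T_cont: "continuous_on S T" for S
    unfolding T_def by (intro continuous_intros \<kappa>_cont)
  have T_ge: "-1 \<le> T x" for x
  proof -
    have "-1 \<le> (c + d) / 2" if "-1 \<le> c" "-1 \<le> d" for c d :: real using that by simp
    then have "-1 \<le> \<kappa> x" unfolding \<kappa>_def by (simp only: cos_ge_minus_one)
    with \<rho> show ?thesis by (simp add: T_def)
  qed
  have hcont: "continuous_on S h" for S using h(1) continuous_on_subset by blast
  \<comment> \<open>One factor \<open>T\<close> turns the mean at \<open>k\<close> into a
    combination of those at \<open>k\<close> and its four neighbours; hence the induction runs over
    all \<open>k\<close> together.\<close>
  have int_zero: "avg (\<lambda>x. of_real (h x * T x ^ n) * ch k x) = 0" for n k
  proof (induction n arbitrary: k)
    case 0
    then show ?case using coeff by simp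
  next
    case (Suc n)
    define g where "g j x = complex_of_real (h x * T x ^ n) * ch j x" for j x
    have gc: "continuous_on UNIV (\<lambda>x. g j x)" for j
      unfolding g_def by (intro continuous_intros hcont T_cont)
    have "complex_of_real (h x * T x ^ Suc n) * ch k x
        = (1 - of_real \<rho>) * g k x
        + (cnj (ch (1, 0) y) / 4 * g (k + (1, 0)) x + (ch (1, 0) y / 4 * g (k + - (1, 0)) x
        + (cnj (ch (0, 1) y) / 4 * g (k + (0, 1)) x + ch (0, 1) y / 4 * g (k + - (0, 1)) x)))" for x
      unfolding g_def T_def power_Suc of_real_mult of_real_add of_real_diff \<kappa>_complex ch_add
      by (simp add: field_simps del: ch_0)
    then have eq: "(\<lambda>x. complex_of_real (h x * T x ^ Suc n) * ch k x) = (\<lambda>x. (1 - of_real \<rho>) * g k x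
        + (cnj (ch (1, 0) y) / 4 * g (k + (1, 0)) x + (ch (1, 0) y / 4 * g (k + - (1, 0)) x
        + (cnj (ch (0, 1) y) / 4 * g (k + (0, 1)) x + ch (0, 1) y / 4 * g (k + - (0, 1)) x))))"
      by blast
    have 0: "avg (\<lambda>x. g j x) = 0" for j unfolding g_def using Suc by simp
    have comb: "continuous_on UNIV (\<lambda>x. c * u x) \<and> avg (\<lambda>x. c * u x) = 0"
      if "continuous_on UNIV u \<and> avg u = 0" for c and u :: "real^2 \<Rightarrow> complex"
      using that by (simp add: avg_cmult continuous_on_mult_left)
    have comb': "continuous_on UNIV (\<lambda>x. u x + v x) \<and> avg (\<lambda>x. u x + v x) = 0"
      if "continuous_on UNIV u \<and> avg u = 0" "continuous_on UNIV v \<and> avg v = 0"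
      for u v :: "real^2 \<Rightarrow> complex"
      using that by (simp add: avg_add continuous_on_add)
    show ?case unfolding eq
      by (rule conjunct2[OF comb']; intro comb comb'; simp only: gc 0)
  qed
  have zero: "avg (\<lambda>x. h x * T x ^ n) = 0" for n
  proof -
    have "complex_of_real (avg (\<lambda>x. h x * T x ^ n)) = avg (\<lambda>x. complex_of_real (h x * T x ^ n))"
      by (rule avg_bounded_linear[symmetric, OF bounded_linear_of_real])
        (intro continuous_intros hcont T_cont)
    also have "\<dots> = 0" using int_zero[of n 0] by simp
    finally show ?thesis by simp
  qed
  obtain M where M: "M > 0" "\<And>x. norm (h x) \<le> M" using periodic_bounded[OF h] by blast
  define E where "E x = max 0 (T x - 1)" for x
  have E_cont: "continuous_on S E" for S
    unfolding E_def by (intro continuous_intros T_cont)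
  have E_pos: "avg E > 0"
  proof (rule avg_pos[OF E_cont])
    show "periodic \<Gamma> E"
      using periodic_comp[OF \<kappa>_periodic, of "\<lambda>u. max 0 (u + (1 - \<rho>) - 1)"] by (simp add: E_def[abs_def] T_def)
    show "E y \<noteq> 0" using \<rho>(2) by (simp add: E_def T_def \<kappa>_def)
  qed (simp add: E_def)
  \<comment> \<open>Where \<open>T > 1\<close>, Bernoulli's inequality gives growth linear in
    \<open>n\<close>, which is enough to beat the constant \<open>M\<close>; elsewhere |T| <= 1
    keeps the integrand above -M.\<close>
  have lower: "d * n * E x - M \<le> h x * T x ^ n" for n :: nat and x
  proof (cases "T x \<le> 1")
    case True
    then have "\<bar>T x ^ n\<bar> \<le> 1" using T_ge[of x] by (simp add: power_abs power_le_one)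
    then have "\<bar>h x * T x ^ n\<bar> \<le> M * 1"
      unfolding abs_mult using M by (intro mult_mono) auto
    moreover have "E x = 0" using True by (simp add: E_def)
    ultimately show ?thesis by simp
  next
    case False
    obtain z where z: "z \<in> cbox (s0 - 1/2, t0 - 1/2) (s0 - 1/2 + 1, t0 - 1/2 + 1)"
      and zz: "\<And>f. periodic \<Gamma> f \<Longrightarrow> (f x :: real) = f (pt z)"
      using periodic_box[of "s0 - 1/2" "t0 - 1/2" x] by blast
    have "\<kappa> (pt z) > \<rho>" using False zz[OF \<kappa>_periodic] by (simp add: T_def)
    then have "pt z \<notin> K" using \<rho>(3) by force
    then have "pt z \<in> U" using z by (simp add: K_def del: add_uminus_conv_diff)
    then have hx: "h x > d" using U(3) zz[OF h(2)] by simp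
    have "1 + real n * (T x - 1) \<le> (1 + (T x - 1)) ^ n"
      using False by (intro Bernoulli_inequality) auto
    then have "real n * E x \<le> T x ^ n" using False by (simp add: E_def)
    then have "d * (real n * E x) \<le> h x * T x ^ n"
      using hx d by (intro mult_mono) (auto simp: E_def)
    then show ?thesis using M by (simp add: mult.assoc)
  qed
  have "d * n * avg E - M \<le> 0" for n :: nat
  proof -
    have "d * n * avg E - M = avg (\<lambda>x. d * n * E x - M)"
      by (simp add: avg_diff avg_cmult continuous_on_mult_left E_cont continuous_on_const)
    also have "\<dots> \<le> avg (\<lambda>x. h x * T x ^ n)"
      by (intro avg_mono lower) (intro continuous_intros E_cont hcont T_cont)+
    finally show ?thesis using zero by simp
  qed
  moreover obtain n :: nat where "M / (d * avg E) < n" using reals_Archimedean2 by blast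
  moreover from this have "M < d * n * avg E" using d E_pos by (simp add: field_simps)
  ultimately show False by (smt (verit))
qed

definition cf :: "(real^2 \<Rightarrow> complex) \<Rightarrow> int \<times> int \<Rightarrow> complex" where
  "cf g k = avg (\<lambda>x. g x * cnj (ch k x))"

text \<open>The coefficients of \<open>g\<close> and of its conjugate vanish together, hence so do
  those of the real and imaginary parts. The one-sided real result is applied to these parts and to
  their negatives.\<close>

lemma fourier_uniqueness:
  assumes g: "continuous_on UNIV g" "periodic \<Gamma> g" and cf: "\<And>k. cf g k = 0"
  shows "g x = 0"
proof -
  have gc: "continuous_on S g" for S using g(1) continuous_on_subset by blast
  have 1: "avg (\<lambda>x. g x * ch k x) = 0" for k
    using cf[of "- k"] by (simp add: cf_def ch_uminus)
  have 2: "avg (\<lambda>x. cnj (g x) * ch k x) = 0" for k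
  proof -
    have "avg (\<lambda>x. cnj (g x * cnj (ch k x))) = cnj (avg (\<lambda>x. g x * cnj (ch k x)))"
      by (rule avg_bounded_linear[OF bounded_linear_cnj]) (intro continuous_intros gc)
    then show ?thesis using cf[of k] by (simp add: cf_def)
  qed
  have comb: "avg (\<lambda>x. (c * g x + e * cnj (g x)) * ch k x) = 0" for c e k
  proof -
    have "avg (\<lambda>x. c * (g x * ch k x) + e * (cnj (g x) * ch k x)) = 0"
      by (subst avg_add, (intro continuous_intros gc)+, subst avg_cmult, (intro continuous_intros gc)+,
          subst avg_cmult, (intro continuous_intros gc)+) (simp add: 1 2)
    then show ?thesis by (simp add: algebra_simps)
  qed
  have sol: "h x = 0"
    if h: "continuous_on UNIV h" "periodic \<Gamma> h" "\<And>k. avg (\<lambda>x. of_real (h x) * ch k x) = 0" for h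
  proof -
    have "h x \<le> 0" by (rule fourier_coeffs_0_imp_nonpos[OF h])
    moreover have "- h x \<le> 0"
    proof (rule fourier_coeffs_0_imp_nonpos[where h="\<lambda>x. - h x"])
      show "continuous_on UNIV (\<lambda>x. - h x)" by (intro continuous_intros h)
      show "periodic \<Gamma> (\<lambda>x. - h x)" by (rule periodic_comp[OF h(2)])
      have "avg (\<lambda>x. (-1) * (of_real (h x) * ch k x)) = 0" for k
        by (subst avg_cmult) (auto intro!: continuous_intros h(1) simp: h(3))
      then show "avg (\<lambda>x. of_real (- h x) * ch k x) = 0" for k by simp
    qed
    ultimately show ?thesis by simp
  qed
  have re: "complex_of_real (Re z) = 1/2 * z + 1/2 * cnj z" for z by (simp add: complex_eq_iff)
  have im: "complex_of_real (Im z) = - \<i> / 2 * z + \<i> / 2 * cnj z" for z by (simp add: complex_eq_iff)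
  have "Re (g x) = 0"
    by (rule sol; (intro continuous_intros g)?; (rule periodic_comp[OF g(2)])?; (unfold re, rule comb)?)
  moreover have "Im (g x) = 0"
    by (rule sol; (intro continuous_intros g)?; (rule periodic_comp[OF g(2)])?; (unfold im, rule comb)?)
  ultimately show ?thesis by (simp add: complex_eq_iff)
qed

end

section \<open>Fourier series of smooth functions\<close>

lemma summable_int_inverse_squares: "(\<lambda>m::int. 1 / (1 + \<bar>real_of_int m\<bar>)\<^sup>2) summable_on UNIV"
proof -
  let ?f = "\<lambda>m::int. 1 / (1 + \<bar>real_of_int m\<bar>)\<^sup>2"
  have "summable (\<lambda>n. inverse (real (Suc n) ^ 2))"
    using inverse_power_summable[of 2, where 'a=real] by (subst summable_Suc_iff) auto
  then have nat: "(\<lambda>n::nat. 1 / (1 + real n)\<^sup>2) summable_on UNIV"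
    by (subst summable_on_UNIV_nonneg_real_iff) (auto simp: inverse_eq_divide)
  have "?f summable_on range int"
    by (subst summable_on_reindex) (auto simp: inj_on_def o_def intro: nat)
  moreover have "?f summable_on range (\<lambda>n. - int n)"
    by (subst summable_on_reindex) (auto simp: inj_on_def o_def intro: nat)
  moreover have "(UNIV :: int set) = range int \<union> range (\<lambda>n. - int n)"
    by (auto intro: int_cases2)
  ultimately show ?thesis by (metis summable_on_union)
qed

text \<open>A product weight: its inverse square is summable by one-dimensional sums, it is
  submultiplicative, as convolutions require, and away from 0 it is still dominated by the quadratic
  form \<open>nu\<close>.\<close>

definition wt :: "int \<times> int \<Rightarrow> real" where
  "wt k = (1 + \<bar>real_of_int (fst k)\<bar>) * (1 + \<bar>real_of_int (snd k)\<bar>)"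

lemma wt_ge_1: "1 \<le> wt k"
  unfolding wt_def using mult_mono[of 1 "1 + \<bar>real_of_int (fst k)\<bar>" 1 "1 + \<bar>real_of_int (snd k)\<bar>"] by simp

lemma wt_pos: "0 < wt k"
  using wt_ge_1[of k] by linarith

lemma wt_submult: "wt (k + l) \<le> wt k * wt l"
proof -
  have *: "1 + \<bar>real_of_int (m + n)\<bar> \<le> (1 + \<bar>real_of_int m\<bar>) * (1 + \<bar>real_of_int n\<bar>)" for m n
  proof -
    have "\<bar>real_of_int (m + n)\<bar> \<le> \<bar>real_of_int m\<bar> + \<bar>real_of_int n\<bar>" by simp
    moreover have "0 \<le> \<bar>real_of_int m\<bar> * \<bar>real_of_int n\<bar>" by simp
    ultimately show ?thesis unfolding distrib_left distrib_right mult_1_left mult_1_right by linarith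
  qed
  have "wt (k + l) \<le> ((1 + \<bar>real_of_int (fst k)\<bar>) * (1 + \<bar>real_of_int (fst l)\<bar>))
      * ((1 + \<bar>real_of_int (snd k)\<bar>) * (1 + \<bar>real_of_int (snd l)\<bar>))"
    unfolding wt_def fst_add snd_add by (intro mult_mono *) auto
  then show ?thesis by (simp add: wt_def mult_ac)
qed

lemma wt_summable: "(\<lambda>k. 1 / wt k ^ 2) summable_on UNIV"
proof -
  let ?g = "\<lambda>m::int. 1 / (1 + \<bar>real_of_int m\<bar>)\<^sup>2"
  obtain S where S: "(?g has_sum S) UNIV"
    using summable_int_inverse_squares unfolding summable_on_def by blast
  have "(\<lambda>k. 1 / wt k ^ 2) summable_on Sigma UNIV (\<lambda>_. UNIV)"
  proof (rule summable_on_SigmaI)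
    show "((\<lambda>n. 1 / wt (m, n) ^ 2) has_sum ?g m * S) UNIV" for m
      using has_sum_cmult_right[OF S, of "?g m"] by (simp add: wt_def power_mult_distrib)
    show "(\<lambda>m. ?g m * S) summable_on UNIV"
      by (rule summable_on_cmult_left[OF summable_int_inverse_squares])
  qed simp
  then show ?thesis by simp
qed

definition rapid :: "(int \<times> int \<Rightarrow> complex) \<Rightarrow> bool" where
  "rapid a \<longleftrightarrow> (\<forall>s. \<exists>C. \<forall>k. norm (a k) * wt k ^ s \<le> C)"

lemma rapid_summable:
  assumes "rapid a"
  shows "(\<lambda>k. norm (a k) * wt k ^ s) summable_on UNIV"
proof -
  obtain C where C: "\<And>k. norm (a k) * wt k ^ (s + 2) \<le> C"
    using assms unfolding rapid_def by blast
  have "norm (a k) * wt k ^ s \<le> C * (1 / wt k ^ 2)" for k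
    using C[of k] wt_pos[of k] by (simp add: field_simps power_add power2_eq_square)
  then show ?thesis
    by (intro summable_on_comparison_test[OF summable_on_cmult_right[OF wt_summable, of C]])
      (simp_all add: wt_pos less_imp_le)
qed

lemma rapid_norm_summable: "rapid a \<Longrightarrow> (\<lambda>k. norm (a k)) summable_on UNIV"
  using rapid_summable[of a 0] by simp

lemma rapid_cmult: "rapid a \<Longrightarrow> rapid (\<lambda>k. c * a k)"
  unfolding rapid_def norm_mult mult.assoc by (meson mult_left_mono norm_ge_zero)

lemma rapid_mult_bound:
  assumes "rapid a" "\<And>k. norm (c k) \<le> K * wt k"
  shows "rapid (\<lambda>k. c k * a k)"
  unfolding rapid_def
proof
  fix s
  obtain C where C: "\<And>k. norm (a k) * wt k ^ Suc s \<le> C"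
    using assms(1) unfolding rapid_def by blast
  have "K \<ge> 0" using order_trans[OF norm_ge_zero assms(2)] wt_pos by (metis zero_le_mult_iff not_less)
  have "norm (c k * a k) * wt k ^ s \<le> K * C" for k
  proof -
    have "norm (c k * a k) * wt k ^ s \<le> (K * wt k) * (norm (a k) * wt k ^ s)"
      unfolding norm_mult mult.assoc[of "norm (c k)"]
      by (intro mult_right_mono assms(2)) (simp add: wt_pos less_imp_le)
    also have "\<dots> = K * (norm (a k) * wt k ^ Suc s)" by simp
    also have "\<dots> \<le> K * C" by (intro mult_left_mono C \<open>K \<ge> 0\<close>)
    finally show ?thesis .
  qed
  then show "\<exists>C. \<forall>k. norm (c k * a k) * wt k ^ s \<le> C" by blast
qed

context torus
begin

definition fc :: "(real^2 \<Rightarrow> real) \<Rightarrow> int \<times> int \<Rightarrow> complex" where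
  "fc f k = cf (\<lambda>x. of_real (f x)) k"

definition ser :: "(int \<times> int \<Rightarrow> complex) \<Rightarrow> real^2 \<Rightarrow> complex" where
  "ser c x = (\<Sum>\<^sub>\<infinity>k. c k * ch k x)"

lemma fc_eq:
  assumes "continuous_on UNIV f"
  shows "fc f k = Complex (avg (\<lambda>x. f x * cos ((2 * pi) *\<^sub>R freq k \<bullet> x)))
    (- avg (\<lambda>x. f x * sin ((2 * pi) *\<^sub>R freq k \<bullet> x)))"
proof -
  have c: "continuous_on UNIV (\<lambda>x. complex_of_real (f x) * cnj (ch k x))"
    by (intro continuous_intros assms)
  have "Re (fc f k) = avg (\<lambda>x. f x * cos ((2 * pi) *\<^sub>R freq k \<bullet> x))"
    using avg_bounded_linear[OF bounded_linear_Re c] by (simp add: fc_def cf_def ch_def)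
  moreover have "Im (fc f k) = avg (\<lambda>x. - (f x * sin ((2 * pi) *\<^sub>R freq k \<bullet> x)))"
    using avg_bounded_linear[OF bounded_linear_Im c] by (simp add: fc_def cf_def ch_def)
  moreover have "avg (\<lambda>x. - (f x * sin ((2 * pi) *\<^sub>R freq k \<bullet> x)))
      = - avg (\<lambda>x. f x * sin ((2 * pi) *\<^sub>R freq k \<bullet> x))"
    by (rule avg_bounded_linear[OF bounded_linear_minus[OF bounded_linear_ident]])
      (intro continuous_intros assms)
  ultimately show ?thesis by (simp add: complex_eq_iff)
qed

lemma periodic_cos: "periodic \<Gamma> (\<lambda>x. cos ((2 * pi) *\<^sub>R freq k \<bullet> x))"
  and periodic_sin: "periodic \<Gamma> (\<lambda>x. sin ((2 * pi) *\<^sub>R freq k \<bullet> x))"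
  using periodic_comp[OF periodic_ch, of Re k] periodic_comp[OF periodic_ch, of Im k]
  by (simp_all add: ch_def)

lemma avg_by_parts:
  assumes "smooth f" "periodic \<Gamma> f" "smooth g" "periodic \<Gamma> g"
  shows "avg (\<lambda>x. partial_deriv i f x * g x) = - avg (\<lambda>x. f x * partial_deriv i g x)"
proof -
  have "partial_deriv i (\<lambda>x. f x * g x) = (\<lambda>x. partial_deriv i f x * g x + f x * partial_deriv i g x)"
    by (intro ext partial_deriv_mult smooth_differentiable assms)
  moreover have "avg (partial_deriv i (\<lambda>x. f x * g x)) = 0"
    by (rule avg_partial_deriv[OF smooth_mult[OF assms(1,3)] periodic_comp2[OF assms(2,4)]])
  ultimately have "avg (\<lambda>x. partial_deriv i f x * g x + f x * partial_deriv i g x) = 0" by simp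
  then show ?thesis
    by (subst (asm) avg_add)
      (auto intro!: smooth_continuous smooth_mult smooth_partial_deriv assms)
qed

lemma
  assumes f: "smooth f" "periodic \<Gamma> f"
  shows avg_partial_cos: "avg (\<lambda>x. partial_deriv i f x * cos ((2 * pi) *\<^sub>R freq k \<bullet> x))
      = 2 * pi * freq k $ i * avg (\<lambda>x. f x * sin ((2 * pi) *\<^sub>R freq k \<bullet> x))"
    and avg_partial_sin: "avg (\<lambda>x. partial_deriv i f x * sin ((2 * pi) *\<^sub>R freq k \<bullet> x))
      = - (2 * pi * freq k $ i) * avg (\<lambda>x. f x * cos ((2 * pi) *\<^sub>R freq k \<bullet> x))"
proof -
  define c where "c = (2 * pi) *\<^sub>R freq k"
  have fc: "continuous_on UNIV (\<lambda>x. f x * cos (c \<bullet> x))" "continuous_on UNIV (\<lambda>x. f x * sin (c \<bullet> x))"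
    by (intro continuous_intros smooth_continuous f)+
  have "avg (\<lambda>x. partial_deriv i f x * cos (c \<bullet> x)) = - avg (\<lambda>x. f x * partial_deriv i (\<lambda>x. cos (c \<bullet> x)) x)"
    using smooth_cos[of 1 c] periodic_cos[of k] by (intro avg_by_parts f) (simp_all add: c_def)
  also have "(\<lambda>x. f x * partial_deriv i (\<lambda>x. cos (c \<bullet> x)) x) = (\<lambda>x. (- c $ i) * (f x * sin (c \<bullet> x)))"
    using partial_deriv_cos[of i 1 c] by auto
  finally show "avg (\<lambda>x. partial_deriv i f x * cos ((2 * pi) *\<^sub>R freq k \<bullet> x))
      = 2 * pi * freq k $ i * avg (\<lambda>x. f x * sin ((2 * pi) *\<^sub>R freq k \<bullet> x))"
    by (subst (asm) avg_cmult[OF fc(2)]) (simp add: c_def)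
  have "avg (\<lambda>x. partial_deriv i f x * sin (c \<bullet> x)) = - avg (\<lambda>x. f x * partial_deriv i (\<lambda>x. sin (c \<bullet> x)) x)"
    using smooth_sin[of 1 c] periodic_sin[of k] by (intro avg_by_parts f) (simp_all add: c_def)
  also have "(\<lambda>x. f x * partial_deriv i (\<lambda>x. sin (c \<bullet> x)) x) = (\<lambda>x. c $ i * (f x * cos (c \<bullet> x)))"
    using partial_deriv_sin[of i 1 c] by auto
  finally show "avg (\<lambda>x. partial_deriv i f x * sin ((2 * pi) *\<^sub>R freq k \<bullet> x))
      = - (2 * pi * freq k $ i) * avg (\<lambda>x. f x * cos ((2 * pi) *\<^sub>R freq k \<bullet> x))"
    by (subst (asm) avg_cmult[OF fc(1)]) (simp add: c_def)
qed

lemma fc_partial_deriv: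
  assumes f: "smooth f" "periodic \<Gamma> f"
  shows "fc (partial_deriv i f) k = \<i> * of_real (2 * pi * freq k $ i) * fc f k"
  using avg_partial_cos[OF f, of i k] avg_partial_sin[OF f, of i k]
  by (simp add: fc_eq smooth_continuous smooth_partial_deriv f complex_eq_iff)

lemma fc_bounded:
  assumes "continuous_on UNIV f" "\<And>x. \<bar>f x\<bar> \<le> M"
  shows "norm (fc f k) \<le> M"
  unfolding fc_def cf_def
  by (rule avg_norm_bound) (auto intro!: continuous_intros assms simp: norm_mult)

text \<open>With k = (m, n), expand \<open>wt k\<close> into 1 + |m| + |n| + |m||n|. Each factor |m|
  is paid for by \<partial>1 and each factor |n| by a \<partial>1 + b \<partial>2, so that one more
  power of \<open>wt\<close> costs derivatives of order at most two, to which the induction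
  hypothesis applies.\<close>

lemma rapid_fc:
  assumes "smooth f" "periodic \<Gamma> f"
  shows "rapid (fc f)"
  unfolding rapid_def
proof
  fix s
  show "\<exists>C. \<forall>k. norm (fc f k) * wt k ^ s \<le> C"
    using assms
  proof (induction s arbitrary: f)
    case 0
    obtain M where "\<And>x. norm (f x) \<le> M"
      using periodic_bounded[OF smooth_continuous] 0 by metis
    then have "norm (fc f k) * wt k ^ 0 \<le> M" for k
      using fc_bounded[OF smooth_continuous[OF 0(1)], of M k] by simp
    then show ?case by blast
  next
    case (Suc s)
    let ?P = "partial_deriv"
    have sm: "smooth (?P i g)" "periodic \<Gamma> (?P i g)" if "smooth g" "periodic \<Gamma> g" for i g
      using that by (auto intro: smooth_partial_deriv periodic_partial_deriv smooth_differentiable)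
    have m: "\<bar>real_of_int (fst k)\<bar> * norm (fc g k) \<le> norm (fc (?P 1 g) k)"
      if "smooth g" "periodic \<Gamma> g" for g k
    proof -
      have "norm (fc (?P 1 g) k) = 2 * pi * \<bar>real_of_int (fst k)\<bar> * norm (fc g k)"
        unfolding fc_partial_deriv[OF that] by (simp add: norm_mult freq_def abs_mult)
      moreover have "1 * (\<bar>real_of_int (fst k)\<bar> * norm (fc g k)) \<le> (2 * pi) * (\<bar>real_of_int (fst k)\<bar> * norm (fc g k))"
        using pi_gt3 by (intro mult_right_mono) auto
      ultimately show ?thesis by simp
    qed
    have n: "\<bar>real_of_int (snd k)\<bar> * norm (fc g k) \<le> \<bar>a\<bar> * norm (fc (?P 1 g) k) + b * norm (fc (?P 2 g) k)"
      if "smooth g" "periodic \<Gamma> g" for g k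
    proof -
      have eq: "real_of_int (snd k) = a * freq k $ 1 + b * freq k $ 2"
        using b_pos by (simp add: freq_def)
      have "\<i> * of_real (2 * pi * snd k) * fc g k = of_real a * fc (?P 1 g) k + of_real b * fc (?P 2 g) k"
        unfolding fc_partial_deriv[OF that] eq by (simp add: algebra_simps)
      then have "norm (\<i> * of_real (2 * pi * snd k) * fc g k) \<le> norm (of_real a * fc (?P 1 g) k) + norm (of_real b * fc (?P 2 g) k)"
        by (simp add: norm_triangle_ineq)
      then have "2 * pi * \<bar>real_of_int (snd k)\<bar> * norm (fc g k) \<le> \<bar>a\<bar> * norm (fc (?P 1 g) k) + b * norm (fc (?P 2 g) k)"
        using b_pos by (simp add: norm_mult abs_mult)
      moreover have "1 * (\<bar>real_of_int (snd k)\<bar> * norm (fc g k)) \<le> (2 * pi) * (\<bar>real_of_int (snd k)\<bar> * norm (fc g k))"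
        using pi_gt3 by (intro mult_right_mono) auto
      ultimately show ?thesis by simp
    qed
    let ?N = "\<lambda>k. norm (fc f k) + norm (fc (?P 1 f) k)
      + (\<bar>a\<bar> * norm (fc (?P 1 f) k) + b * norm (fc (?P 2 f) k))
      + (\<bar>a\<bar> * norm (fc (?P 1 (?P 1 f)) k) + b * norm (fc (?P 2 (?P 1 f)) k))"
    have N: "norm (fc f k) * wt k \<le> ?N k" for k
    proof -
      have "\<bar>real_of_int (snd k)\<bar> * (\<bar>real_of_int (fst k)\<bar> * norm (fc f k))
          \<le> \<bar>real_of_int (snd k)\<bar> * norm (fc (?P 1 f) k)"
        by (intro mult_left_mono m Suc.prems) simp
      also have "\<dots> \<le> \<bar>a\<bar> * norm (fc (?P 1 (?P 1 f)) k) + b * norm (fc (?P 2 (?P 1 f)) k)"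
        by (intro n sm Suc.prems)
      finally show ?thesis
        using m[OF Suc.prems, of k] n[OF Suc.prems, of k] unfolding wt_def by (simp add: algebra_simps)
    qed
    obtain C where C: "\<And>k. norm (fc f k) * wt k ^ s \<le> C" using Suc.IH[OF Suc.prems] by blast
    obtain C1 where C1: "\<And>k. norm (fc (?P 1 f) k) * wt k ^ s \<le> C1"
      using Suc.IH[OF sm[OF Suc.prems]] by blast
    obtain C2 where C2: "\<And>k. norm (fc (?P 2 f) k) * wt k ^ s \<le> C2"
      using Suc.IH[OF sm[OF Suc.prems]] by blast
    obtain C11 where C11: "\<And>k. norm (fc (?P 1 (?P 1 f)) k) * wt k ^ s \<le> C11"
      using Suc.IH[OF sm[OF sm[OF Suc.prems]]] by blast
    obtain C21 where C21: "\<And>k. norm (fc (?P 2 (?P 1 f)) k) * wt k ^ s \<le> C21"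
      using Suc.IH[OF sm[OF sm[OF Suc.prems]]] by blast
    have "norm (fc f k) * wt k ^ Suc s
        \<le> C + C1 + (\<bar>a\<bar> * C1 + b * C2) + (\<bar>a\<bar> * C11 + b * C21)" for k
    proof -
      have "norm (fc f k) * wt k ^ Suc s = norm (fc f k) * wt k * wt k ^ s" by simp
      also have "\<dots> \<le> ?N k * wt k ^ s"
        by (intro mult_right_mono N) (simp add: wt_pos less_imp_le)
      also have "\<dots> = norm (fc f k) * wt k ^ s + norm (fc (?P 1 f) k) * wt k ^ s
          + (\<bar>a\<bar> * (norm (fc (?P 1 f) k) * wt k ^ s) + b * (norm (fc (?P 2 f) k) * wt k ^ s))
          + (\<bar>a\<bar> * (norm (fc (?P 1 (?P 1 f)) k) * wt k ^ s) + b * (norm (fc (?P 2 (?P 1 f)) k) * wt k ^ s))"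
        by (simp add: algebra_simps)
      also have "\<dots> \<le> C + C1 + (\<bar>a\<bar> * C1 + b * C2) + (\<bar>a\<bar> * C11 + b * C21)"
        using b_pos by (intro add_mono mult_left_mono C C1 C2 C11 C21) auto
      finally show ?thesis .
    qed
    then show ?case by blast
  qed
qed

lemma avg_ch: "avg (ch k) = (if k = 0 then 1 else 0)"
proof (cases "k = 0")
  case True
  have "ch 0 = (\<lambda>x. 1)" by auto
  with True show ?thesis by simp
next
  case False
  have "freq k \<noteq> 0"
  proof
    assume "freq k = 0"
    then have "freq k $ 1 = 0" "freq k $ 2 = 0" by simp_all
    then have "fst k = 0" "snd k = 0" using b_pos by (simp_all add: freq_def)
    with False show False by (simp add: prod_eq_iff)
  qed
  then obtain i where i: "freq k $ i \<noteq> 0" by (metis vec_eq_iff zero_index)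
  have "avg (\<lambda>x. 1 * cos ((2 * pi) *\<^sub>R freq k \<bullet> x)) = 0" "avg (\<lambda>x. 1 * sin ((2 * pi) *\<^sub>R freq k \<bullet> x)) = 0"
    using avg_partial_cos[OF smooth_const periodic_const, of i 1 k]
      avg_partial_sin[OF smooth_const periodic_const, of i 1 k] i by simp_all
  moreover have "Re (avg (ch k)) = avg (\<lambda>x. Re (ch k x))" "Im (avg (ch k)) = avg (\<lambda>x. Im (ch k x))"
    by (simp_all add: avg_bounded_linear[OF bounded_linear_Re] avg_bounded_linear[OF bounded_linear_Im] continuous_ch)
  ultimately show ?thesis using False by (simp add: complex_eq_iff ch_def)
qed

context
  fixes c :: "int \<times> int \<Rightarrow> complex"
  assumes c: "(\<lambda>k. norm (c k)) summable_on UNIV"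
begin

lemma summable_ser: "(\<lambda>k. c k * ch k x) summable_on UNIV"
  by (rule abs_summable_summable) (simp add: norm_mult c)

lemma continuous_ser: "continuous_on UNIV (ser c)"
  unfolding ser_def[abs_def] using c
  by (intro continuous_on_infsum[where M="\<lambda>k. norm (c k)"]) (auto simp: norm_mult intro!: continuous_intros)

lemma periodic_ser: "periodic \<Gamma> (ser c)"
  using periodic_ch unfolding ser_def[abs_def] periodic_def by simp

lemma avg_mult_ser:
  assumes h: "continuous_on UNIV h" "periodic \<Gamma> h"
  shows "((\<lambda>k. c k * avg (\<lambda>x. h x * ch k x)) has_sum avg (\<lambda>x. h x * ser c x)) UNIV"
proof -
  have hc: "continuous_on S h" for S using h(1) continuous_on_subset by blast
  obtain M where M: "M > 0" "\<And>x. norm (h x) \<le> M" using periodic_bounded[OF h] by blast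
  have "((\<lambda>k. avg (\<lambda>x. h x * (c k * ch k x))) has_sum avg (\<lambda>x. \<Sum>\<^sub>\<infinity>k. h x * (c k * ch k x))) UNIV"
  proof (rule avg_infsum)
    show "norm (h x * (c k * ch k x)) \<le> M * norm (c k)" for k x
      using M(2)[of x] by (simp add: norm_mult mult_right_mono)
    show "(\<lambda>k. M * norm (c k)) summable_on UNIV" by (rule summable_on_cmult_right[OF c])
    show "continuous_on UNIV (\<lambda>x. h x * (c k * ch k x))" for k
      by (intro continuous_intros hc)
  qed
  moreover have "avg (\<lambda>x. h x * (c k * ch k x)) = c k * avg (\<lambda>x. h x * ch k x)" for k
    using avg_cmult[of "\<lambda>x. h x * ch k x" "c k"]
    by (simp add: mult.left_commute continuous_on_mult hc continuous_ch)
  moreover have "(\<Sum>\<^sub>\<infinity>k. h x * (c k * ch k x)) = h x * ser c x" for x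
    unfolding ser_def by (rule infsum_cmult_right[OF summable_ser])
  ultimately show ?thesis by simp
qed

lemma cf_ser: "cf (ser c) k = c k"
proof -
  have "((\<lambda>j. c j * avg (\<lambda>x. cnj (ch k x) * ch j x)) has_sum avg (\<lambda>x. cnj (ch k x) * ser c x)) UNIV"
    by (rule avg_mult_ser) (auto intro!: continuous_intros periodic_comp[OF periodic_ch])
  moreover have "avg (\<lambda>x. cnj (ch k x) * ch j x) = (if j = k then 1 else 0)" for j
  proof -
    have "(\<lambda>x. cnj (ch k x) * ch j x) = ch (j - k)"
      using ch_add[of j "- k"] by (auto simp: ch_uminus mult.commute)
    then show ?thesis by (simp add: avg_ch)
  qed
  ultimately have "((\<lambda>j. c j * (if j = k then 1 else 0)) has_sum cf (ser c) k) UNIV"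
    by (simp add: cf_def mult.commute)
  moreover have "((\<lambda>j. c j * (if j = k then 1 else 0)) has_sum c k) UNIV"
    by (rule has_sum_finite_neutralI[of "{k}"]) auto
  ultimately show ?thesis using has_sum_unique by blast
qed

end

text \<open>Rapid decay makes the series continuous; it has the same coefficients as
  \<open>f\<close>, and uniqueness applies.\<close>

lemma fourier_inversion:
  assumes f: "smooth f" "periodic \<Gamma> f"
  shows "of_real (f x) = ser (fc f) x"
proof -
  note s = rapid_norm_summable[OF rapid_fc[OF f]]
  note cs = continuous_ser[OF s] and fcont = smooth_continuous[OF f(1)]
  have sc: "continuous_on S (ser (fc f))" for S using cs continuous_on_subset by blast
  have "of_real (f x) - ser (fc f) x = 0"
  proof (rule fourier_uniqueness)
    show "continuous_on UNIV (\<lambda>x. of_real (f x) - ser (fc f) x)"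
      by (intro continuous_intros sc fcont)
    show "periodic \<Gamma> (\<lambda>x. of_real (f x) - ser (fc f) x)"
      by (rule periodic_comp2[OF f(2) periodic_ser[OF s]])
    show "cf (\<lambda>x. of_real (f x) - ser (fc f) x) k = 0" for k
    proof -
      have "cf (\<lambda>x. of_real (f x) - ser (fc f) x) k
          = avg (\<lambda>x. of_real (f x) * cnj (ch k x) - ser (fc f) x * cnj (ch k x))"
        by (simp add: cf_def left_diff_distrib)
      also have "\<dots> = fc f k - cf (ser (fc f)) k"
        unfolding fc_def[of f k] cf_def by (intro avg_diff continuous_intros sc fcont)
      finally show ?thesis using cf_ser[OF s] by simp
    qed
  qed
  then show ?thesis by simp
qed

lemma parseval:
  assumes f: "smooth f" "periodic \<Gamma> f"
  shows "((\<lambda>k. (norm (fc f k))\<^sup>2) has_sum avg (\<lambda>x. (f x)\<^sup>2)) UNIV"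
proof -
  note s = rapid_norm_summable[OF rapid_fc[OF f]]
  have fcont: "continuous_on S f" for S using smooth_continuous[OF f(1)] continuous_on_subset by blast
  have "((\<lambda>k. fc f k * avg (\<lambda>x. of_real (f x) * ch k x)) has_sum avg (\<lambda>x. of_real (f x) * ser (fc f) x)) UNIV"
    by (intro avg_mult_ser s periodic_comp[OF f(2)] continuous_intros fcont)
  moreover have "avg (\<lambda>x. of_real (f x) * ch k x) = cnj (fc f k)" for k
  proof -
    have "avg (\<lambda>x. cnj (of_real (f x) * cnj (ch k x))) = cnj (fc f k)"
      unfolding fc_def cf_def
      by (rule avg_bounded_linear[OF bounded_linear_cnj]) (intro continuous_intros fcont)
    then show ?thesis by simp
  qed
  moreover have "avg (\<lambda>x. of_real (f x) * ser (fc f) x) = complex_of_real (avg (\<lambda>x. (f x)\<^sup>2))"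
    unfolding fourier_inversion[OF f, symmetric]
  proof -
    have "avg (\<lambda>x. complex_of_real ((f x)\<^sup>2)) = complex_of_real (avg (\<lambda>x. (f x)\<^sup>2))"
      by (rule avg_bounded_linear[OF bounded_linear_of_real]) (intro continuous_intros fcont)
    then show "avg (\<lambda>x. of_real (f x) * complex_of_real (f x)) = complex_of_real (avg (\<lambda>x. (f x)\<^sup>2))"
      by (simp add: power2_eq_square)
  qed
  ultimately have "((\<lambda>k. complex_of_real ((norm (fc f k))\<^sup>2)) has_sum complex_of_real (avg (\<lambda>x. (f x)\<^sup>2))) UNIV"
    by (simp add: complex_norm_square[symmetric])
  then show ?thesis by (simp only: has_sum_of_real_iff)
qed

end

lemma has_sum_diff:
  fixes f g :: "'k \<Rightarrow> 'z::real_normed_vector"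
  assumes "(f has_sum x) A" "(g has_sum y) A"
  shows "((\<lambda>k. f k - g k) has_sum (x - y)) A"
  using has_sum_add[OF assms(1), of "\<lambda>k. - g k" "- y"] assms(2) by (simp add: has_sum_uminus)

context torus
begin

section \<open>Termwise differentiation of Fourier series\<close>

definition dcoeff :: "2 \<Rightarrow> (int \<times> int \<Rightarrow> complex) \<Rightarrow> int \<times> int \<Rightarrow> complex" where
  "dcoeff i c k = \<i> * of_real (2 * pi * freq k $ i) * c k"

lemma freq_bound: "\<exists>K. \<forall>k i. \<bar>2 * pi * freq k $ i\<bar> \<le> K * wt k"
proof -
  define K where "K = 2 * pi * (1 + (1 + \<bar>a\<bar>) / b)"
  have "\<bar>2 * pi * freq k $ i\<bar> \<le> K * wt k" for k i
  proof -
    define m n where "m = \<bar>real_of_int (fst k)\<bar>" and "n = \<bar>real_of_int (snd k)\<bar>"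
    have nn: "0 \<le> m" "0 \<le> n" by (simp_all add: m_def n_def)
    then have "0 \<le> m * n" by simp
    then have m: "m \<le> wt k" and n: "n \<le> wt k"
      unfolding wt_def m_def[symmetric] n_def[symmetric] using nn by (auto simp: algebra_simps)
    have "\<bar>freq k $ i\<bar> \<le> (1 + (1 + \<bar>a\<bar>) / b) * wt k"
    proof (cases "i = 1")
      case True
      have "m \<le> 1 * wt k" using m by simp
      also have "\<dots> \<le> (1 + (1 + \<bar>a\<bar>) / b) * wt k"
        using b_pos by (intro mult_right_mono) (auto simp: wt_pos less_imp_le)
      finally show ?thesis using True by (simp add: freq_def m_def)
    next
      case False
      then have i: "i = 2" using exhaust_2 by blast
      have "\<bar>freq k $ i\<bar> \<le> (n + \<bar>a\<bar> * m) / b"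
        using b_pos abs_triangle_ineq4[of "real_of_int (snd k)" "a * real_of_int (fst k)"]
        by (simp add: i freq_def abs_mult m_def n_def divide_right_mono)
      also have "\<dots> \<le> (wt k + \<bar>a\<bar> * wt k) / b"
        using b_pos m n by (intro divide_right_mono add_mono mult_left_mono) auto
      also have "\<dots> = 0 * wt k + ((1 + \<bar>a\<bar>) / b) * wt k" by (simp add: field_simps)
      also have "\<dots> \<le> (1 + (1 + \<bar>a\<bar>) / b) * wt k"
        unfolding distrib_right by (intro add_mono mult_right_mono) (auto simp: wt_pos less_imp_le)
      finally show ?thesis .
    qed
    then have "2 * pi * \<bar>freq k $ i\<bar> \<le> 2 * pi * ((1 + (1 + \<bar>a\<bar>) / b) * wt k)"
      by (intro mult_left_mono) auto
    then show ?thesis by (simp add: K_def abs_mult mult.assoc)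
  qed
  then show ?thesis by blast
qed

lemma rapid_dcoeff:
  assumes "rapid c"
  shows "rapid (dcoeff i c)"
proof -
  obtain K where K: "\<And>k i. \<bar>2 * pi * freq k $ i\<bar> \<le> K * wt k" using freq_bound by blast
  have "norm (\<i> * of_real (2 * pi * freq k $ i)) \<le> K * wt k" for k
    using K[of k i] by (simp only: norm_mult norm_of_real) simp
  from rapid_mult_bound[OF assms this] show ?thesis by (simp add: dcoeff_def[abs_def])
qed

lemma norm_cis_minus_linear: "norm (cis \<theta> - 1 - \<i> * of_real \<theta>) \<le> \<theta>\<^sup>2"
  using Taylor_exp[of "\<i> * of_real \<theta>" 1]
  by (simp add: cis_conv_exp norm_mult power2_eq_square diff_diff_eq)

text \<open>Each term has a Taylor remainder of at most |c k| \<theta>^2, where \<theta> is linear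
  in \<open>h\<close> and bounded by a multiple of \<open>wt k\<close>. Rapid decay makes the sum of
  the remainders finite and quadratic in \<open>h\<close>, which is total differentiability.\<close>

lemma has_derivative_ser:
  assumes c: "rapid c"
  shows "(ser c has_derivative (\<lambda>h. of_real (h $ 1) * ser (dcoeff 1 c) x + of_real (h $ 2) * ser (dcoeff 2 c) x)) (at x)"
proof -
  obtain K where K: "\<And>k i. \<bar>2 * pi * freq k $ i\<bar> \<le> K * wt k" using freq_bound by blast
  have K0: "0 \<le> K" using K[of 0 1] by (simp add: wt_def)
  note s0 = summable_ser[OF rapid_norm_summable[OF c]]
  note s = summable_ser[OF rapid_norm_summable[OF rapid_dcoeff[OF c]]]
  define C where "C = (\<Sum>\<^sub>\<infinity>k. norm (c k) * wt k ^ 2)"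
  have C: "((\<lambda>k. norm (c k) * wt k ^ 2) has_sum C) UNIV"
    unfolding C_def by (rule has_sum_infsum[OF rapid_summable[OF c]])
  let ?D = "\<lambda>h :: real^2. of_real (h $ 1) * ser (dcoeff 1 c) x + of_real (h $ 2) * ser (dcoeff 2 c) x"
  have bound: "norm (ser c (x + h) - ser c x - ?D h) \<le> (4 * K\<^sup>2 * (norm h)\<^sup>2) * C" for h
  proof (rule norm_infsum_le)
    show "((\<lambda>k. c k * ch k (x + h) - c k * ch k x
        - (of_real (h $ 1) * (dcoeff 1 c k * ch k x) + of_real (h $ 2) * (dcoeff 2 c k * ch k x)))
        has_sum (ser c (x + h) - ser c x - ?D h)) UNIV"
      unfolding ser_def
      by (intro has_sum_diff has_sum_add has_sum_cmult_right has_sum_infsum s0 s)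
    show "((\<lambda>k. (4 * K\<^sup>2 * (norm h)\<^sup>2) * (norm (c k) * wt k ^ 2)) has_sum (4 * K\<^sup>2 * (norm h)\<^sup>2) * C) UNIV"
      by (rule has_sum_cmult_right[OF C])
    fix k
    define \<theta> where "\<theta> = (2 * pi * freq k $ 1) * h $ 1 + (2 * pi * freq k $ 2) * h $ 2"
    have \<theta>: "(2 * pi) *\<^sub>R freq k \<bullet> h = \<theta>"
      by (simp add: \<theta>_def inner_vec_def sum_2 algebra_simps)
    have "c k * ch k (x + h) - c k * ch k x
        - (of_real (h $ 1) * (dcoeff 1 c k * ch k x) + of_real (h $ 2) * (dcoeff 2 c k * ch k x))
        = c k * ch k x * (cis \<theta> - 1 - \<i> * of_real \<theta>)"
    proof -
      have "ch k (x + h) = ch k x * cis \<theta>" unfolding \<theta>[symmetric] by (simp add: ch_def inner_add_right cis_mult distrib_left)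
      then show ?thesis unfolding dcoeff_def \<theta>_def by (simp add: algebra_simps)
    qed
    moreover have "\<bar>\<theta>\<bar> \<le> 2 * K * wt k * norm h"
    proof -
      have "\<bar>\<theta>\<bar> \<le> \<bar>2 * pi * freq k $ 1\<bar> * \<bar>h $ 1\<bar> + \<bar>2 * pi * freq k $ 2\<bar> * \<bar>h $ 2\<bar>"
        unfolding \<theta>_def abs_mult[symmetric] by (rule abs_triangle_ineq)
      also have "\<dots> \<le> (K * wt k) * norm h + (K * wt k) * norm h"
        using K0 wt_pos[of k] by (intro add_mono mult_mono K component_le_norm_cart) auto
      finally show ?thesis by (simp add: mult_ac)
    qed
    then have "\<theta>\<^sup>2 \<le> (2 * K * wt k * norm h)\<^sup>2" by (rule abs_le_square_iff[THEN iffD1, OF order_trans[OF _ abs_ge_self]])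
    then have "norm (cis \<theta> - 1 - \<i> * of_real \<theta>) \<le> 4 * K\<^sup>2 * (norm h)\<^sup>2 * wt k ^ 2"
      using norm_cis_minus_linear[of \<theta>] by (simp add: power_mult_distrib mult_ac)
    then have "norm (c k) * norm (cis \<theta> - 1 - \<i> * of_real \<theta>) \<le> norm (c k) * (4 * K\<^sup>2 * (norm h)\<^sup>2 * wt k ^ 2)"
      by (intro mult_left_mono) auto
    ultimately show "norm (c k * ch k (x + h) - c k * ch k x
        - (of_real (h $ 1) * (dcoeff 1 c k * ch k x) + of_real (h $ 2) * (dcoeff 2 c k * ch k x)))
        \<le> (4 * K\<^sup>2 * (norm h)\<^sup>2) * (norm (c k) * wt k ^ 2)"
      by (simp only: norm_mult norm_ch) (simp add: mult_ac)
  qed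
  have lin: "bounded_linear ?D"
  proof -
    have *: "bounded_linear (\<lambda>h :: real^2. of_real (h $ i) * w)" for i :: 2 and w :: complex
      by (intro bounded_linear_compose[OF bounded_linear_mult_left]
          bounded_linear_compose[OF bounded_linear_of_real] bounded_linear_vec_nth)
    show ?thesis by (intro bounded_linear_add *)
  qed
  show ?thesis
    unfolding has_derivative_at
  proof (rule conjI[OF lin])
    have "(\<lambda>h :: real^2. 4 * K\<^sup>2 * C * norm h) \<midarrow>0\<rightarrow> 4 * K\<^sup>2 * C * norm (0 :: real^2)"
      by (intro tendsto_mult_left tendsto_norm tendsto_ident_at)
    then have lim: "(\<lambda>h :: real^2. 4 * K\<^sup>2 * C * norm h) \<midarrow>0\<rightarrow> 0" by simp
    show "(\<lambda>h. norm (ser c (x + h) - ser c x - ?D h) / norm h) \<midarrow>0\<rightarrow> 0"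
    proof (rule Lim_null_comparison[OF _ lim], unfold eventually_at_filter, rule always_eventually,
        intro allI impI)
      fix h :: "real^2" assume "h \<noteq> 0"
      then show "norm (norm (ser c (x + h) - ser c x - ?D h) / norm h) \<le> 4 * K\<^sup>2 * C * norm h"
        using bound[of h] by (simp add: divide_le_eq power2_eq_square mult_ac)
    qed
  qed
qed

lemma
  assumes "rapid c"
  shows differentiable_Re_ser: "(\<lambda>x. Re (ser c x)) differentiable (at x)"
    and partial_deriv_Re_ser: "partial_deriv i (\<lambda>x. Re (ser c x)) = (\<lambda>x. Re (ser (dcoeff i c) x))"
proof -
  let ?D = "\<lambda>x (h :: real^2). of_real (h $ 1) * ser (dcoeff 1 c) x + of_real (h $ 2) * ser (dcoeff 2 c) x"
  have d: "((\<lambda>x. Re (ser c x)) has_derivative (\<lambda>h. Re (?D x h))) (at x)" for x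
    by (rule bounded_linear.has_derivative[OF bounded_linear_Re has_derivative_ser[OF assms]])
  show "(\<lambda>x. Re (ser c x)) differentiable (at x)" using d differentiable_def by blast
  show "partial_deriv i (\<lambda>x. Re (ser c x)) = (\<lambda>x. Re (ser (dcoeff i c) x))"
  proof
    fix x
    show "partial_deriv i (\<lambda>x. Re (ser c x)) x = Re (ser (dcoeff i c) x)"
      unfolding partial_deriv_eqI[OF d] using exhaust_2[of i] by (auto simp: axis_def)
  qed
qed

lemma smooth_Re_ser:
  assumes "rapid c"
  shows "smooth (\<lambda>x. Re (ser c x))"
proof (rule smooth_coinduct)
  show "(\<lambda>x. Re (ser c x)) \<in> {\<lambda>x. Re (ser c x) | c. rapid c}" using assms by blast
  fix g i assume "g \<in> {\<lambda>x. Re (ser c x) | c. rapid c}"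
  then obtain c where c: "rapid c" "g = (\<lambda>x. Re (ser c x))" by blast
  then show "partial_deriv i g \<in> {\<lambda>x. Re (ser c x) | c. rapid c}"
    using partial_deriv_Re_ser[OF c(1)] rapid_dcoeff[OF c(1)] by blast
qed (use differentiable_Re_ser in auto)

text \<open>The eigenvalue of the flat Laplacian on \<open>ch k\<close>.\<close>

definition nu :: "int \<times> int \<Rightarrow> real" where
  "nu k = (2 * pi * freq k $ 1)\<^sup>2 + (2 * pi * freq k $ 2)\<^sup>2"

text \<open>The Dirichlet energy divided by the flat area \<open>b\<close>. By conformal invariance
  in dimension two it is computed with the flat metric for every member of the class.\<close>

definition dir :: "(real^2 \<Rightarrow> real) \<Rightarrow> real" where
  "dir f = avg (\<lambda>x. (partial_deriv 1 f x)\<^sup>2 + (partial_deriv 2 f x)\<^sup>2)"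

lemma nu_nonneg: "0 \<le> nu k" by (simp add: nu_def)

text \<open>|m||n| is at most (m^2 + n^2) / 2, and m^2 + n^2 >= 1 for nonzero integer vectors. The
  bound serves as a spectral gap and, in the regularity argument, as the gain of one power of
  \<open>wt\<close>.\<close>

lemma nu_lower: "\<exists>c>0. \<forall>k. k \<noteq> 0 \<longrightarrow> c * wt k \<le> nu k"
proof -
  define A where "A = 3 * (1 + 2 * a\<^sup>2 + 2 * b\<^sup>2)"
  have A: "A > 0" by (simp add: A_def add_pos_nonneg)
  have "(1 / A) * wt k \<le> nu k" if k: "k \<noteq> 0" for k
  proof -
    define m n y where "m = real_of_int (fst k)" and "n = real_of_int (snd k)" and "y = freq k $ 2"
    have n: "n = a * m + b * y" using b_pos by (simp add: n_def m_def y_def freq_def)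
    have "fst k \<noteq> 0 \<or> snd k \<noteq> 0" using k by (auto simp: prod_eq_iff)
    then have "1 \<le> (fst k)\<^sup>2 \<or> 1 \<le> (snd k)\<^sup>2" by (auto simp: int_one_le_iff_zero_less)
    then have "1 \<le> m\<^sup>2 \<or> 1 \<le> n\<^sup>2" unfolding m_def n_def by (metis of_int_1 of_int_le_iff of_int_power)
    then have mn: "1 \<le> m\<^sup>2 + n\<^sup>2" by (metis add_increasing add_increasing2 zero_le_power2)
    have "wt k = (1 + \<bar>m\<bar>) * (1 + \<bar>n\<bar>)" by (simp add: wt_def m_def n_def)
    also have "\<dots> \<le> 2 + \<bar>m\<bar>\<^sup>2 + \<bar>n\<bar>\<^sup>2"
      using zero_le_power2[of "\<bar>m\<bar> - \<bar>n\<bar>"] zero_le_power2[of "\<bar>m\<bar> - 1"] zero_le_power2[of "\<bar>n\<bar> - 1"]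
      by (simp add: power2_eq_square algebra_simps)
    also have "\<dots> \<le> 3 * (m\<^sup>2 + n\<^sup>2)" using mn by simp
    also have "n\<^sup>2 \<le> 2 * a\<^sup>2 * m\<^sup>2 + 2 * b\<^sup>2 * y\<^sup>2"
      unfolding n using zero_le_power2[of "a * m - b * y"] by (simp add: power2_eq_square algebra_simps)
    also have "m\<^sup>2 + (2 * a\<^sup>2 * m\<^sup>2 + 2 * b\<^sup>2 * y\<^sup>2) \<le> (1 + 2 * a\<^sup>2 + 2 * b\<^sup>2) * (m\<^sup>2 + y\<^sup>2)"
      by (simp add: algebra_simps)
    finally have "wt k \<le> A * (m\<^sup>2 + y\<^sup>2)" unfolding A_def mult.assoc by simp
    moreover have "1 * (m\<^sup>2 + y\<^sup>2) \<le> (2 * pi)\<^sup>2 * (m\<^sup>2 + y\<^sup>2)"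
      using pi_gt3 by (intro mult_right_mono one_le_power) auto
    moreover have "nu k = (2 * pi)\<^sup>2 * (m\<^sup>2 + y\<^sup>2)"
      unfolding nu_def y_def power_mult_distrib distrib_left by (simp add: m_def freq_def)
    ultimately have "wt k \<le> A * nu k" using A by (smt (verit) mult_left_mono)
    then show ?thesis using A by (simp add: field_simps)
  qed
  then show ?thesis using A by (meson zero_less_divide_1_iff)
qed

lemma dir_eq:
  assumes "smooth f"
  shows "dir f = avg (\<lambda>x. (partial_deriv 1 f x)\<^sup>2) + avg (\<lambda>x. (partial_deriv 2 f x)\<^sup>2)"
  unfolding dir_def using smooth_continuous[OF smooth_partial_deriv[OF assms]]
  by (intro avg_add continuous_on_power)

lemma dir_nonneg: "smooth f \<Longrightarrow> 0 \<le> dir f"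
  unfolding dir_eq using smooth_continuous[OF smooth_partial_deriv]
  by (intro add_nonneg_nonneg avg_nonneg continuous_on_power) auto

lemma dir_parseval:
  assumes f: "smooth f" "periodic \<Gamma> f"
  shows "((\<lambda>k. nu k * (norm (fc f k))\<^sup>2) has_sum dir f) UNIV"
proof -
  have "((\<lambda>k. (norm (fc (partial_deriv i f) k))\<^sup>2) has_sum avg (\<lambda>x. (partial_deriv i f x)\<^sup>2)) UNIV" for i
    by (intro parseval smooth_partial_deriv f periodic_partial_deriv smooth_differentiable)
  from has_sum_add[OF this[of 1] this[of 2]] show ?thesis
    unfolding fc_partial_deriv[OF f] dir_eq[OF f(1)]
    by (simp only: norm_mult norm_ii norm_of_real power_mult_distrib power2_abs)
      (simp add: nu_def power_mult_distrib distrib_right)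
qed

end

section \<open>The first eigenvalue of a conformal metric\<close>

text \<open>Tychonoff: the product of closed discs is compact, and metrizable because the index set
  is countable. This takes the place of weak compactness in a Sobolev space.\<close>

lemma bounded_family_subseq:
  fixes F :: "nat \<Rightarrow> 'i::countable \<Rightarrow> complex"
  assumes "\<And>n i. norm (F n i) \<le> K"
  obtains r a where "strict_mono r" "\<And>i. (\<lambda>n. F (r n) i) \<longlonglongrightarrow> a i"
proof -
  let ?S = "PiE UNIV (\<lambda>_. cball 0 K) :: ('i \<Rightarrow> complex) set"
  have "compactin (product_topology (\<lambda>_. euclidean) UNIV) ?S"
    by (simp add: compactin_PiE)
  then have "compact ?S" by (simp add: euclidean_product_topology)
  then have "seq_compact ?S" using compact_eq_seq_compact_metric by blast
  moreover have "\<forall>n. F n \<in> ?S" using assms by auto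
  ultimately obtain a r where ar: "strict_mono (r :: nat \<Rightarrow> nat)" "(F \<circ> r) \<longlonglongrightarrow> a"
    unfolding seq_compact_def by meson
  have "(\<lambda>n. F (r n) i) \<longlonglongrightarrow> a i" for i
    using continuous_on_tendsto_compose[OF continuous_on_product_coordinates ar(2), of i]
    by (simp add: o_def)
  with ar(1) show ?thesis using that by blast
qed

text \<open>Dominated convergence for sums: the majorant makes the finite partial sums converge
  uniformly in \<open>n\<close>, so that the two limits may be exchanged.\<close>

lemma infsum_dominated_tendsto:
  fixes f :: "nat \<Rightarrow> 'i \<Rightarrow> complex"
  assumes lim: "\<And>j. (\<lambda>n. f n j) \<longlonglongrightarrow> g j" and bound: "\<And>n j. norm (f n j) \<le> M j"
    and M: "M summable_on UNIV"
  shows "(\<lambda>n. \<Sum>\<^sub>\<infinity>j. f n j) \<longlonglongrightarrow> (\<Sum>\<^sub>\<infinity>j. g j)"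
proof (rule swap_uniform_limit')
  show "\<forall>\<^sub>F X in finite_subsets_at_top UNIV. (\<lambda>n. \<Sum>j\<in>X. f n j) \<longlonglongrightarrow> (\<Sum>j\<in>X. g j)"
    by (intro always_eventually allI tendsto_sum lim)
  have "norm (g j) \<le> M j" for j
    by (rule LIMSEQ_le_const2[OF tendsto_norm[OF lim]]) (use bound in blast)
  then have "(\<lambda>j. norm (g j)) summable_on UNIV"
    by (intro summable_on_comparison_test[OF M]) auto
  then show "((\<lambda>X. \<Sum>j\<in>X. g j) \<longlongrightarrow> (\<Sum>\<^sub>\<infinity>j. g j)) (finite_subsets_at_top UNIV)"
    by (intro infsum_tendsto abs_summable_summable[of g])
  show "uniform_limit UNIV (\<lambda>X n. \<Sum>j\<in>X. f n j) (\<lambda>n. \<Sum>\<^sub>\<infinity>j. f n j) (finite_subsets_at_top UNIV)"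
    by (rule Weierstrass_m_test_general[OF bound M])
qed auto

context torus
begin

lemma avg_lin3:
  fixes p q r :: "real^2 \<Rightarrow> real"
  assumes "continuous_on UNIV p" "continuous_on UNIV q" "continuous_on UNIV r"
  shows "avg (\<lambda>x. p x + c * q x + d * r x) = avg p + c * avg q + d * avg r"
  using assms by (simp add: avg_add avg_cmult continuous_on_add continuous_on_mult_left)

text \<open>Multiplication becomes convolution; the weight \<open>w\<close> thereby acts on
  coefficients, where limits are taken one index at a time.\<close>

lemma cf_mult_ser:
  assumes h: "continuous_on UNIV h" "periodic \<Gamma> h" and c: "(\<lambda>k. norm (c k)) summable_on UNIV"
  shows "((\<lambda>j. c j * fc h (k - j)) has_sum cf (\<lambda>x. of_real (h x) * ser c x) k) UNIV"
proof -
  have hc: "continuous_on S h" for S using h(1) continuous_on_subset by blast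
  have per: "periodic \<Gamma> (\<lambda>x. of_real (h x) * cnj (ch k x))"
    using h(2) periodic_ch by (simp add: periodic_def)
  have "((\<lambda>j. c j * avg (\<lambda>x. of_real (h x) * cnj (ch k x) * ch j x))
      has_sum avg (\<lambda>x. of_real (h x) * cnj (ch k x) * ser c x)) UNIV"
    by (intro avg_mult_ser c per continuous_intros hc)
  moreover have "(\<lambda>x. of_real (h x) * cnj (ch k x) * ch j x) = (\<lambda>x. of_real (h x) * cnj (ch (k - j) x))" for j
    using ch_add[of k "- j"] by (simp add: ch_uminus mult.assoc)
  moreover have "(\<lambda>x. of_real (h x) * cnj (ch k x) * ser c x) = (\<lambda>x. of_real (h x) * ser c x * cnj (ch k x))"
    by (simp add: mult_ac)
  ultimately show ?thesis unfolding fc_def cf_def by (simp only:)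
qed

end

locale conformal_factor = torus +
  fixes w :: "real^2 \<Rightarrow> real"
  assumes w_smooth: "smooth w" and w_periodic: "periodic \<Gamma> w" and w_pos: "\<And>x. 0 < w x"
begin

section \<open>Mass, energy and the inverse Rayleigh quotient\<close>

definition adm :: "(real^2 \<Rightarrow> real) \<Rightarrow> bool" where
  "adm f \<longleftrightarrow> smooth f \<and> periodic \<Gamma> f \<and> avg (\<lambda>x. w x * f x) = 0"

definition mass :: "(real^2 \<Rightarrow> real) \<Rightarrow> real" where
  "mass f = avg (\<lambda>x. w x * (f x)\<^sup>2)"

text \<open>The supremum of the inverse Rayleigh quotient, shown in \<open>lambda1_eq\<close> to be
  the reciprocal of the first eigenvalue. In this form the constraint bounds the energy, and bounded
  energy prevents mass from escaping to high frequencies.\<close>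

definition \<kappa> :: real where
  "\<kappa> = Sup {mass f | f. adm f \<and> dir f \<le> 1}"

lemma w_cont: "continuous_on S w"
  using smooth_continuous[OF w_smooth] continuous_on_subset by blast

lemma w_bounds: obtains w0 W where "0 < w0" "0 < W" "\<And>x. w0 \<le> w x" "\<And>x. w x \<le> W"
proof -
  obtain W where W: "0 < W" "\<And>x. norm (w x) \<le> W"
    using periodic_bounded[OF w_cont w_periodic] by blast
  have "continuous_on UNIV (\<lambda>x. inverse (w x))"
    by (intro continuous_intros w_cont) (metis w_pos less_irrefl)
  then obtain V where V: "0 < V" "\<And>x. norm (inverse (w x)) \<le> V"
    using periodic_bounded[OF _ periodic_comp[OF w_periodic, of inverse]] by blast
  have "inverse V \<le> w x" for x
    using V w_pos[of x] by (metis abs_of_pos inverse_inverse_eq le_imp_inverse_le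
      positive_imp_inverse_positive real_norm_def)
  moreover have "w x \<le> W" for x using W(2)[of x] by simp
  ultimately show ?thesis using that[of "inverse V" W] V W by simp
qed

lemma avg_w_pos: "0 < avg w"
  using avg_pos[OF w_cont w_periodic less_imp_le[OF w_pos]] w_pos by (metis less_irrefl)

lemma admD: "adm f \<Longrightarrow> smooth f" "adm f \<Longrightarrow> periodic \<Gamma> f" "adm f \<Longrightarrow> avg (\<lambda>x. w x * f x) = 0"
  by (simp_all add: adm_def)

lemma dir_diff_const:
  assumes "smooth f"
  shows "dir (\<lambda>x. f x - c) = dir f"
proof -
  have "partial_deriv i (\<lambda>x. f x - c) = partial_deriv i f" for i
    using partial_deriv_diff[OF smooth_differentiable[OF assms] smooth_differentiable[OF smooth_const]]
    by fastforce
  then show ?thesis by (simp add: dir_def)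
qed

lemma adm_centre:
  assumes "smooth f" "periodic \<Gamma> f"
  shows "adm (\<lambda>x. f x - avg (\<lambda>x. w x * f x) / avg w)"
proof -
  have fc: "continuous_on UNIV f" by (rule smooth_continuous[OF assms(1)])
  define m where "m = avg (\<lambda>x. w x * f x) / avg w"
  have "avg (\<lambda>x. w x * f x - m * w x) = avg (\<lambda>x. w x * f x) - m * avg w"
    by (simp add: avg_diff avg_cmult continuous_on_mult w_cont fc continuous_on_const)
  also have "\<dots> = 0" using avg_w_pos by (simp add: m_def)
  finally have "avg (\<lambda>x. w x * (f x - m)) = 0" by (simp add: algebra_simps)
  then show ?thesis
    using assms unfolding adm_def m_def[symmetric]
    by (simp add: smooth_diff smooth_const periodic_def)
qed

lemma adm_add:
  assumes "adm f" "adm g"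
  shows "adm (\<lambda>x. f x + s * g x)"
proof -
  have c: "continuous_on UNIV f" "continuous_on UNIV g"
    using assms by (auto simp: adm_def smooth_continuous)
  have "avg (\<lambda>x. w x * f x + s * (w x * g x)) = 0"
    using admD(3)[OF assms(1)] admD(3)[OF assms(2)]
    by (simp add: avg_add avg_cmult continuous_on_mult w_cont c continuous_on_const)
  moreover have "periodic \<Gamma> (\<lambda>x. f x + s * g x)"
    using assms by (simp add: adm_def periodic_def)
  ultimately show ?thesis
    using assms unfolding adm_def by (auto simp: algebra_simps intro!: smooth_add smooth_mult smooth_const)
qed

lemma mass_nonneg: "smooth f \<Longrightarrow> 0 \<le> mass f"
  unfolding mass_def
  by (intro avg_nonneg continuous_on_mult w_cont continuous_on_power smooth_continuous)
    (simp_all add: less_imp_le[OF w_pos])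

text \<open>As the \<open>w\<close>-mean of \<open>f\<close> is zero, subtracting the unweighted
  mean can only increase the mass. The zeroth coefficient is then gone, and Parseval with the
  spectral gap compares mean square and energy.\<close>

lemma poincare: "\<exists>C>0. \<forall>f. adm f \<longrightarrow> mass f \<le> C * dir f"
proof -
  obtain W where W: "0 < W" "\<And>x. w x \<le> W" using w_bounds by metis
  obtain c where c: "0 < c" "\<And>k. k \<noteq> 0 \<Longrightarrow> c * wt k \<le> nu k" using nu_lower by blast
  have "mass f \<le> W / c * dir f" if f: "adm f" for f
  proof -
    note f' = admD[OF f]
    have fcont: "continuous_on S f" for S
      using smooth_continuous[OF f'(1)] continuous_on_subset by blast
    define m where "m = avg f"
    define g where "g x = f x - m" for x
    have g: "smooth g" "periodic \<Gamma> g"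
      unfolding g_def[abs_def] using f' by (simp_all add: smooth_diff smooth_const periodic_def)
    have gc: "continuous_on S g" for S
      using smooth_continuous[OF g(1)] continuous_on_subset by blast
    have "avg g = 0" unfolding g_def[abs_def] by (subst avg_diff) (auto simp: fcont m_def)
    then have fc0: "fc g 0 = 0"
      by (subst fc_eq[OF gc]) (simp add: freq_def inner_vec_def sum_2 complex_eq_iff)
    have "mass g = avg (\<lambda>x. w x * (f x)\<^sup>2 + (- 2 * m) * (w x * f x) + m\<^sup>2 * w x)"
      unfolding mass_def g_def by (rule arg_cong[where f=avg]) (auto simp: power2_eq_square algebra_simps)
    also have "\<dots> = mass f + m\<^sup>2 * avg w"
      by (subst avg_lin3) (auto intro!: continuous_intros w_cont fcont simp: f'(3) mass_def)
    finally have "mass f \<le> mass g" using avg_w_pos by (simp add: zero_le_mult_iff)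
    also have "\<dots> \<le> avg (\<lambda>x. W * (g x)\<^sup>2)"
      unfolding mass_def by (intro avg_mono continuous_intros w_cont gc mult_right_mono W(2)) auto
    also have "\<dots> = W * avg (\<lambda>x. (g x)\<^sup>2)" by (intro avg_cmult continuous_intros gc)
    also have "avg (\<lambda>x. (g x)\<^sup>2) \<le> inverse c * dir g"
    proof (rule has_sum_mono[OF parseval[OF g] has_sum_cmult_right[OF dir_parseval[OF g]]])
      fix k
      show "(norm (fc g k))\<^sup>2 \<le> inverse c * (nu k * (norm (fc g k))\<^sup>2)"
      proof (cases "k = 0")
        case False
        have "c * 1 \<le> c * wt k" using c(1) wt_ge_1 by (intro mult_left_mono) auto
        then have "c \<le> nu k" using c(2)[OF False] by linarith
        then have "1 \<le> inverse c * nu k" using c(1) by (simp add: field_simps)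
        then have "1 * (norm (fc g k))\<^sup>2 \<le> (inverse c * nu k) * (norm (fc g k))\<^sup>2"
          by (rule mult_right_mono) simp
        then show ?thesis by (simp add: mult.assoc)
      qed (simp add: fc0)
    qed
    also have "dir g = dir f" unfolding g_def[abs_def] by (rule dir_diff_const[OF f'(1)])
    finally show ?thesis using W(1) by (simp add: field_simps)
  qed
  then show ?thesis using W(1) c(1) by (metis divide_pos_pos)
qed

lemma zero_adm: "adm (\<lambda>x. 0)" "dir (\<lambda>x. 0) = 0" "mass (\<lambda>x. 0) = 0"
  by (simp_all add: adm_def smooth_const periodic_const dir_def mass_def)

lemma mass_le_\<kappa>:
  assumes "adm f" "dir f \<le> 1"
  shows "mass f \<le> \<kappa>"
proof -
  obtain C where C: "C > 0" "\<And>f. adm f \<Longrightarrow> mass f \<le> C * dir f" using poincare by blast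
  have "bdd_above {mass f | f. adm f \<and> dir f \<le> 1}"
  proof (rule bdd_aboveI)
    fix y assume "y \<in> {mass f | f. adm f \<and> dir f \<le> 1}"
    then obtain f where f: "y = mass f" "adm f" "dir f \<le> 1" by blast
    then have "y \<le> C * dir f" using C(2) by simp
    also have "\<dots> \<le> C * 1" using C(1) f(3) by (intro mult_left_mono) auto
    finally show "y \<le> C" by simp
  qed
  then show ?thesis unfolding \<kappa>_def using assms by (intro cSup_upper) auto
qed

lemma \<kappa>_nonneg: "0 \<le> \<kappa>"
  using mass_le_\<kappa>[OF zero_adm(1)] zero_adm by simp

lemma scale:
  assumes "smooth f"
  shows "dir (\<lambda>x. s * f x) = s\<^sup>2 * dir f" "mass (\<lambda>x. s * f x) = s\<^sup>2 * mass f"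
proof -
  have "partial_deriv i (\<lambda>x. s * f x) = (\<lambda>x. s * partial_deriv i f x)" for i
    using partial_deriv_cmult[OF smooth_differentiable[OF assms]] by blast
  then have "dir (\<lambda>x. s * f x) = avg (\<lambda>x. s\<^sup>2 * ((partial_deriv 1 f x)\<^sup>2 + (partial_deriv 2 f x)\<^sup>2))"
    by (simp add: dir_def power_mult_distrib distrib_left)
  also have "\<dots> = s\<^sup>2 * dir f" unfolding dir_def
    by (intro avg_cmult continuous_on_add continuous_on_power smooth_continuous smooth_partial_deriv assms)
  finally show "dir (\<lambda>x. s * f x) = s\<^sup>2 * dir f" .
  have "mass (\<lambda>x. s * f x) = avg (\<lambda>x. s\<^sup>2 * (w x * (f x)\<^sup>2))"
    by (simp add: mass_def power_mult_distrib mult_ac)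
  also have "\<dots> = s\<^sup>2 * mass f" unfolding mass_def
    by (intro avg_cmult continuous_on_mult w_cont continuous_on_power smooth_continuous assms)
  finally show "mass (\<lambda>x. s * f x) = s\<^sup>2 * mass f" .
qed

lemma rayleigh:
  assumes f: "adm f"
  shows "mass f \<le> \<kappa> * dir f"
proof (cases "dir f = 0")
  case True
  then show ?thesis using poincare f by (metis mult_zero_right)
next
  case False
  define d where "d = dir f"
  have d: "d > 0" using False dir_nonneg[OF admD(1)[OF f]] by (simp add: d_def)
  define s where "s = 1 / sqrt d"
  have s: "s\<^sup>2 = 1 / d" using d by (simp add: s_def power_divide)
  have "adm (\<lambda>x. 0 + s * f x)" by (rule adm_add[OF zero_adm(1) f])
  moreover have "dir (\<lambda>x. s * f x) = 1" using d by (simp add: scale(1)[OF admD(1)[OF f]] s d_def[symmetric])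
  ultimately have "mass (\<lambda>x. s * f x) \<le> \<kappa>" using mass_le_\<kappa> by simp
  then show ?thesis using d unfolding scale(2)[OF admD(1)[OF f]] s d_def[symmetric]
    by (simp add: field_simps)
qed

lemma \<kappa>_pos: "0 < \<kappa>"
proof -
  define c where "c = (2 * pi) *\<^sub>R freq (1, 0)"
  define g where "g x = cos (c \<bullet> x)" for x
  have g: "smooth g" "periodic \<Gamma> g"
    using smooth_cos[of 1 c] periodic_cos[of "(1, 0)"] by (simp_all add: g_def[abs_def] c_def)
  define m where "m = avg (\<lambda>x. w x * g x) / avg w"
  define f where "f x = g x - m" for x
  have f: "adm f" unfolding f_def m_def by (rule adm_centre[OF g])
  \<comment> \<open>A function taking the values 1 and -1 does not vanish identically after
    subtraction of a constant.\<close>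
  have "g (pt (0, 0)) = 1" "g (pt (1/2, 0)) = -1" by (simp_all add: g_def c_def freq_inner_pt)
  then have "f (pt (0, 0)) \<noteq> 0 \<or> f (pt (1/2, 0)) \<noteq> 0" by (auto simp: f_def)
  then obtain x where x: "f x \<noteq> 0" by blast
  have "0 < mass f" unfolding mass_def
  proof (rule avg_pos)
    show "continuous_on UNIV (\<lambda>x. w x * (f x)\<^sup>2)"
      by (intro continuous_on_mult w_cont continuous_on_power smooth_continuous admD(1)[OF f])
    show "periodic \<Gamma> (\<lambda>x. w x * (f x)\<^sup>2)"
      using admD(2)[OF f] w_periodic by (simp add: periodic_def)
    show "0 \<le> w x * (f x)\<^sup>2" for x using w_pos[of x] by simp
    show "w x * (f x)\<^sup>2 \<noteq> 0" using x w_pos[of x] by simp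
  qed
  then have "0 < \<kappa> * dir f" using rayleigh[OF f] by linarith
  then show ?thesis using \<kappa>_nonneg by (metis less_eq_real_def mult_zero_left)
qed

definition dirb :: "(real^2 \<Rightarrow> real) \<Rightarrow> (real^2 \<Rightarrow> real) \<Rightarrow> real" where
  "dirb f g = avg (\<lambda>x. partial_deriv 1 f x * partial_deriv 1 g x + partial_deriv 2 f x * partial_deriv 2 g x)"

definition massb :: "(real^2 \<Rightarrow> real) \<Rightarrow> (real^2 \<Rightarrow> real) \<Rightarrow> real" where
  "massb f g = avg (\<lambda>x. w x * (f x * g x))"

lemma quadratic_expansion:
  assumes f: "smooth f" and g: "smooth g"
  shows "dir (\<lambda>x. f x + s * g x) = dir f + 2 * s * dirb f g + s\<^sup>2 * dir g"
    and "mass (\<lambda>x. f x + s * g x) = mass f + 2 * s * massb f g + s\<^sup>2 * mass g"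
proof -
  note cont = smooth_continuous[OF f] smooth_continuous[OF g] w_cont
    smooth_continuous[OF smooth_partial_deriv[OF f]] smooth_continuous[OF smooth_partial_deriv[OF g]]
  have "partial_deriv i (\<lambda>x. f x + s * g x) = (\<lambda>x. partial_deriv i f x + s * partial_deriv i g x)" for i
    using partial_deriv_add[OF smooth_differentiable[OF f] smooth_differentiable[OF smooth_mult[OF smooth_const[of s] g]]]
      partial_deriv_cmult[OF smooth_differentiable[OF g]] by auto
  then have "dir (\<lambda>x. f x + s * g x) = avg (\<lambda>x. ((partial_deriv 1 f x)\<^sup>2 + (partial_deriv 2 f x)\<^sup>2)
      + (2 * s) * (partial_deriv 1 f x * partial_deriv 1 g x + partial_deriv 2 f x * partial_deriv 2 g x)
      + s\<^sup>2 * ((partial_deriv 1 g x)\<^sup>2 + (partial_deriv 2 g x)\<^sup>2))"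
    unfolding dir_def by (intro arg_cong[where f=avg]) (auto simp: power2_eq_square algebra_simps)
  also have "\<dots> = dir f + 2 * s * dirb f g + s\<^sup>2 * dir g"
    unfolding dir_def dirb_def
    by (intro avg_lin3 continuous_on_add continuous_on_mult continuous_on_power cont)
  finally show "dir (\<lambda>x. f x + s * g x) = dir f + 2 * s * dirb f g + s\<^sup>2 * dir g" .
  have "mass (\<lambda>x. f x + s * g x) = avg (\<lambda>x. w x * (f x)\<^sup>2 + (2 * s) * (w x * (f x * g x)) + s\<^sup>2 * (w x * (g x)\<^sup>2))"
    unfolding mass_def by (intro arg_cong[where f=avg]) (auto simp: power2_eq_square algebra_simps)
  also have "\<dots> = mass f + 2 * s * massb f g + s\<^sup>2 * mass g"
    unfolding mass_def massb_def
    by (intro avg_lin3 continuous_on_mult continuous_on_power cont)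
  finally show "mass (\<lambda>x. f x + s * g x) = mass f + 2 * s * massb f g + s\<^sup>2 * mass g" .
qed

text \<open>An approximate Euler-Lagrange equation: the Rayleigh inequality for
  \<open>f + s g\<close> is quadratic in \<open>s\<close> with constant term at most
  \<open>e\<close>. The values \<open>sqrt e\<close> and \<open>- sqrt e\<close> of \<open>s\<close>
  bring the constant and the quadratic term to the same order.\<close>

lemma near_maximizer:
  assumes f: "adm f" "dir f \<le> 1" "\<kappa> - e < mass f" and e: "0 < e" and g: "adm g"
  shows "\<bar>\<kappa> * dirb f g - massb f g\<bar> \<le> sqrt e * (1 + \<kappa> * dir g)"
proof -
  define R where "R = \<kappa> * dirb f g - massb f g"
  have *: "- (2 * s * R) \<le> e + s\<^sup>2 * (\<kappa> * dir g)" for s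
  proof -
    have "\<kappa> * dir f \<le> \<kappa> * 1" using f(2) \<kappa>_nonneg by (intro mult_left_mono)
    moreover have "mass f + 2 * s * massb f g + s\<^sup>2 * mass g
        \<le> \<kappa> * (dir f + 2 * s * dirb f g + s\<^sup>2 * dir g)"
      using rayleigh[OF adm_add[OF f(1) g, of s]]
      by (simp add: quadratic_expansion[OF admD(1)[OF f(1)] admD(1)[OF g]])
    moreover have "0 \<le> s\<^sup>2 * mass g" using mass_nonneg[OF admD(1)[OF g]] by simp
    moreover have "2 * s * R = 2 * s * (\<kappa> * dirb f g) - 2 * s * massb f g"
      by (simp add: R_def right_diff_distrib)
    moreover have "\<kappa> * (dir f + 2 * s * dirb f g + s\<^sup>2 * dir g)
      = \<kappa> * dir f + 2 * s * (\<kappa> * dirb f g) + s\<^sup>2 * (\<kappa> * dir g)" by (simp add: algebra_simps)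
    ultimately show ?thesis using f(3) by linarith
  qed
  have "2 * sqrt e * \<bar>R\<bar> \<le> e * (1 + \<kappa> * dir g)"
    using *[of "sqrt e"] *[of "- sqrt e"] e by (cases "R \<ge> 0") (auto simp: algebra_simps)
  also have "\<dots> = sqrt e * (sqrt e * (1 + \<kappa> * dir g))" using e by (simp add: mult.assoc[symmetric])
  finally have "sqrt e * (2 * \<bar>R\<bar>) \<le> sqrt e * (sqrt e * (1 + \<kappa> * dir g))" by (simp add: mult_ac)
  then have "2 * \<bar>R\<bar> \<le> sqrt e * (1 + \<kappa> * dir g)" using e by simp
  then show ?thesis unfolding R_def[symmetric] using abs_ge_zero[of R] by linarith
qed

section \<open>From a maximizing sequence to a smooth eigenfunction\<close>

lemma maximizing_sequence:
  obtains f where "\<And>n. adm (f n)" "\<And>n. dir (f n) \<le> 1" "\<And>n. \<kappa> - 1 / real (Suc n) < mass (f n)"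
proof -
  have "\<exists>f. adm f \<and> dir f \<le> 1 \<and> \<kappa> - 1 / real (Suc n) < mass f" for n
  proof (rule ccontr)
    assume "\<nexists>f. adm f \<and> dir f \<le> 1 \<and> \<kappa> - 1 / real (Suc n) < mass f"
    then have "\<kappa> \<le> \<kappa> - 1 / real (Suc n)"
      unfolding \<kappa>_def using zero_adm by (intro cSup_least) (auto simp: not_less)
    then show False by simp
  qed
  then show ?thesis using that by metis
qed

text \<open>Real and imaginary part are the weak equation tested against cosine and sine of
  frequency \<open>k\<close>. Centring makes the test functions admissible and changes nothing:
  gradients ignore constants, and \<open>f\<close> has \<open>w\<close>-mean zero.\<close>

lemma eigen_residual:
  obtains g h where "adm g" "adm h"
    "\<And>f. adm f \<Longrightarrow> of_real (\<kappa> * nu k) * fc f k - fc (\<lambda>x. w x * f x) k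
      = Complex (\<kappa> * dirb f g - massb f g) (- (\<kappa> * dirb f h - massb f h))"
proof -
  define c where "c = (2 * pi) *\<^sub>R freq k"
  define \<alpha> where "\<alpha> = avg (\<lambda>x. w x * cos (c \<bullet> x)) / avg w"
  define \<beta> where "\<beta> = avg (\<lambda>x. w x * sin (c \<bullet> x)) / avg w"
  define g where "g x = cos (c \<bullet> x) - \<alpha>" for x
  define h where "h x = sin (c \<bullet> x) - \<beta>" for x
  have sm: "smooth (\<lambda>x. cos (c \<bullet> x))" "smooth (\<lambda>x. sin (c \<bullet> x))"
    using smooth_cos[of 1 c] smooth_sin[of 1 c] by simp_all
  have gh: "adm g" "adm h"
    unfolding g_def \<alpha>_def h_def \<beta>_def using periodic_cos[of k] periodic_sin[of k]
    by (intro adm_centre sm; simp add: c_def)+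
  have pg: "partial_deriv i g = (\<lambda>x. - c $ i * sin (c \<bullet> x))" for i
    unfolding g_def[abs_def] using partial_deriv_cos[of i 1 c]
      partial_deriv_diff[OF smooth_differentiable[OF sm(1)] smooth_differentiable[OF smooth_const]] by auto
  have ph: "partial_deriv i h = (\<lambda>x. c $ i * cos (c \<bullet> x))" for i
    unfolding h_def[abs_def] using partial_deriv_sin[of i 1 c]
      partial_deriv_diff[OF smooth_differentiable[OF sm(2)] smooth_differentiable[OF smooth_const]] by auto
  have "of_real (\<kappa> * nu k) * fc f k - fc (\<lambda>x. w x * f x) k
      = Complex (\<kappa> * dirb f g - massb f g) (- (\<kappa> * dirb f h - massb f h))" if f: "adm f" for f
  proof -
    note f' = admD[OF f]
    have fcont: "continuous_on S f" for S
      using smooth_continuous[OF f'(1)] continuous_on_subset by blast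
    have pc: "continuous_on S (partial_deriv i f)" for S i
      using smooth_continuous[OF smooth_partial_deriv[OF f'(1)]] continuous_on_subset by blast
    have nu: "nu k = (c $ 1)\<^sup>2 + (c $ 2)\<^sup>2" by (simp add: nu_def c_def)
    have trig: "continuous_on S (\<lambda>x. cos (c \<bullet> x))" "continuous_on S (\<lambda>x. sin (c \<bullet> x))" for S
      by (intro continuous_intros)+
    have "dirb f g = avg (\<lambda>x. (- c $ 1) * (partial_deriv 1 f x * sin (c \<bullet> x)) + (- c $ 2) * (partial_deriv 2 f x * sin (c \<bullet> x)))"
      unfolding dirb_def pg by (rule arg_cong[where f=avg]) (auto simp: algebra_simps)
    also have "\<dots> = (- c $ 1) * avg (\<lambda>x. partial_deriv 1 f x * sin (c \<bullet> x)) + (- c $ 2) * avg (\<lambda>x. partial_deriv 2 f x * sin (c \<bullet> x))"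
      using avg_lin3[of "\<lambda>x. 0" "\<lambda>x. partial_deriv 1 f x * sin (c \<bullet> x)" "\<lambda>x. partial_deriv 2 f x * sin (c \<bullet> x)" "- c $ 1" "- c $ 2"]
      by (simp add: continuous_on_mult pc trig continuous_on_const)
    also have "\<dots> = nu k * avg (\<lambda>x. f x * cos (c \<bullet> x))"
      using avg_partial_sin[OF f'(1,2), of 1 k] avg_partial_sin[OF f'(1,2), of 2 k]
      by (simp add: c_def nu_def power2_eq_square algebra_simps)
    finally have dg: "dirb f g = nu k * avg (\<lambda>x. f x * cos (c \<bullet> x))" .
    have "dirb f h = avg (\<lambda>x. c $ 1 * (partial_deriv 1 f x * cos (c \<bullet> x)) + c $ 2 * (partial_deriv 2 f x * cos (c \<bullet> x)))"
      unfolding dirb_def ph by (rule arg_cong[where f=avg]) (auto simp: algebra_simps)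
    also have "\<dots> = c $ 1 * avg (\<lambda>x. partial_deriv 1 f x * cos (c \<bullet> x)) + c $ 2 * avg (\<lambda>x. partial_deriv 2 f x * cos (c \<bullet> x))"
      using avg_lin3[of "\<lambda>x. 0" "\<lambda>x. partial_deriv 1 f x * cos (c \<bullet> x)" "\<lambda>x. partial_deriv 2 f x * cos (c \<bullet> x)" "c $ 1" "c $ 2"]
      by (simp add: continuous_on_mult pc trig continuous_on_const)
    also have "\<dots> = nu k * avg (\<lambda>x. f x * sin (c \<bullet> x))"
      using avg_partial_cos[OF f'(1,2), of 1 k] avg_partial_cos[OF f'(1,2), of 2 k]
      by (simp add: c_def nu_def power2_eq_square algebra_simps)
    finally have dh: "dirb f h = nu k * avg (\<lambda>x. f x * sin (c \<bullet> x))" .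
    have "massb f g = avg (\<lambda>x. w x * f x * cos (c \<bullet> x) - \<alpha> * (w x * f x))"
      unfolding massb_def g_def by (rule arg_cong[where f=avg]) (auto simp: algebra_simps)
    also have "\<dots> = avg (\<lambda>x. w x * f x * cos (c \<bullet> x))"
      by (simp add: avg_diff avg_cmult continuous_on_mult w_cont fcont trig continuous_on_const f'(3))
    finally have mg: "massb f g = avg (\<lambda>x. w x * f x * cos (c \<bullet> x))" .
    have "massb f h = avg (\<lambda>x. w x * f x * sin (c \<bullet> x) - \<beta> * (w x * f x))"
      unfolding massb_def h_def by (rule arg_cong[where f=avg]) (auto simp: algebra_simps)
    also have "\<dots> = avg (\<lambda>x. w x * f x * sin (c \<bullet> x))"
      by (simp add: avg_diff avg_cmult continuous_on_mult w_cont fcont trig continuous_on_const f'(3))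
    finally have mh: "massb f h = avg (\<lambda>x. w x * f x * sin (c \<bullet> x))" .
    show ?thesis
      unfolding fc_eq[OF fcont] fc_eq[OF continuous_on_mult[OF w_cont fcont]] dg dh mg mh
      by (simp add: complex_eq_iff c_def)
  qed
  with gh show ?thesis using that by blast
qed

lemma rapid_w: "rapid (fc w)"
  by (rule rapid_fc[OF w_smooth w_periodic])

lemma summable_shift:
  assumes "(\<lambda>j. F j) summable_on (UNIV :: (int \<times> int) set)"
  shows "(\<lambda>j. F (k - j)) summable_on UNIV" "(\<Sum>\<^sub>\<infinity>j. F (k - j)) = (\<Sum>\<^sub>\<infinity>j. F j :: real)"
proof -
  have "bij_betw (\<lambda>j. k - j) UNIV (UNIV :: (int \<times> int) set)"
    by (rule bij_betwI[where g="\<lambda>j. k - j"]) auto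
  from summable_on_reindex_bij_betw[OF this, of F] infsum_reindex_bij_betw[OF this, of F] assms
  show "(\<lambda>j. F (k - j)) summable_on UNIV" "(\<Sum>\<^sub>\<infinity>j. F (k - j)) = (\<Sum>\<^sub>\<infinity>j. F j)" by simp_all
qed

text \<open>The coefficients converge one by one. The equation survives because the convolution is
  dominated by the summable coefficients of \<open>w\<close>; the limit is nonzero because bounded
  energy keeps a fixed share of the mass in finitely many frequencies.\<close>

lemma limit_coefficients:
  obtains c K where "\<And>k. norm (c k) \<le> K"
    "\<And>k. of_real (\<kappa> * nu k) * c k = (\<Sum>\<^sub>\<infinity>j. c j * fc w (k - j))" "\<exists>k. c k \<noteq> 0"
proof -
  obtain w0 W where W: "0 < w0" "0 < W" "\<And>x. w0 \<le> w x" "\<And>x. w x \<le> W" using w_bounds by metis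
  obtain f where f: "\<And>n. adm (f n)" "\<And>n. dir (f n) \<le> 1" "\<And>n. \<kappa> - 1 / real (Suc n) < mass (f n)"
    using maximizing_sequence by blast
  note fs = admD(1)[OF f(1)] and fp = admD(2)[OF f(1)]
  have fcont: "continuous_on S (f n)" for S n
    using smooth_continuous[OF fs] continuous_on_subset by blast
  define K where "K = sqrt (\<kappa> / w0)"
  have K: "norm (fc (f n) k) \<le> K" for n k
  proof -
    have "w0 * avg (\<lambda>x. (f n x)\<^sup>2) = avg (\<lambda>x. w0 * (f n x)\<^sup>2)"
      by (intro avg_cmult[symmetric] continuous_on_power fcont)
    also have "\<dots> \<le> mass (f n)" unfolding mass_def
      by (intro avg_mono continuous_on_mult w_cont continuous_on_power fcont continuous_on_const
          mult_right_mono W(3)) simp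
    also have "\<dots> \<le> \<kappa>" by (rule mass_le_\<kappa>[OF f(1,2)])
    finally have "avg (\<lambda>x. (f n x)\<^sup>2) \<le> \<kappa> / w0" using W(1) by (simp add: field_simps)
    moreover have "(norm (fc (f n) k))\<^sup>2 \<le> avg (\<lambda>x. (f n x)\<^sup>2)"
      using finite_sum_le_has_sum[OF parseval[OF fs fp], of "{k}" n] by simp
    ultimately show ?thesis unfolding K_def by (intro real_le_rsqrt) simp
  qed
  obtain r c where r: "strict_mono r" and c: "\<And>k. (\<lambda>n. fc (f (r n)) k) \<longlonglongrightarrow> c k"
    using bounded_family_subseq[of "\<lambda>n. fc (f n)" K] K by blast
  have cK: "norm (c k) \<le> K" for k
    by (rule LIMSEQ_le_const2[OF tendsto_norm[OF c]]) (use K in blast)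
  have inv0: "(\<lambda>n. 1 / real (Suc n)) \<longlonglongrightarrow> 0"
    using LIMSEQ_inverse_real_of_nat by (simp add: inverse_eq_divide)
  have eq: "of_real (\<kappa> * nu k) * c k = (\<Sum>\<^sub>\<infinity>j. c j * fc w (k - j))" for k
  proof -
    define res where "res n = of_real (\<kappa> * nu k) * fc (f n) k - fc (\<lambda>x. w x * f n x) k" for n
    obtain g h where gh: "adm g" "adm h"
      and eqn: "\<And>f. adm f \<Longrightarrow> of_real (\<kappa> * nu k) * fc f k - fc (\<lambda>x. w x * f x) k
        = Complex (\<kappa> * dirb f g - massb f g) (- (\<kappa> * dirb f h - massb f h))"
      using eigen_residual[of k] by blast
    have "norm (res n) \<le> sqrt (1 / real (Suc n)) * ((1 + \<kappa> * dir g) + (1 + \<kappa> * dir h))" for n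
    proof -
      have "norm (res n) \<le> \<bar>\<kappa> * dirb (f n) g - massb (f n) g\<bar> + \<bar>\<kappa> * dirb (f n) h - massb (f n) h\<bar>"
        using cmod_le[of "res n"] unfolding res_def eqn[OF f(1)] by simp
      then show ?thesis
        using near_maximizer[OF f(1,2,3) _ gh(1), of n] near_maximizer[OF f(1,2,3) _ gh(2), of n]
        by (simp add: distrib_left)
    qed
    moreover have "(\<lambda>n. sqrt (1 / real (Suc n)) * ((1 + \<kappa> * dir g) + (1 + \<kappa> * dir h))) \<longlonglongrightarrow> 0"
      using tendsto_mult_left_zero[OF tendsto_real_sqrt[OF inv0, simplified]] by simp
    ultimately have "res \<longlonglongrightarrow> 0"
      by (intro Lim_null_comparison[of res]) (auto intro: always_eventually)
    then have res0: "(\<lambda>n. res (r n)) \<longlonglongrightarrow> 0"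
      using LIMSEQ_subseq_LIMSEQ[OF _ r] by (force simp: o_def)
    have conv: "fc (\<lambda>x. w x * f n x) k = (\<Sum>\<^sub>\<infinity>j. fc (f n) j * fc w (k - j))" for n
    proof -
      have "((\<lambda>j. fc (f n) j * fc w (k - j)) has_sum cf (\<lambda>x. of_real (w x) * ser (fc (f n)) x) k) UNIV"
        by (intro cf_mult_ser w_cont w_periodic rapid_norm_summable rapid_fc fs fp)
      then show ?thesis
        unfolding fourier_inversion[OF fs fp, symmetric] by (simp add: fc_def infsumI)
    qed
    have "(\<lambda>n. \<Sum>\<^sub>\<infinity>j. fc (f (r n)) j * fc w (k - j)) \<longlonglongrightarrow> (\<Sum>\<^sub>\<infinity>j. c j * fc w (k - j))"
    proof (rule infsum_dominated_tendsto)
      show "(\<lambda>n. fc (f (r n)) j * fc w (k - j)) \<longlonglongrightarrow> c j * fc w (k - j)" for j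
        by (intro tendsto_mult c tendsto_const)
      show "norm (fc (f (r n)) j * fc w (k - j)) \<le> K * norm (fc w (k - j))" for n j
        using K by (simp add: norm_mult mult_right_mono)
      show "(\<lambda>j. K * norm (fc w (k - j))) summable_on UNIV"
        by (intro summable_on_cmult_right summable_shift(1)[of "\<lambda>j. norm (fc w j)"]
            rapid_norm_summable rapid_w)
    qed
    then have "(\<lambda>n. res (r n)) \<longlonglongrightarrow> of_real (\<kappa> * nu k) * c k - (\<Sum>\<^sub>\<infinity>j. c j * fc w (k - j))"
      unfolding res_def conv by (intro tendsto_diff tendsto_mult_left c)
    with res0 show ?thesis using LIMSEQ_unique by fastforce
  qed
  have nz: "\<exists>k. c k \<noteq> 0"
  proof (rule ccontr)
    assume "\<nexists>k. c k \<noteq> 0"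
    obtain e where e: "0 < e" "\<And>k. k \<noteq> 0 \<Longrightarrow> e * wt k \<le> nu k" using nu_lower by blast
    \<comment> \<open>Chosen so that the frequencies outside \<open>F\<close> contribute at most W /
      (e M) = \<kappa> / 4 to the mass. If all limits were zero, the mass, which tends to \<kappa>,
      could not exceed \<kappa> / 4 in the limit.\<close>
    define M where "M = 4 * W / (e * \<kappa>)"
    have M: "0 < M" using W(2) e(1) \<kappa>_pos by (simp add: M_def)
    define F where "F = insert 0 {k. wt k \<le> M}"
    have "finite F"
    proof -
      have "{k. wt k \<le> M} \<subseteq> {-\<lceil>M\<rceil>..\<lceil>M\<rceil>} \<times> {-\<lceil>M\<rceil>..\<lceil>M\<rceil>}"
      proof
        fix k assume "k \<in> {k. wt k \<le> M}"
        then have k: "wt k \<le> M" by simp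
        define m n where "m = \<bar>real_of_int (fst k)\<bar>" and "n = \<bar>real_of_int (snd k)\<bar>"
        have "0 \<le> m" "0 \<le> n" "0 \<le> m * n" by (simp_all add: m_def n_def)
        moreover have "1 + m + n + m * n \<le> M"
          using k by (simp add: wt_def m_def n_def algebra_simps)
        ultimately have "m \<le> M" "n \<le> M" by linarith+
        then have "\<bar>fst k\<bar> \<le> \<lceil>M\<rceil>" "\<bar>snd k\<bar> \<le> \<lceil>M\<rceil>"
          unfolding m_def n_def by linarith+
        then show "k \<in> {-\<lceil>M\<rceil>..\<lceil>M\<rceil>} \<times> {-\<lceil>M\<rceil>..\<lceil>M\<rceil>}" by (cases k) auto
      qed
      then show ?thesis unfolding F_def by (meson finite.insertI finite_SigmaI finite_atLeastAtMost_int finite_subset)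
    qed
    have bound: "\<kappa> - 1 / real (Suc n) \<le> W * (\<Sum>k\<in>F. (norm (fc (f n) k))\<^sup>2) + \<kappa> / 4" for n
    proof -
      have "\<kappa> - 1 / real (Suc n) \<le> mass (f n)" using f(3)[of n] by simp
      also have "\<dots> \<le> avg (\<lambda>x. W * (f n x)\<^sup>2)" unfolding mass_def
        by (intro avg_mono continuous_on_mult w_cont continuous_on_power fcont continuous_on_const
            mult_right_mono W(4)) simp
      also have "\<dots> = W * avg (\<lambda>x. (f n x)\<^sup>2)"
        by (intro avg_cmult continuous_on_power fcont)
      also have "avg (\<lambda>x. (f n x)\<^sup>2) \<le> (\<Sum>k\<in>F. (norm (fc (f n) k))\<^sup>2) + 1 / (e * M) * dir (f n)"
      proof (rule has_sum_mono[OF parseval[OF fs fp]])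
        show "((\<lambda>k. (if k \<in> F then (norm (fc (f n) k))\<^sup>2 else 0) + 1 / (e * M) * (nu k * (norm (fc (f n) k))\<^sup>2))
            has_sum (\<Sum>k\<in>F. (norm (fc (f n) k))\<^sup>2) + 1 / (e * M) * dir (f n)) UNIV"
          by (intro has_sum_add has_sum_cmult_right dir_parseval fs fp
              has_sum_finite_neutralI[OF \<open>finite F\<close>]) auto
        fix k
        show "(norm (fc (f n) k))\<^sup>2 \<le> (if k \<in> F then (norm (fc (f n) k))\<^sup>2 else 0) + 1 / (e * M) * (nu k * (norm (fc (f n) k))\<^sup>2)"
        proof (cases "k \<in> F")
          case True
          then show ?thesis using M e(1) nu_nonneg[of k] by simp
        next
          case False
          then have "e * M \<le> e * wt k" "k \<noteq> 0" using e(1) by (auto simp: F_def)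
          then have "e * M \<le> nu k" using e(2) by fastforce
          then have "1 \<le> 1 / (e * M) * nu k" using e(1) M by (simp add: field_simps)
          then have "1 * (norm (fc (f n) k))\<^sup>2 \<le> (1 / (e * M) * nu k) * (norm (fc (f n) k))\<^sup>2"
            by (rule mult_right_mono) simp
          then show ?thesis using False by (simp only: if_False mult.assoc)
        qed
      qed
      also have "1 / (e * M) * dir (f n) \<le> 1 / (e * M) * 1"
        using e(1) M f(2) by (intro mult_left_mono) auto
      also have "W * ((\<Sum>k\<in>F. (norm (fc (f n) k))\<^sup>2) + 1 / (e * M) * 1)
          = W * (\<Sum>k\<in>F. (norm (fc (f n) k))\<^sup>2) + \<kappa> / 4"
        using W(2) e(1) \<kappa>_pos by (simp add: M_def distrib_left)
      finally show ?thesis using W(2) by (simp add: mult_left_mono)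
    qed
    have "(\<lambda>n. \<kappa> - 1 / real (Suc (r n))) \<longlonglongrightarrow> \<kappa> - 0"
      using LIMSEQ_subseq_LIMSEQ[OF inv0 r] by (intro tendsto_diff tendsto_const) (simp add: o_def)
    moreover have "(\<lambda>n. W * (\<Sum>k\<in>F. (norm (fc (f (r n)) k))\<^sup>2) + \<kappa> / 4)
        \<longlonglongrightarrow> W * (\<Sum>k\<in>F. (norm (c k))\<^sup>2) + \<kappa> / 4"
      by (intro tendsto_intros c)
    ultimately have "\<kappa> - 0 \<le> W * (\<Sum>k\<in>F. (norm (c k))\<^sup>2) + \<kappa> / 4"
      by (rule LIMSEQ_le) (use bound in blast)
    moreover have "c k = 0" for k using \<open>\<nexists>k. c k \<noteq> 0\<close> by blast
    ultimately show False using \<kappa>_pos by simp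
  qed
  show ?thesis using that cK eq nz by blast
qed

text \<open>Bootstrapping: convolution with the rapid coefficients of \<open>w\<close> preserves a
  decay rate by submultiplicativity of \<open>wt\<close>, and division by
  \<open>\<kappa> * nu k\<close> gains one power of \<open>wt\<close>. At the index 0, where
  \<open>nu\<close> vanishes, the weight is 1 and the bound \<open>K\<close> suffices.\<close>

lemma eigen_coeffs_rapid:
  assumes K: "\<And>k. norm (c k) \<le> K"
    and eq: "\<And>k. of_real (\<kappa> * nu k) * c k = (\<Sum>\<^sub>\<infinity>j. c j * fc w (k - j))"
  shows "rapid c"
  unfolding rapid_def
proof
  fix s
  show "\<exists>C. \<forall>k. norm (c k) * wt k ^ s \<le> C"
  proof (induction s)
    case 0
    then show ?case using K by auto
  next
    case (Suc s)
    then obtain C where C: "\<And>k. norm (c k) * wt k ^ s \<le> C" by blast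
    obtain e where e: "0 < e" "\<And>k. k \<noteq> 0 \<Longrightarrow> e * wt k \<le> nu k" using nu_lower by blast
    define S where "S = (\<Sum>\<^sub>\<infinity>j. norm (fc w j) * wt j ^ s)"
    note sum = summable_shift[OF rapid_summable[OF rapid_w, of s]]
    have C0: "0 \<le> C" using order_trans[OF _ C[of 0]] by (simp add: wt_def)
    have conv: "norm (\<Sum>\<^sub>\<infinity>j. c j * fc w (k - j)) * wt k ^ s \<le> C * S" for k
    proof -
      have le: "norm (c j * fc w (k - j) * of_real (wt k ^ s)) \<le> C * (norm (fc w (k - j)) * wt (k - j) ^ s)" for j
      proof -
        have "wt k ^ s \<le> (wt j * wt (k - j)) ^ s"
          using wt_submult[of j "k - j"] wt_pos[of k] by (intro power_mono) auto
        then have "norm (c j * fc w (k - j) * of_real (wt k ^ s))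
            \<le> norm (c j) * norm (fc w (k - j)) * (wt j * wt (k - j)) ^ s"
          using wt_pos[of k] by (simp add: norm_mult norm_power mult_left_mono)
        also have "\<dots> = (norm (c j) * wt j ^ s) * (norm (fc w (k - j)) * wt (k - j) ^ s)"
          by (simp add: power_mult_distrib mult_ac)
        also have "\<dots> \<le> C * (norm (fc w (k - j)) * wt (k - j) ^ s)"
          using wt_pos by (intro mult_right_mono C) (simp add: less_imp_le)
        finally show ?thesis .
      qed
      have hs: "((\<lambda>j. C * (norm (fc w (k - j)) * wt (k - j) ^ s)) has_sum C * S) UNIV"
        unfolding S_def sum(2)[of k, symmetric]
        by (intro has_sum_cmult_right has_sum_infsum sum(1))
      have sm: "(\<lambda>j. c j * fc w (k - j) * of_real (wt k ^ s)) summable_on UNIV"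
        by (rule abs_summable_summable, rule summable_on_comparison_test[OF has_sum_imp_summable[OF hs]])
          (use le in auto)
      have "norm (\<Sum>\<^sub>\<infinity>j. c j * fc w (k - j) * of_real (wt k ^ s)) \<le> C * S"
        by (rule norm_infsum_le[OF has_sum_infsum[OF sm] hs le])
      then show ?thesis
        using wt_pos[of k] by (simp add: infsum_cmult_left' norm_mult del: of_real_power)
    qed
    have "norm (c k) * wt k ^ Suc s \<le> max K (C * S / (\<kappa> * e))" for k
    proof (cases "k = 0")
      case True
      then show ?thesis using K[of k] by (simp add: wt_def)
    next
      case False
      have "(\<kappa> * e) * (norm (c k) * wt k ^ Suc s) = \<kappa> * (e * wt k) * norm (c k) * wt k ^ s" by simp
      also have "\<dots> \<le> \<kappa> * nu k * norm (c k) * wt k ^ s"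
        using e(2)[OF False] \<kappa>_pos wt_pos[of k] by (intro mult_right_mono mult_left_mono) auto
      also have "\<kappa> * nu k * norm (c k) = norm (of_real (\<kappa> * nu k) * c k)"
        using \<kappa>_pos nu_nonneg[of k] by (simp add: norm_mult)
      also have "norm (of_real (\<kappa> * nu k) * c k) * wt k ^ s \<le> C * S" unfolding eq by (rule conv)
      finally have "norm (c k) * wt k ^ Suc s \<le> C * S / (\<kappa> * e)"
        using e(1) \<kappa>_pos by (simp add: field_simps)
      then show ?thesis by simp
    qed
    then show ?case by blast
  qed
qed

lemma eigenfunction_exists:
  obtains f where "smooth f" "periodic \<Gamma> f" "\<exists>x. f x \<noteq> 0"
    "\<And>x. partial_deriv 1 (partial_deriv 1 f) x + partial_deriv 2 (partial_deriv 2 f) x = - (1 / \<kappa>) * (w x * f x)"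
proof -
  obtain c0 K where c0: "\<And>k. norm (c0 k) \<le> K"
    "\<And>k. of_real (\<kappa> * nu k) * c0 k = (\<Sum>\<^sub>\<infinity>j. c0 j * fc w (k - j))" "\<exists>k. c0 k \<noteq> 0"
    using limit_coefficients by blast
  have c0r: "rapid c0" by (rule eigen_coeffs_rapid[OF c0(1,2)])
  have "\<exists>x. ser c0 x \<noteq> 0"
  proof (rule ccontr)
    assume "\<nexists>x. ser c0 x \<noteq> 0"
    then have "ser c0 = (\<lambda>x. 0)" by auto
    then have "c0 k = 0" for k
      using cf_ser[OF rapid_norm_summable[OF c0r], of k] by (simp add: cf_def)
    then show False using c0(3) by blast
  qed
  then obtain x0 where "ser c0 x0 \<noteq> 0" by blast
  \<comment> \<open>The limit coefficients are not known here to belong to a real function. One of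
    the factors 1 and -i makes the real part of the series nonzero, and the equation, linear with
    real \<open>w\<close>, passes to that real part.\<close>
  then have "Re (1 * ser c0 x0) \<noteq> 0 \<or> Re (- \<i> * ser c0 x0) \<noteq> 0"
    by (simp add: complex_eq_iff)
  then obtain u where u: "Re (u * ser c0 x0) \<noteq> 0" by blast
  define c where "c k = u * c0 k" for k
  have c: "rapid c" unfolding c_def[abs_def] by (rule rapid_cmult[OF c0r])
  have serc: "ser c x = u * ser c0 x" for x
    unfolding ser_def c_def mult.assoc by (rule infsum_cmult_right')
  have eq: "of_real (\<kappa> * nu k) * c k = (\<Sum>\<^sub>\<infinity>j. c j * fc w (k - j))" for k
  proof -
    have "of_real (\<kappa> * nu k) * c k = u * (\<Sum>\<^sub>\<infinity>j. c0 j * fc w (k - j))"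
      unfolding c0(2)[symmetric] c_def by (simp add: mult_ac)
    then show ?thesis unfolding c_def mult.assoc by (simp add: infsum_cmult_right')
  qed
  define f where "f x = Re (ser c x)" for x
  have f: "smooth f" unfolding f_def[abs_def] by (rule smooth_Re_ser[OF c])
  note cs = rapid_norm_summable[OF c]
  have fp: "periodic \<Gamma> f" unfolding f_def[abs_def] by (rule periodic_comp[OF periodic_ser[OF cs]])
  have fnz: "\<exists>x. f x \<noteq> 0" using u unfolding f_def serc by blast
  have dd: "partial_deriv i (partial_deriv i f) x = Re (ser (dcoeff i (dcoeff i c)) x)" for i x
    unfolding f_def[abs_def] partial_deriv_Re_ser[OF c] partial_deriv_Re_ser[OF rapid_dcoeff[OF c]] ..
  define L where "L k = dcoeff 1 (dcoeff 1 c) k + dcoeff 2 (dcoeff 2 c) k" for k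
  have L: "L k = - of_real (nu k) * c k" for k
    unfolding L_def dcoeff_def nu_def by (simp add: power2_eq_square algebra_simps)
  note s1 = rapid_norm_summable[OF rapid_dcoeff[OF rapid_dcoeff[OF c]]]
  have serL: "ser L x = ser (dcoeff 1 (dcoeff 1 c)) x + ser (dcoeff 2 (dcoeff 2 c)) x" for x
    unfolding ser_def L_def distrib_right by (intro infsum_add summable_ser s1)
  have Ls: "(\<lambda>k. norm (L k)) summable_on UNIV"
    by (rule summable_on_comparison_test[OF summable_on_add[OF s1 s1]])
      (auto simp: L_def intro: norm_triangle_ineq)
  have wsc: "continuous_on S w" "continuous_on S (ser c)" "continuous_on S (ser L)" for S
    using w_cont continuous_ser[OF cs] continuous_ser[OF Ls] continuous_on_subset by blast+
  have eqn: "of_real \<kappa> * ser L x + of_real (w x) * ser c x = 0" for x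
  proof (rule fourier_uniqueness)
    show "continuous_on UNIV (\<lambda>x. of_real \<kappa> * ser L x + of_real (w x) * ser c x)"
      by (intro continuous_intros wsc)
    show "periodic \<Gamma> (\<lambda>x. of_real \<kappa> * ser L x + of_real (w x) * ser c x)"
      using periodic_ser[OF cs] periodic_ser[OF Ls] w_periodic by (simp add: periodic_def)
    fix k
    have "cf (\<lambda>x. of_real \<kappa> * ser L x + of_real (w x) * ser c x) k
        = avg (\<lambda>x. of_real \<kappa> * (ser L x * cnj (ch k x)) + of_real (w x) * ser c x * cnj (ch k x))"
      by (simp add: cf_def algebra_simps)
    also have "\<dots> = avg (\<lambda>x. of_real \<kappa> * (ser L x * cnj (ch k x))) + cf (\<lambda>x. of_real (w x) * ser c x) k"
      unfolding cf_def by (intro avg_add continuous_intros wsc)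
    also have "avg (\<lambda>x. of_real \<kappa> * (ser L x * cnj (ch k x))) = of_real \<kappa> * cf (ser L) k"
      unfolding cf_def by (intro avg_cmult continuous_intros wsc)
    also have "cf (ser L) k = L k" by (rule cf_ser[OF Ls])
    also have "cf (\<lambda>x. of_real (w x) * ser c x) k = of_real (\<kappa> * nu k) * c k"
      unfolding eq by (rule infsumI[symmetric, OF cf_mult_ser[OF w_cont w_periodic cs]])
    finally show "cf (\<lambda>x. of_real \<kappa> * ser L x + of_real (w x) * ser c x) k = 0"
      unfolding L[of k] by simp
  qed
  have "partial_deriv 1 (partial_deriv 1 f) x + partial_deriv 2 (partial_deriv 2 f) x = - (1 / \<kappa>) * (w x * f x)" for x
  proof -
    have "\<kappa> * Re (ser L x) + w x * f x = 0"
      using arg_cong[OF eqn[of x], of Re] by (simp add: f_def)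
    moreover have "Re (ser L x) = partial_deriv 1 (partial_deriv 1 f) x + partial_deriv 2 (partial_deriv 2 f) x"
      by (simp add: serL dd)
    ultimately show ?thesis using \<kappa>_pos by (simp add: field_simps)
  qed
  then show ?thesis using that f fp fnz by blast
qed

text \<open>In dimension two the square root of the determinant is \<open>w\<close> and the inverse
  matrix carries 1 / w. The two cancel under the divergence, and only the outer factor is
  left.\<close>

lemma laplace_beltrami_conformal:
  assumes "smooth f"
  shows "laplace_beltrami (\<lambda>x. w x *\<^sub>R mat 1) f x
    = - (1 / w x) * (partial_deriv 1 (partial_deriv 1 f) x + partial_deriv 2 (partial_deriv 2 f) x)"
proof -
  have det: "sqrt (det (w y *\<^sub>R mat 1 :: real^2^2)) = w y" for y
    using w_pos[of y] by (simp add: det_2 mat_def real_sqrt_mult_self)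
  have inv: "matrix_inv (w y *\<^sub>R mat 1 :: real^2^2) = (1 / w y) *\<^sub>R mat 1" for y
  proof -
    let ?A = "w y *\<^sub>R mat 1 :: real^2^2" and ?B = "(1 / w y) *\<^sub>R mat 1 :: real^2^2"
    have AB: "?A ** ?B = mat 1" "?B ** ?A = mat 1"
      using w_pos[of y] by (simp_all add: matrix_matrix_mult_def mat_def vec_eq_iff sum_2 forall_2)
    \<comment> \<open>\<open>matrix_inv\<close> chooses some two-sided inverse; \<open>?B\<close>
      shows that one exists, and uniqueness of inverses then identifies the choice.\<close>
    then have "?A ** matrix_inv ?A = mat 1"
      unfolding matrix_inv_def by (metis (mono_tags, lifting) someI_ex)
    then have "?B ** (?A ** matrix_inv ?A) = ?B" by simp
    then show ?thesis by (simp only: matrix_mul_assoc AB matrix_mul_lid)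
  qed
  have "(\<lambda>y. \<Sum>j\<in>UNIV. sqrt (det (w y *\<^sub>R mat 1 :: real^2^2)) * matrix_inv (w y *\<^sub>R mat 1 :: real^2^2) $ i $ j * partial_deriv j f y)
      = partial_deriv i f" for i :: 2
  proof
    fix y
    have "w y \<noteq> 0" using w_pos[of y] by simp
    then show "(\<Sum>j\<in>UNIV. sqrt (det (w y *\<^sub>R mat 1 :: real^2^2)) * matrix_inv (w y *\<^sub>R mat 1 :: real^2^2) $ i $ j * partial_deriv j f y)
      = partial_deriv i f y"
      unfolding det inv using exhaust_2[of i] by (auto simp: sum_2 mat_def)
  qed
  then show ?thesis unfolding laplace_beltrami_def det by (simp add: sum_2)
qed

text \<open>The limit eigenfunction attains 1 / \<kappa>. Conversely, an eigenfunction for l > 0 has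
  \<open>w\<close>-mean zero because a Laplacian has mean zero; integration by parts gives dir f = l
  mass f, and the Rayleigh inequality yields 1 <= \<kappa> l.\<close>

theorem lambda1_eq: "lambda1 \<Gamma> (\<lambda>x. w x *\<^sub>R mat 1) = 1 / \<kappa>"
  unfolding lambda1_def
proof (rule Least_equality)
  obtain f where f: "smooth f" "periodic \<Gamma> f" "\<exists>x. f x \<noteq> 0"
    "\<And>x. partial_deriv 1 (partial_deriv 1 f) x + partial_deriv 2 (partial_deriv 2 f) x = - (1 / \<kappa>) * (w x * f x)"
    using eigenfunction_exists by blast
  have "laplace_beltrami (\<lambda>x. w x *\<^sub>R mat 1) f x = 1 / \<kappa> * f x" for x
    unfolding laplace_beltrami_conformal[OF f(1)] f(4) using w_pos[of x] by simp
  then show "0 < 1 / \<kappa> \<and> is_eigenvalue \<Gamma> (\<lambda>x. w x *\<^sub>R mat 1) (1 / \<kappa>)"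
    using f(1-3) \<kappa>_pos unfolding is_eigenvalue_def by auto
next
  fix l assume l: "0 < l \<and> is_eigenvalue \<Gamma> (\<lambda>x. w x *\<^sub>R mat 1) l"
  then obtain f x0 where f: "smooth f" "periodic \<Gamma> f" "f x0 \<noteq> 0"
    and lb: "\<And>x. laplace_beltrami (\<lambda>x. w x *\<^sub>R mat 1) f x = l * f x"
    unfolding is_eigenvalue_def by blast
  have eq: "partial_deriv 1 (partial_deriv 1 f) x + partial_deriv 2 (partial_deriv 2 f) x = - l * (w x * f x)" for x
    using lb[of x] w_pos[of x] unfolding laplace_beltrami_conformal[OF f(1)] by (simp add: field_simps)
  have pd: "smooth (partial_deriv i f)" "periodic \<Gamma> (partial_deriv i f)" for i
    using f by (auto intro: smooth_partial_deriv periodic_partial_deriv smooth_differentiable)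
  note cont = smooth_continuous[OF f(1)] smooth_continuous[OF pd(1)]
    smooth_continuous[OF smooth_partial_deriv[OF pd(1)]] w_cont
  have "avg (\<lambda>x. - l * (w x * f x)) = 0"
    unfolding eq[symmetric] by (subst avg_add) (simp_all add: cont avg_partial_deriv pd)
  then have "avg (\<lambda>x. w x * f x) = 0"
    using l by (subst (asm) avg_cmult) (simp_all add: continuous_on_mult cont)
  then have adm: "adm f" using f by (simp add: adm_def)
  have "dir f = - avg (\<lambda>x. f x * partial_deriv 1 (partial_deriv 1 f) x) + - avg (\<lambda>x. f x * partial_deriv 2 (partial_deriv 2 f) x)"
    unfolding dir_eq[OF f(1)] power2_eq_square
    by (simp only: avg_by_parts[OF f(1,2) pd])
  also have "\<dots> = - avg (\<lambda>x. f x * partial_deriv 1 (partial_deriv 1 f) x + f x * partial_deriv 2 (partial_deriv 2 f) x)"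
    by (subst avg_add) (simp_all add: continuous_on_mult cont)
  also have "(\<lambda>x. f x * partial_deriv 1 (partial_deriv 1 f) x + f x * partial_deriv 2 (partial_deriv 2 f) x)
      = (\<lambda>x. - l * (w x * (f x)\<^sup>2))"
    by (simp only: distrib_left[symmetric] eq) (simp add: power2_eq_square mult_ac)
  also have "- avg (\<lambda>x. - l * (w x * (f x)\<^sup>2)) = l * mass f"
    unfolding mass_def by (subst avg_cmult) (simp_all add: continuous_on_mult continuous_on_power cont)
  finally have dir: "dir f = l * mass f" .
  have "0 < mass f" unfolding mass_def
  proof (rule avg_pos)
    show "continuous_on UNIV (\<lambda>x. w x * (f x)\<^sup>2)" by (intro continuous_on_mult continuous_on_power cont)
    show "periodic \<Gamma> (\<lambda>x. w x * (f x)\<^sup>2)" using f(2) w_periodic by (simp add: periodic_def)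
    show "0 \<le> w x * (f x)\<^sup>2" for x using w_pos[of x] by simp
    show "w x0 * (f x0)\<^sup>2 \<noteq> 0" using f(3) w_pos[of x0] by simp
  qed
  then have "1 \<le> \<kappa> * l" using rayleigh[OF adm] unfolding dir by simp
  then show "1 / \<kappa> \<le> l" using \<kappa>_pos by (simp add: field_simps)
qed

end

section \<open>Area and explicit averages\<close>

lemma Re_cayley:
  assumes "norm v < 1"
  shows "Re ((1 + v) / (1 - v)) = (1 - (norm v)\<^sup>2) / (norm (1 - v))\<^sup>2"
  unfolding Re_divide cmod_power2 by (simp add: power2_eq_square algebra_simps)

text \<open>With \<open>\<zeta> = z / (C + d)\<close> the integrand is \<open>1 / d\<close> times a Poisson kernel, the real part of
  \<open>(1 + v) / (1 - v)\<close> for \<open>v = \<zeta> cis (2 \<pi> s)\<close>; the latter has a logarithmic primitive.\<close>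

lemma has_integral_inverse_cos:
  fixes z :: complex
  assumes z: "norm z < C"
  defines "d \<equiv> sqrt (C\<^sup>2 - (norm z)\<^sup>2)"
  shows "((\<lambda>s. 1 / (C - Re (z * cis (2 * pi * s)))) has_integral 1 / d) {0..1}"
proof -
  have C: "0 < C" using z norm_ge_zero[of z] by linarith
  have "(norm z)\<^sup>2 < C\<^sup>2" using z by (intro power_strict_mono) auto
  then have d: "0 < d" and d2: "d\<^sup>2 = C\<^sup>2 - (norm z)\<^sup>2" by (simp_all add: d_def)
  define \<zeta> where "\<zeta> = z / of_real (C + d)"
  define v where "v s = \<zeta> * cis (2 * pi * s)" for s
  have nv: "norm (v s) = norm z / (C + d)" for s
    using C d by (simp add: v_def \<zeta>_def norm_mult norm_divide del: of_real_add)
  have v1: "norm (v s) < 1" for s using z C d by (simp add: nv)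
  have vne: "1 - v s \<noteq> 0" for s using v1[of s] by auto
  have eq: "1 / (C - Re (z * cis (2 * pi * s))) = 1 / d * Re ((1 + v s) / (1 - v s))" for s
  proof -
    have Rev: "Re (v s) = Re (z * cis (2 * pi * s)) / (C + d)"
      by (simp add: v_def \<zeta>_def del: of_real_add)
    have nv2: "(norm (v s))\<^sup>2 = (C - d) / (C + d)"
    proof -
      have "(norm z)\<^sup>2 = (C - d) * (C + d)" using d2 by (simp add: power2_eq_square algebra_simps)
      then show ?thesis using C d unfolding nv power_divide by (simp add: power2_eq_square)
    qed
    have "(norm (1 - v s))\<^sup>2 = 1 - 2 * Re (v s) + (norm (v s))\<^sup>2"
      unfolding cmod_power2 by (simp add: power2_eq_square algebra_simps)
    also have "\<dots> = 2 * (C - Re (z * cis (2 * pi * s))) / (C + d)"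
    proof -
      have "1 - 2 * (r / (C + d)) + (C - d) / (C + d) = 2 * (C - r) / (C + d)" for r
        using C d by (simp add: divide_simps)
      then show ?thesis unfolding Rev nv2 .
    qed
    finally have n1: "(norm (1 - v s))\<^sup>2 = 2 * (C - Re (z * cis (2 * pi * s))) / (C + d)" .
    have "0 < (norm (1 - v s))\<^sup>2" using vne[of s] by simp
    then have pos: "0 < C - Re (z * cis (2 * pi * s))"
      unfolding n1 using C d by (simp add: zero_less_divide_iff)
    have "1 - (norm (v s))\<^sup>2 = 2 * d / (C + d)" unfolding nv2 using C d by (simp add: field_simps)
    moreover have "1 / r = 1 / d * (2 * d / (C + d) / (2 * r / (C + d)))" if "0 < r" for r
      using C d that by (simp add: divide_simps)
    ultimately show ?thesis unfolding Re_cayley[OF v1] n1 using pos by metis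
  qed
  \<comment> \<open>Since |v| < 1, the principal logarithm is differentiable along
    \<open>1 - v s\<close> and returns to its initial value; the linear term alone contributes to
    \<open>H 1 - H 0\<close>.\<close>
  define H where "H s = of_real s - 1 / (of_real pi * \<i>) * Ln (1 - v s)" for s
  have "(H has_vector_derivative (1 + v s) / (1 - v s)) (at s within {0..1})" for s
  proof -
    have dv: "(v has_vector_derivative 2 * of_real pi * \<i> * v s) (at s within {0..1})"
      unfolding v_def cis_conv_exp
      by (rule derivative_eq_intros has_vector_derivative_real_field refl | simp)+
    have "1 - v s \<notin> \<real>\<^sub>\<le>\<^sub>0"
      using v1[of s] abs_Re_le_cmod[of "v s"] by (auto simp: complex_nonpos_Reals_iff)
    then have L: "(Ln has_field_derivative inverse (1 - v s)) (at (1 - v s) within (\<lambda>s. 1 - v s) ` {0..1})"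
      by (rule has_field_derivative_at_within[OF has_field_derivative_Ln])
    have "((\<lambda>s. 1 - v s) has_vector_derivative 0 - 2 * of_real pi * \<i> * v s) (at s within {0..1})"
      by (intro has_vector_derivative_diff has_vector_derivative_const dv)
    from field_vector_diff_chain_within[OF this L]
    have "((\<lambda>s. Ln (1 - v s)) has_vector_derivative (- (2 * of_real pi * \<i> * v s)) * (1 / (1 - v s))) (at s within {0..1})"
      by (simp add: o_def inverse_eq_divide)
    then have "(H has_vector_derivative 1 - 1 / (of_real pi * \<i>) * ((- (2 * of_real pi * \<i> * v s)) * (1 / (1 - v s)))) (at s within {0..1})"
      unfolding H_def
      by (intro has_vector_derivative_diff has_vector_derivative_mult_right)
        (auto intro!: derivative_eq_intros)
    moreover have "1 - 1 / (of_real pi * \<i>) * ((- (2 * of_real pi * \<i> * v s)) * (1 / (1 - v s))) = (1 + v s) / (1 - v s)"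
      using vne[of s] by (simp add: field_simps)
    ultimately show ?thesis by simp
  qed
  then have "((\<lambda>s. (1 + v s) / (1 - v s)) has_integral H 1 - H 0) {0..1}"
    by (intro fundamental_theorem_of_calculus) auto
  moreover have "H 1 - H 0 = 1" by (simp add: H_def v_def)
  ultimately have "((\<lambda>s. Re ((1 + v s) / (1 - v s))) has_integral Re 1) {0..1}"
    by (metis has_integral_Re)
  from has_integral_mult_right[OF this, of "1 / d"] show ?thesis
    unfolding eq[symmetric] by simp
qed

text \<open>The periodic function Im e / X has derivative
  \<open>2 * pi * (d\<^sup>2 / X\<^sup>2 - C / X)\<close>, whose integral over a period is zero.
  This reduces the square to the first power.\<close>

lemma has_integral_inverse_cos_squared:
  fixes z :: complex
  assumes z: "norm z < C"
  defines "d \<equiv> sqrt (C\<^sup>2 - (norm z)\<^sup>2)"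
  shows "((\<lambda>s. 1 / (C - Re (z * cis (2 * pi * s)))\<^sup>2) has_integral C / d ^ 3) {0..1}"
proof -
  have C: "0 < C" using z norm_ge_zero[of z] by linarith
  have "(norm z)\<^sup>2 < C\<^sup>2" using z by (intro power_strict_mono) auto
  then have d: "0 < d" and d2: "d\<^sup>2 = C\<^sup>2 - (norm z)\<^sup>2" by (simp_all add: d_def)
  define e where "e s = z * cis (2 * pi * s)" for s
  define X where "X s = C - Re (e s)" for s
  have ne: "norm (e s) = norm z" for s by (simp add: e_def norm_mult)
  have X: "0 < X s" for s
    using z abs_Re_le_cmod[of "e s"] unfolding ne X_def by linarith
  have de: "(e has_vector_derivative 2 * of_real pi * \<i> * e s) (at s within {0..1})" for s
    unfolding e_def cis_conv_exp
    by (rule derivative_eq_intros has_vector_derivative_real_field refl | simp)+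
  have dRe: "((\<lambda>s. Re (e s)) has_real_derivative (- 2 * pi * Im (e s))) (at s within {0..1})" for s
    using bounded_linear.has_vector_derivative[OF bounded_linear_Re de[of s]]
    by (simp add: has_real_derivative_iff_has_vector_derivative)
  have dIm: "((\<lambda>s. Im (e s)) has_real_derivative (2 * pi * Re (e s))) (at s within {0..1})" for s
    using bounded_linear.has_vector_derivative[OF bounded_linear_Im de[of s]]
    by (simp add: has_real_derivative_iff_has_vector_derivative)
  have "((\<lambda>s. Im (e s) / X s) has_real_derivative 2 * pi * (d\<^sup>2 * (1 / (X s)\<^sup>2) - C * (1 / X s))) (at s within {0..1})" for s
  proof -
    have dX: "(X has_real_derivative 2 * pi * Im (e s)) (at s within {0..1})"
      unfolding X_def using DERIV_diff[OF DERIV_const[of C] dRe[of s]] by simp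
    have sq: "(Re (e s))\<^sup>2 + (Im (e s))\<^sup>2 = C\<^sup>2 - d\<^sup>2"
      unfolding d2 using ne[of s] by (simp add: cmod_power2[symmetric])
    have Re: "Re (e s) = C - X s" by (simp add: X_def)
    have "2 * pi * Re (e s) * X s - Im (e s) * (2 * pi * Im (e s)) = 2 * pi * (d\<^sup>2 - C * X s)"
      using sq unfolding Re by (simp add: power2_eq_square) (algebra)
    then have "(2 * pi * Re (e s) * X s - Im (e s) * (2 * pi * Im (e s))) / (X s * X s)
        = 2 * pi * (d\<^sup>2 * (1 / (X s)\<^sup>2) - C * (1 / X s))"
      using X[of s] by (simp add: field_simps power2_eq_square)
    with DERIV_divide[OF dIm dX] X[of s] show ?thesis by simp
  qed
  then have "((\<lambda>s. 2 * pi * (d\<^sup>2 * (1 / (X s)\<^sup>2) - C * (1 / X s))) has_integral Im (e 1) / X 1 - Im (e 0) / X 0) {0..1}"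
    by (intro fundamental_theorem_of_calculus) (auto simp: has_real_derivative_iff_has_vector_derivative)
  moreover have "Im (e 1) / X 1 - Im (e 0) / X 0 = 0" by (simp add: e_def X_def)
  ultimately have "((\<lambda>s. 2 * pi * (d\<^sup>2 * (1 / (X s)\<^sup>2) - C * (1 / X s))) has_integral 0) {0..1}" by simp
  from has_integral_mult_right[OF this, of "1 / (2 * pi)"]
  have "((\<lambda>s. d\<^sup>2 * (1 / (X s)\<^sup>2) - C * (1 / X s)) has_integral 0) {0..1}" by simp
  moreover have "((\<lambda>s. C * (1 / X s)) has_integral C * (1 / d)) {0..1}"
    unfolding X_def e_def d_def by (intro has_integral_mult_right has_integral_inverse_cos z)
  ultimately have "((\<lambda>s. d\<^sup>2 * (1 / (X s)\<^sup>2) - C * (1 / X s) + C * (1 / X s)) has_integral 0 + C * (1 / d)) {0..1}"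
    by (rule has_integral_add)
  then have "((\<lambda>s. d\<^sup>2 * (1 / (X s)\<^sup>2)) has_integral C / d) {0..1}" by simp
  from has_integral_mult_right[OF this, of "1 / d\<^sup>2"]
  show ?thesis using d by (simp add: X_def e_def power2_eq_square power3_eq_cube mult.assoc)
qed

lemma integral_periodic_shift:
  fixes g :: "real \<Rightarrow> 'z::banach"
  assumes g: "continuous_on UNIV g" "\<And>t. g (t + 1) = g t" and s: "0 \<le> s" "s \<le> 1"
  shows "integral {0..1} (\<lambda>t. g (t + s)) = integral {0..1} g"
proof -
  have int: "g integrable_on {u..v}" for u v
    using g(1) by (intro integrable_continuous_interval) (rule continuous_on_subset, auto)
  have "integral {0..1} (\<lambda>t. g (t + s)) = integral {s..1 + s} g"
    using integral_shift_real_ivl[where a=s and c=s and b="1 + s" and f=g] by simp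
  also have "\<dots> = integral {s..1} g + integral {1..1 + s} g"
    using Henstock_Kurzweil_Integration.integral_combine[of s 1 "1 + s" g] int s by simp
  also have "integral {1..1 + s} g = integral {0..s} g"
    using integral_shift_real_ivl[where a=1 and c=1 and b="1 + s" and f=g] g(2) by simp
  also have "integral {s..1} g + integral {0..s} g = integral {0..1} g"
    using Henstock_Kurzweil_Integration.integral_combine[of 0 s 1 g] int s by (simp add: add.commute)
  finally show ?thesis .
qed

context torus
begin

text \<open>An area-preserving change of variables. At (s, t + s) both basic characters have
  frequency one in \<open>s\<close>, so that for fixed \<open>t\<close> the function
  \<open>conf\<close> becomes a constant minus a single cosine.\<close>

lemma avg_shear:
  fixes f :: "real^2 \<Rightarrow> 'z::banach"
  assumes f: "continuous_on UNIV f" "periodic \<Gamma> f"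
  shows "avg f = integral {0..1} (\<lambda>t. integral {0..1} (\<lambda>s. f (pt (s, t + s))))"
proof -
  have per: "f (pt (s, t + 1)) = f (pt (s, t))" for s t
    using periodic_pt[OF f(2), of s 0 t 1] by simp
  have "avg f = integral {0..1} (\<lambda>s. integral {0..1} (\<lambda>t. f (pt (s, t))))"
    by (rule avg_iterated(1)[OF f(1)])
  also have "\<dots> = integral {0..1} (\<lambda>s. integral {0..1} (\<lambda>t. f (pt (s, t + s))))"
  proof (rule integral_cong)
    fix s :: real assume "s \<in> {0..1}"
    then show "integral {0..1} (\<lambda>t. f (pt (s, t))) = integral {0..1} (\<lambda>t. f (pt (s, t + s)))"
      using integral_periodic_shift[of "\<lambda>t. f (pt (s, t))" s] per
        continuous_on_compose2[OF f(1) continuous_on_pt[of UNIV "\<lambda>t. (s, t)"]]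
      by (simp add: continuous_on_Pair continuous_on_const continuous_on_id)
  qed
  also have "\<dots> = integral {0..1} (\<lambda>t. integral {0..1} (\<lambda>s. f (pt (s, t + s))))"
  proof -
    have "continuous_on (cbox (0, 0) (1, 1)) (\<lambda>(s, t). f (pt (s, t + s)))"
      unfolding case_prod_beta
      by (rule continuous_on_compose2[OF f(1)], rule continuous_on_pt) (auto intro!: continuous_intros)
    from integral_swap_continuous[OF this] show ?thesis by simp
  qed
  finally show ?thesis .
qed

text \<open>For suitable \<open>A\<close> and \<open>B\<close> this is one minus the inner product
  of t with the embedding (\<open>conf_eq_inner\<close>); up to a constant, its reciprocal is the
  conformal factor of the Moebius transformation.\<close>

definition conf :: "complex \<Rightarrow> complex \<Rightarrow> real^2 \<Rightarrow> real" where
  "conf A B x = 1 - Re (A * ch (0, 1) x) - Re (B * ch (1, 0) x)"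

context
  fixes A B :: complex and S D :: real
  assumes AB: "norm A + norm B < 1"
  defines "S \<equiv> 1 - (norm A)\<^sup>2 - (norm B)\<^sup>2" and "D \<equiv> S\<^sup>2 - 4 * (norm A)\<^sup>2 * (norm B)\<^sup>2"
begin

lemma conf_pos: "0 < conf A B x"
  using AB abs_Re_le_cmod[of "A * ch (0, 1) x"] abs_Re_le_cmod[of "B * ch (1, 0) x"]
  unfolding conf_def norm_mult norm_ch by linarith

lemma conf_continuous: "continuous_on T (conf A B)"
  unfolding conf_def[abs_def] by (intro continuous_intros)

lemma conf_periodic: "periodic \<Gamma> (conf A B)"
  using periodic_ch by (simp add: conf_def[abs_def] periodic_def)

lemma conf_shear: "conf A B (pt (s, t + s)) = 1 - Re ((A * cis (2 * pi * t) + B) * cis (2 * pi * s))"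
  by (simp add: conf_def ch_pt cis_mult[symmetric] distrib_left algebra_simps)

lemma SD: "0 < S" "2 * norm (A * cnj B) < S" "0 < D" "D = S\<^sup>2 - (norm (2 * A * cnj B))\<^sup>2"
proof -
  have "(norm A + norm B)\<^sup>2 < 1\<^sup>2" using AB by (intro power_strict_mono) auto
  then show 1: "2 * norm (A * cnj B) < S" by (simp add: S_def norm_mult power2_eq_square algebra_simps)
  then show "0 < S" using norm_ge_zero[of "A * cnj B"] by linarith
  show 2: "D = S\<^sup>2 - (norm (2 * A * cnj B))\<^sup>2"
    by (simp add: D_def norm_mult power_mult_distrib)
  have "(2 * norm (A * cnj B))\<^sup>2 < S\<^sup>2" using 1 by (intro power_strict_mono) auto
  then show "0 < D" unfolding 2 by (simp add: norm_mult power_mult_distrib)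
qed

text \<open>After the inner integration the amplitude enters only through one minus its square,
  which is Y = S - Re (...), again a constant minus a cosine. The same one-dimensional formulas
  therefore evaluate the means of 1 / Y and 1 / Y^2, with \<open>D\<close> as discriminant.\<close>

lemma norm_shear: "(norm (A * cis (2 * pi * t) + B))\<^sup>2 = 1 - (S - Re (2 * A * cnj B * cis (2 * pi * t)))"
proof -
  have "(norm (u + v))\<^sup>2 = (norm u)\<^sup>2 + (norm v)\<^sup>2 + 2 * Re (u * cnj v)" for u v :: complex
    unfolding cmod_power2 by (simp add: power2_eq_square algebra_simps)
  from this[of "A * cis (2 * pi * t)" B] show ?thesis
    by (simp add: S_def norm_mult mult_ac)
qed

lemma norm_shear_less: "norm (A * cis (2 * pi * t) + B) < 1"
  using AB norm_triangle_ineq[of "A * cis (2 * pi * t)" B] by (simp add: norm_mult)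

lemma shear_pos: "0 < S - Re (2 * A * cnj B * cis (2 * pi * t))"
  using SD(2) abs_Re_le_cmod[of "2 * A * cnj B * cis (2 * pi * t)"] by (simp add: norm_mult)

lemma avg_conf_inverse_eq: "avg (\<lambda>x. 1 / conf A B x)
    = integral {0..1} (\<lambda>t. 1 / sqrt (S - Re (2 * A * cnj B * cis (2 * pi * t))))"
proof -
  have one_square: "1\<^sup>2 - (1 - y) = y" for y :: real by simp
  have outer: "avg (\<lambda>x. 1 / conf A B x)
      = integral {0..1} (\<lambda>t. integral {0..1} (\<lambda>s. 1 / conf A B (pt (s, t + s))))"
    using conf_pos by (intro avg_shear continuous_on_divide conf_continuous continuous_on_const
        periodic_comp[OF conf_periodic]) (metis less_irrefl)
  have inner: "integral {0..1} (\<lambda>s. 1 / conf A B (pt (s, t + s)))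
      = 1 / sqrt (S - Re (2 * A * cnj B * cis (2 * pi * t)))" for t
    unfolding conf_shear integral_unique[OF has_integral_inverse_cos[OF norm_shear_less]] norm_shear
      one_square ..
  show ?thesis unfolding outer inner ..
qed

lemma avg_conf_inverse_square_eq: "avg (\<lambda>x. 1 / (conf A B x)\<^sup>2)
    = integral {0..1} (\<lambda>t. 1 / sqrt (S - Re (2 * A * cnj B * cis (2 * pi * t))) ^ 3)"
proof -
  have one_square: "1\<^sup>2 - (1 - y) = y" for y :: real by simp
  have outer: "avg (\<lambda>x. 1 / (conf A B x)\<^sup>2)
      = integral {0..1} (\<lambda>t. integral {0..1} (\<lambda>s. 1 / (conf A B (pt (s, t + s)))\<^sup>2))"
    using conf_pos by (intro avg_shear continuous_on_divide continuous_on_power conf_continuous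
        continuous_on_const periodic_comp[OF conf_periodic]) (metis less_irrefl power_eq_0_iff)
  have inner: "integral {0..1} (\<lambda>s. 1 / (conf A B (pt (s, t + s)))\<^sup>2)
      = 1 / sqrt (S - Re (2 * A * cnj B * cis (2 * pi * t))) ^ 3" for t
    unfolding conf_shear integral_unique[OF has_integral_inverse_cos_squared[OF norm_shear_less]] norm_shear
      one_square ..
  show ?thesis unfolding outer inner ..
qed

lemma Y_continuous: "continuous_on T (\<lambda>t. S - Re (2 * A * cnj B * cis (2 * pi * t)))"
  by (intro continuous_intros)

lemma shear_integrals:
  shows "((\<lambda>t. 1 / (S - Re (2 * A * cnj B * cis (2 * pi * t)))) has_integral 1 / sqrt D) {0..1}"
    and "((\<lambda>t. 1 / (S - Re (2 * A * cnj B * cis (2 * pi * t)))\<^sup>2) has_integral S / sqrt D ^ 3) {0..1}"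
  unfolding SD(4) using SD(2)
  by (intro has_integral_inverse_cos has_integral_inverse_cos_squared; simp add: norm_mult)+

text \<open>Cauchy-Schwarz for Y^(-1/2) against 1, as a pointwise inequality between arithmetic and
  geometric mean; \<open>c\<close> is the parameter that minimizes the integrated right-hand
  side.\<close>

lemma avg_conf_inverse_le: "avg (\<lambda>x. 1 / conf A B x) \<le> 1 / sqrt (sqrt D)"
proof -
  define Y where "Y t = S - Re (2 * A * cnj B * cis (2 * pi * t))" for t
  have Y: "0 < Y t" for t unfolding Y_def by (rule shear_pos)
  have Yc: "continuous_on T Y" for T unfolding Y_def[abs_def] by (rule Y_continuous)
  define c where "c = sqrt (sqrt D)"
  have c: "0 < c" "c\<^sup>2 = sqrt D" using SD(3) by (simp_all add: c_def)
  have int: "(\<lambda>t. 1 / sqrt (Y t)) integrable_on {0..1}"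
    using Y by (intro integrable_continuous_interval continuous_on_divide continuous_on_const
        continuous_on_real_sqrt Yc) (metis real_sqrt_eq_zero_cancel_iff less_irrefl)
  have "((\<lambda>t. 1 / 2 * (1 / c + c * (1 / Y t))) has_integral 1 / 2 * (1 / c + c * (1 / sqrt D))) {0..1}"
    using has_integral_const_real[of "1 / c" 0 1] shear_integrals(1)
    by (intro has_integral_mult_right has_integral_add) (simp_all add: Y_def)
  moreover have "1 / sqrt (Y t) \<le> 1 / 2 * (1 / c + c * (1 / Y t))" for t
  proof -
    define y where "y = sqrt (Y t)"
    have y: "0 < y" "Y t = y\<^sup>2" using Y[of t] by (simp_all add: y_def)
    have "0 \<le> (y - c)\<^sup>2 / (2 * c * y\<^sup>2)" using y c by simp
    also have "\<dots> = 1 / 2 * (1 / c + c * (1 / y\<^sup>2)) - 1 / y"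
      using y(1) c(1) by (simp add: field_simps power2_eq_square)
    finally show ?thesis unfolding y(2) using y(1) by simp
  qed
  ultimately have "integral {0..1} (\<lambda>t. 1 / sqrt (Y t)) \<le> 1 / 2 * (1 / c + c * (1 / sqrt D))"
    by (rule has_integral_le[OF integrable_integral[OF int]])
  also have "\<dots> = 1 / c" using c by (simp add: c(2)[symmetric] power2_eq_square)
  finally show ?thesis unfolding avg_conf_inverse_eq by (simp add: Y_def c_def)
qed

text \<open>Cauchy-Schwarz between the means of 1 / Y and 1 / Y^2, again with the optimal
  \<open>c\<close>. It is an equality for constant Y, that is, if \<open>A\<close> or
  \<open>B\<close> is zero.\<close>

lemma avg_conf_inverse_square_le: "avg (\<lambda>x. 1 / (conf A B x)\<^sup>2) \<le> sqrt S / D"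
proof -
  define Y where "Y t = S - Re (2 * A * cnj B * cis (2 * pi * t))" for t
  have Y: "0 < Y t" for t unfolding Y_def by (rule shear_pos)
  have Yc: "continuous_on T Y" for T unfolding Y_def[abs_def] by (rule Y_continuous)
  define c where "c = sqrt S / sqrt D"
  have c: "0 < c" using SD by (simp add: c_def)
  have int: "(\<lambda>t. 1 / sqrt (Y t) ^ 3) integrable_on {0..1}"
    using Y by (intro integrable_continuous_interval continuous_on_divide continuous_on_const
        continuous_on_power continuous_on_real_sqrt Yc) (metis real_sqrt_eq_zero_cancel_iff less_irrefl power_eq_0_iff)
  have "((\<lambda>t. 1 / 2 * (c * (1 / Y t) + 1 / c * (1 / (Y t)\<^sup>2)))
      has_integral 1 / 2 * (c * (1 / sqrt D) + 1 / c * (S / sqrt D ^ 3))) {0..1}"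
    using shear_integrals by (intro has_integral_mult_right has_integral_add) (simp_all add: Y_def)
  moreover have "1 / sqrt (Y t) ^ 3 \<le> 1 / 2 * (c * (1 / Y t) + 1 / c * (1 / (Y t)\<^sup>2))" for t
  proof -
    define y where "y = sqrt (Y t)"
    have y: "0 < y" "Y t = y\<^sup>2" using Y[of t] by (simp_all add: y_def)
    have "0 \<le> (y * c - 1)\<^sup>2 / (2 * c * y ^ 4)" using y c by simp
    also have "\<dots> = 1 / 2 * (c * (1 / y\<^sup>2) + 1 / c * (1 / (y\<^sup>2)\<^sup>2)) - 1 / y ^ 3"
      using y(1) c by (simp add: field_simps power2_eq_square eval_nat_numeral)
    finally show ?thesis unfolding y(2) using y(1) by simp
  qed
  ultimately have "integral {0..1} (\<lambda>t. 1 / sqrt (Y t) ^ 3) \<le> 1 / 2 * (c * (1 / sqrt D) + 1 / c * (S / sqrt D ^ 3))"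
    by (rule has_integral_le[OF integrable_integral[OF int]])
  also have "\<dots> = sqrt S / D"
  proof -
    define \<sigma> \<delta> where "\<sigma> = sqrt S" and "\<delta> = sqrt D"
    have "0 < \<sigma>" "0 < \<delta>" "S = \<sigma>\<^sup>2" "D = \<delta>\<^sup>2" using SD(1,3) by (simp_all add: \<sigma>_def \<delta>_def)
    then show ?thesis
      unfolding c_def \<sigma>_def[symmetric] \<delta>_def[symmetric]
      by (simp add: field_simps power2_eq_square power3_eq_cube)
  qed
  finally show ?thesis unfolding avg_conf_inverse_square_eq by (simp add: Y_def)
qed

end

end

text \<open>Transports integrals over the plane to the product of two lines, where they become
  iterated integrals.\<close>

lemma lborel_eq_distr_vec2: "lborel = distr lborel borel (\<lambda>z::real \<times> real. vector [fst z, snd z] :: real^2)"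
proof (rule lborel_eqI)
  let ?v = "\<lambda>z::real \<times> real. vector [fst z, snd z] :: real^2"
  have cont: "continuous_on UNIV ?v"
  proof -
    have "?v z = fst z *\<^sub>R axis 1 1 + snd z *\<^sub>R axis 2 1" for z
      by (simp add: vec_eq_iff forall_2 axis_def)
    then show ?thesis by (auto intro!: continuous_intros)
  qed
  have Basis2: "(Basis :: (real^2) set) = {axis 1 1, axis 2 1}"
    by (auto simp: Basis_vec_def UNIV_2)
  have ne: "axis 1 (1::real) \<noteq> (axis 2 1 :: real^2)"
    by (simp add: axis_eq_axis)
  fix l u :: "real^2"
  assume lu: "\<And>e. e \<in> Basis \<Longrightarrow> l \<bullet> e \<le> u \<bullet> e"
  have "?v -` box l u = box (l $ 1, l $ 2) (u $ 1, u $ 2)"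
    by (auto simp: box_def Basis2 inner_axis Basis_prod_def)
  then have "emeasure (distr lborel borel ?v) (box l u) = emeasure lborel (box (l $ 1, l $ 2) (u $ 1, u $ 2))"
    using borel_measurable_continuous_onI[OF cont] by (subst emeasure_distr) auto
  also have "\<dots> = ennreal ((u $ 1 - l $ 1) * (u $ 2 - l $ 2))"
    using lu[of "axis 1 1"] lu[of "axis 2 1"]
    by (subst emeasure_lborel_box_eq) (auto simp: Basis_prod_def Basis2 inner_axis)
  also have "(u $ 1 - l $ 1) * (u $ 2 - l $ 2) = (\<Prod>e\<in>Basis. (u - l) \<bullet> e)"
    unfolding Basis2 using ne by (simp add: inner_axis)
  finally show "emeasure (distr lborel borel ?v) (box l u) = (\<Prod>e\<in>Basis. (u - l) \<bullet> e)" .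
qed simp

lemma lborel_integral_unit_interval:
  fixes f :: "real \<Rightarrow> real"
  assumes "continuous_on {0..1} f"
  shows "(\<integral>s. indicator {0..<1} s *\<^sub>R f s \<partial>lborel) = integral {0..1} f"
proof -
  have "AE s in lborel. s \<noteq> (1::real)" by (rule AE_lborel_singleton)
  then have "AE s in lborel. indicator {0..<1} s *\<^sub>R f s = indicator {0..1} s *\<^sub>R f s"
    by eventually_elim (auto simp: indicator_def)
  moreover have m: "(\<lambda>s. indicator {0..1} s *\<^sub>R f s) \<in> borel_measurable lborel"
    using borel_measurable_continuous_on_indicator[OF _ assms] by simp
  moreover have "(\<lambda>s. indicator {0..<1} s *\<^sub>R f s) \<in> borel_measurable lborel"
  proof -
    have "(\<lambda>s. indicator {0..<1::real} s *\<^sub>R (indicator {0..1} s *\<^sub>R f s)) \<in> borel_measurable lborel"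
      using m by measurable
    moreover have "(\<lambda>s. indicator {0..<1::real} s *\<^sub>R (indicator {0..1} s *\<^sub>R f s)) = (\<lambda>s. indicator {0..<1} s *\<^sub>R f s)"
      by (auto simp: indicator_def)
    ultimately show ?thesis by (simp only:)
  qed
  ultimately have "(\<integral>s. indicator {0..<1} s *\<^sub>R f s \<partial>lborel) = (\<integral>s. indicator {0..1} s *\<^sub>R f s \<partial>lborel)"
    by (intro integral_cong_AE)
  also have "\<dots> = integral {0..1} f"
    using set_borel_integral_eq_integral(2)[of "{0..1}" f] borel_integrable_atLeastAtMost'[OF assms]
    by (simp add: set_lebesgue_integral_def)
  finally show ?thesis .
qed

context torus
begin

text \<open>Fubini for the parallelogram: horizontal lines are shifted by
  \<open>a * (y / b)\<close>, and then y = b t contributes the factor \<open>b\<close>. Half-open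
  and closed intervals differ by a null set.\<close>

lemma area_conformal:
  assumes w: "continuous_on UNIV w" "\<And>x. 0 < w x"
  shows "area (vector [1, 0]) (vector [a, b]) (\<lambda>x. w x *\<^sub>R mat 1) = b * avg w"
proof -
  define v where "v z = (vector [fst z, snd z] :: real^2)" for z :: "real \<times> real"
  define D where "D = fundamental_domain (vector [1, 0]) (vector [a, b])"
  have v_eq: "v z = fst z *\<^sub>R axis 1 1 + snd z *\<^sub>R axis 2 1" for z
    by (simp add: v_def vec_eq_iff forall_2 axis_def)
  have v_cont: "continuous_on UNIV v"
    unfolding v_eq[abs_def] by (auto intro!: continuous_intros)
  note v_meas = borel_measurable_continuous_onI[OF v_cont]
  note w_meas = borel_measurable_continuous_onI[OF w(1)]
  have D_iff: "x \<in> D \<longleftrightarrow> x $ 2 / b \<in> {0..<1} \<and> x $ 1 - a * (x $ 2 / b) \<in> {0..<1}" for x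
  proof
    assume "x \<in> D"
    then obtain s t where st: "x = pt (s, t)" "s \<in> {0..<1}" "t \<in> {0..<1}"
      unfolding D_def fundamental_domain_def pt_eq by blast
    then show "x $ 2 / b \<in> {0..<1} \<and> x $ 1 - a * (x $ 2 / b) \<in> {0..<1}"
      using b_pos by (simp add: pt_def)
  next
    assume st: "x $ 2 / b \<in> {0..<1} \<and> x $ 1 - a * (x $ 2 / b) \<in> {0..<1}"
    have "x = pt (x $ 1 - a * (x $ 2 / b), x $ 2 / b)"
      using b_pos by (simp add: pt_def vec_eq_iff forall_2)
    then show "x \<in> D"
      using st unfolding D_def fundamental_domain_def pt_eq by blast
  qed
  define E where "E = {z :: real \<times> real. snd z / b \<in> {0..<1} \<and> fst z - a * (snd z / b) \<in> {0..<1}}"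
  have vE: "v z \<in> D \<longleftrightarrow> z \<in> E" for z unfolding D_iff E_def by (simp add: v_def)
  have preimage: "f -` {0..<1} \<in> sets borel" if "continuous_on UNIV f" for f :: "'z::topological_space \<Rightarrow> real"
    using measurable_sets_borel[OF borel_measurable_continuous_onI[OF that]] by simp
  have E_meas: "E \<in> sets borel"
  proof -
    have "E = (\<lambda>z. snd z / b) -` {0..<1} \<inter> (\<lambda>z. fst z - a * (snd z / b)) -` {0..<1}"
      unfolding E_def by auto
    also have "\<dots> \<in> sets borel"
      using b_pos by (intro sets.Int preimage continuous_intros) auto
    finally show ?thesis .
  qed
  have D_meas: "D \<in> sets borel"
  proof -
    have "D = (\<lambda>x. x $ 2 / b) -` {0..<1} \<inter> (\<lambda>x. x $ 1 - a * (x $ 2 / b)) -` {0..<1}" using D_iff by blast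
    also have "\<dots> \<in> sets borel"
      using b_pos by (intro sets.Int preimage continuous_intros) auto
    finally show ?thesis .
  qed
  have E_sub: "E \<subseteq> (\<lambda>z. (fst z + a * snd z, b * snd z)) ` cbox (0, 0) (1, 1)"
  proof
    fix z assume z: "z \<in> E"
    then have "(fst z - a * (snd z / b), snd z / b) \<in> cbox (0, 0) (1, 1)" by (simp add: E_def cbox_Pair_eq)
    moreover have "z = (\<lambda>z. (fst z + a * snd z, b * snd z)) (fst z - a * (snd z / b), snd z / b)"
      using b_pos by (simp add: prod_eq_iff)
    ultimately show "z \<in> (\<lambda>z. (fst z + a * snd z, b * snd z)) ` cbox (0, 0) (1, 1)" by blast
  qed
  have comp: "compact ((\<lambda>z. (fst z + a * snd z, b * snd z)) ` cbox (0, 0) (1, 1))"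
    by (intro compact_continuous_image compact_cbox continuous_intros)
  define K where "K = (\<lambda>z. (fst z + a * snd z, b * snd z)) ` cbox (0, 0) (1, 1)"
  have E_fin: "emeasure lborel E < \<infinity>"
    using comp E_sub by (intro emeasure_bounded_finite bounded_subset[OF compact_imp_bounded])
  have wv_cont: "continuous_on S (\<lambda>z. w (v z))" for S
    using continuous_on_compose2[OF w(1) v_cont] continuous_on_subset by fastforce
  have "compact ((\<lambda>z. w (v z)) ` K)" by (rule compact_continuous_image[OF wv_cont comp[folded K_def]])
  then obtain M where M: "\<And>z. z \<in> K \<Longrightarrow> norm (w (v z)) \<le> M"
    using compact_imp_bounded bounded_iff by (metis image_eqI)
  have "z \<in> E \<longrightarrow> norm (w (v z)) \<le> M" for z
    using M E_sub unfolding K_def by blast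
  then have "AE z in lborel. z \<in> E \<longrightarrow> norm (w (v z)) \<le> M" by (intro AE_I2)
  then have int: "integrable lborel (\<lambda>z. indicator E z *\<^sub>R w (v z))"
    using E_meas E_fin measurable_compose[OF v_meas w_meas]
    by (intro integrableI_bounded_set_indicator[where B=M]) simp_all
  have "area (vector [1, 0]) (vector [a, b]) (\<lambda>x. w x *\<^sub>R mat 1) = (\<integral>x. indicator D x *\<^sub>R w x \<partial>lborel)"
  proof -
    have "sqrt (det (w x *\<^sub>R mat 1 :: real^2^2)) = w x" for x
      using w(2)[of x] by (simp add: det_2 mat_def)
    then show ?thesis by (simp add: area_def set_lebesgue_integral_def D_def)
  qed
  also have "\<dots> = (\<integral>z. indicator D (v z) *\<^sub>R w (v z) \<partial>lborel)"
    using v_meas w_meas D_meas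
    by (subst lborel_eq_distr_vec2, subst integral_distr) (simp_all add: v_def[abs_def])
  also have "\<dots> = (\<integral>z. indicator E z *\<^sub>R w (v z) \<partial>lborel)"
    using vE by (intro Bochner_Integration.integral_cong) (auto simp: indicator_def)
  also have "\<dots> = (\<integral>y. (\<integral>x. indicator E (x, y) *\<^sub>R w (v (x, y)) \<partial>lborel) \<partial>lborel)"
    using int by (simp add: lborel_prod[symmetric] lborel_pair.integral_snd case_prod_beta')
  also have "\<dots> = (\<integral>y. indicator {0..<1} (y / b) *\<^sub>R integral {0..1} (\<lambda>s. w (pt (s, y / b))) \<partial>lborel)"
  proof (intro Bochner_Integration.integral_cong refl)
    fix y :: real
    have "(\<integral>x. indicator E (x, y) *\<^sub>R w (v (x, y)) \<partial>lborel)
        = (\<integral>s. indicator E (a * (y / b) + 1 * s, y) *\<^sub>R w (v (a * (y / b) + 1 * s, y)) \<partial>lborel)"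
      by (subst lborel_integral_real_affine[where c=1 and t="a * (y / b)"]) auto
    also have "\<dots> = (\<integral>s. indicator {0..<1} (y / b) *\<^sub>R (indicator {0..<1} s *\<^sub>R w (pt (s, y / b))) \<partial>lborel)"
      using b_pos by (intro Bochner_Integration.integral_cong refl)
        (auto simp: indicator_def E_def v_def pt_def add.commute)
    also have "\<dots> = indicator {0..<1} (y / b) *\<^sub>R integral {0..1} (\<lambda>s. w (pt (s, y / b)))"
      by (subst lborel_integral_unit_interval[symmetric])
        (auto intro!: continuous_on_compose2[OF w(1)] continuous_on_pt continuous_intros)
    finally show "(\<integral>x. indicator E (x, y) *\<^sub>R w (v (x, y)) \<partial>lborel)
        = indicator {0..<1} (y / b) *\<^sub>R integral {0..1} (\<lambda>s. w (pt (s, y / b)))" .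
  qed
  also have "\<dots> = b * (\<integral>t. indicator {0..<1} t *\<^sub>R integral {0..1} (\<lambda>s. w (pt (s, t))) \<partial>lborel)"
    using b_pos by (subst lborel_integral_real_affine[where c=b and t=0]) auto
  also have "(\<integral>t. indicator {0..<1} t *\<^sub>R integral {0..1} (\<lambda>s. w (pt (s, t))) \<partial>lborel)
      = integral {0..1} (\<lambda>t. integral {0..1} (\<lambda>s. w (pt (s, t))))"
  proof (rule lborel_integral_unit_interval)
    have "continuous_on ({0..1} \<times> cbox 0 1) (\<lambda>(t, s). w (pt (s, t)))"
      unfolding case_prod_beta
      by (rule continuous_on_compose2[OF w(1)], rule continuous_on_pt) (auto intro!: continuous_intros)
    from integral_continuous_on_param[OF this]
    show "continuous_on {0..1} (\<lambda>t. integral {0..1} (\<lambda>s. w (pt (s, t))))" by simp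
  qed
  also have "\<dots> = avg w" by (rule avg_iterated(2)[OF w(1), symmetric])
  finally show ?thesis .
qed

end

section \<open>An algebraic inequality\<close>

context
  fixes P Q x y :: real
  assumes PQ: "P + Q = 1" "0 < Q" "0 < P" and xy: "0 \<le> x" "0 \<le> y"
begin

text \<open>In the variables n = P N and y / Q the discriminant is a square plus 4 n Q. This gives
  the lower bound 4 P N Q at once and exhibits the variables in which the extremal inequality is
  transparent.\<close>

lemma discriminant_identity:
  defines "n \<equiv> P * (1 - x / P - y / Q)" and "S \<equiv> 1 - x - y"
  shows "S\<^sup>2 - 4 * x * y = (y / Q + n - Q)\<^sup>2 + 4 * n * Q" "S = Q + (1 - 2 * Q) * (y / Q) + n"
proof -
  define z where "z = y / Q"
  have P: "P = 1 - Q" using PQ by simp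
  have y: "y = Q * z" using PQ by (simp add: z_def)
  have n: "n = P - x - P * z" using PQ by (simp add: n_def z_def algebra_simps)
  have x: "x = 1 - Q - z + Q * z - n" unfolding n P by (simp add: algebra_simps)
  have S: "S = Q + (1 - 2 * Q) * z + n"
    unfolding S_def x y by (simp add: algebra_simps)
  then show "S = Q + (1 - 2 * Q) * (y / Q) + n" by (simp add: z_def)
  show "S\<^sup>2 - 4 * x * y = (y / Q + n - Q)\<^sup>2 + 4 * n * Q"
    unfolding z_def[symmetric] unfolding S x y by (simp add: power2_eq_square algebra_simps)
qed

text \<open>In terms of \<open>z = y / Q\<close> and \<open>m = z + n\<close>, the difference of the two sides is
  \<open>4 (m - Q)\<^sup>2 + n (4 Q - 3 m) + 6 n Q z\<close>; if \<open>3 m > 4 Q\<close>, then \<open>n \<le> m\<close> bounds it from below by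
  \<open>(m - 2 Q)\<^sup>2\<close>.\<close>

lemma discriminant_bound:
  defines "n \<equiv> P * (1 - x / P - y / Q)" and "S \<equiv> 1 - x - y"
  assumes n: "0 \<le> n"
  shows "3 * n * (3 * Q + S) \<le> 4 * (S\<^sup>2 - 4 * x * y)"
    and "n \<le> Q\<^sup>2 \<Longrightarrow> Q \<le> 1 / 2 \<Longrightarrow> 3 * n * (3 * Q + S) \<le> (15 / 16) * (4 * (S\<^sup>2 - 4 * x * y))"
proof -
  define z where "z = y / Q"
  define m where "m = z + n"
  have z: "0 \<le> z" using PQ xy by (simp add: z_def)
  have nm: "n \<le> m" using z by (simp add: m_def)
  have D: "S\<^sup>2 - 4 * x * y = (m - Q)\<^sup>2 + 4 * n * Q"
    and S: "S = Q + (1 - 2 * Q) * z + n"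
    unfolding m_def z_def S_def n_def by (rule discriminant_identity)+
  have nQz: "0 \<le> n * Q * z" using n z PQ by simp
  have diff: "4 * (S\<^sup>2 - 4 * x * y) - 3 * n * (3 * Q + S) = 4 * (m - Q)\<^sup>2 + n * (4 * Q - 3 * m) + 6 * (n * Q * z)"
    unfolding D unfolding S m_def by (simp add: power2_eq_square algebra_simps)
  have "0 \<le> 4 * (m - Q)\<^sup>2 + n * (4 * Q - 3 * m)"
  proof (cases "3 * m \<le> 4 * Q")
    case True
    then show ?thesis using n by simp
  next
    case False
    then have "m * (4 * Q - 3 * m) \<le> n * (4 * Q - 3 * m)" using nm by (intro mult_right_mono_neg) auto
    moreover have "4 * (m - Q)\<^sup>2 + m * (4 * Q - 3 * m) = (m - 2 * Q)\<^sup>2"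
      by (simp add: power2_eq_square algebra_simps)
    ultimately show ?thesis using zero_le_power2[of "m - 2 * Q"] by linarith
  qed
  then show "3 * n * (3 * Q + S) \<le> 4 * (S\<^sup>2 - 4 * x * y)" using diff nQz by linarith
  assume nQ: "n \<le> Q\<^sup>2" and Q: "Q \<le> 1 / 2"
  \<comment> \<open>The factor 15/16 gives up one sixteenth of the right-hand side, which is (m -
    Q)^2 / 4 + n Q.\<close>
  have slack: "15 / 16 * A - K = 15 / 4 * U + (3 * g - 3 * h) + c"
    if "A - K = 4 * U + (4 * g - 3 * h) + c" "A = 4 * U + 16 * g" for A K U g h c :: real
    using that by linarith
  have diff': "(15 / 16) * (4 * (S\<^sup>2 - 4 * x * y)) - 3 * n * (3 * Q + S)
      = 15 / 4 * (m - Q)\<^sup>2 + 3 * n * (Q - m) + 6 * (n * Q * z)"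
  proof -
    have "n * (4 * Q - 3 * m) = 4 * (n * Q) - 3 * (n * m)" "3 * n * (Q - m) = 3 * (n * Q) - 3 * (n * m)"
      by (simp_all add: algebra_simps)
    moreover have "4 * ((m - Q)\<^sup>2 + 4 * n * Q) = 4 * (m - Q)\<^sup>2 + 16 * (n * Q)"
      by (simp add: mult.assoc distrib_left)
    ultimately show ?thesis using slack diff unfolding D by metis
  qed
  have "0 \<le> 15 / 4 * (m - Q)\<^sup>2 + 3 * n * (Q - m) + 6 * (n * Q * z)"
  proof (cases "m \<le> Q")
    case True
    then show ?thesis using n nQz by simp
  next
    case False
    \<comment> \<open>Completing the square with coefficient 2/5 leaves a deficit of 3/5 n^2. It is
      covered by 6 n Q z, as z = m - n > Q - Q^2 >= Q / 2 and n <= Q^2.\<close>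
    have "Q\<^sup>2 \<le> Q * (1 / 2)" unfolding power2_eq_square using Q PQ by (intro mult_left_mono) auto
    then have "Q / 2 \<le> z" using False nQ unfolding m_def by linarith
    then have "n * (6 * Q * (Q / 2)) \<le> n * (6 * Q * z)" using n PQ by (intro mult_left_mono) auto
    moreover have "n * (3 / 5 * n) \<le> n * (3 * Q\<^sup>2)" using nQ n by (intro mult_left_mono) auto
    moreover have "0 \<le> 15 / 4 * (m - Q - 2 / 5 * n)\<^sup>2" by simp
    moreover have "15 / 4 * (m - Q - 2 / 5 * n)\<^sup>2 = 15 / 4 * (m - Q)\<^sup>2 + 3 * n * (Q - m) + n * (3 / 5 * n)"
      by (simp add: power2_eq_square algebra_simps)
    moreover have "n * (6 * Q * (Q / 2)) = n * (3 * Q\<^sup>2)" "n * (6 * Q * z) = 6 * (n * Q * z)"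
      by (simp_all add: power2_eq_square)
    ultimately show ?thesis by linarith
  qed
  then show "3 * n * (3 * Q + S) \<le> (15 / 16) * (4 * (S\<^sup>2 - 4 * x * y))" using diff' by linarith
qed

text \<open>The root of \<open>S\<close> is removed by 2 sqrt(3 Q S) <= 3 Q + S. Equality at S = 3 Q
  is chosen to fit the extremal point y = 0, x = 1 - 3 Q of \<open>discriminant_bound\<close>, so
  that both inequalities are sharp together.\<close>

lemma energy_bound:
  defines "N \<equiv> 1 - x / P - y / Q" and "S \<equiv> 1 - x - y"
  assumes N: "0 < N" and D: "0 < S\<^sup>2 - 4 * x * y" and S: "0 < S"
  shows "N * (sqrt S / (S\<^sup>2 - 4 * x * y)) \<le> 2 / (3 * sqrt 3 * P * sqrt Q)"
    and "P * N \<le> Q\<^sup>2 \<Longrightarrow> Q \<le> 1 / 2 \<Longrightarrow>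
      N * (sqrt S / (S\<^sup>2 - 4 * x * y)) \<le> 15 / 16 * (2 / (3 * sqrt 3 * P * sqrt Q))"
proof -
  define R where "R = sqrt 3 * sqrt Q"
  define T where "T = sqrt S"
  have T: "0 < T" "S = T\<^sup>2" using S by (simp_all add: T_def)
  have R: "0 < R" "3 * Q = R\<^sup>2" using PQ by (simp_all add: R_def power_mult_distrib)
  have amgm: "2 * (R * T) \<le> 3 * Q + S"
    unfolding R(2) T(2) using zero_le_power2[of "R - T"] by (simp add: power2_eq_square algebra_simps)
  have PN: "0 \<le> P * N" using PQ N by simp
  have key: "N * (sqrt S / (S\<^sup>2 - 4 * x * y)) \<le> c * (2 / (3 * sqrt 3 * P * sqrt Q))"
    if c: "3 * (P * N) * (3 * Q + S) \<le> c * (4 * (S\<^sup>2 - 4 * x * y))" for c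
  proof -
    have "3 * (P * N) * (2 * (R * T)) \<le> 3 * (P * N) * (3 * Q + S)"
      using PN amgm by (intro mult_left_mono) auto
    moreover have "3 * (P * N) * (2 * (R * T)) = 2 * (N * T * (3 * P * R))"
      "c * (4 * (S\<^sup>2 - 4 * x * y)) = 2 * (c * 2 * (S\<^sup>2 - 4 * x * y))" by simp_all
    ultimately have "N * T * (3 * P * R) \<le> c * 2 * (S\<^sup>2 - 4 * x * y)" using c by linarith
    then have "N * T / (S\<^sup>2 - 4 * x * y) \<le> c * 2 / (3 * P * R)"
      using D PQ R(1) by (simp add: field_simps)
    then show ?thesis by (simp add: T_def R_def mult_ac)
  qed
  show "N * (sqrt S / (S\<^sup>2 - 4 * x * y)) \<le> 2 / (3 * sqrt 3 * P * sqrt Q)"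
    using key[of 1] discriminant_bound(1) PN unfolding N_def S_def by simp
  show "N * (sqrt S / (S\<^sup>2 - 4 * x * y)) \<le> 15 / 16 * (2 / (3 * sqrt 3 * P * sqrt Q))"
    if "P * N \<le> Q\<^sup>2" "Q \<le> 1 / 2"
    using key[of "15 / 16"] discriminant_bound(2) PN that unfolding N_def S_def by simp
qed

end

section \<open>Hersch's balancing argument\<close>

context torus
begin

text \<open>The first slot carries the frequency (0, 1), whose squared gradient
  \<open>4 * pi\<^sup>2 / b\<^sup>2\<close> is the smaller one on the moduli space; the second has
  a^2 + b^2 times as much. Complex amplitudes let one definition cover the derivatives as
  well.\<close>

definition emb :: "complex \<Rightarrow> complex \<Rightarrow> real^2 \<Rightarrow> complex \<times> complex" where
  "emb c1 c2 x = (c1 * ch (0, 1) x, c2 * ch (1, 0) x)"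

lemma continuous_emb [continuous_intros]: "continuous_on T (emb c1 c2)"
  unfolding emb_def[abs_def] by (intro continuous_intros)

lemma periodic_emb: "periodic \<Gamma> (emb c1 c2)"
  using periodic_ch by (simp add: emb_def[abs_def] periodic_def)

lemma inner_emb: "t \<bullet> emb c1 c2 x = Re (c1 * cnj (fst t) * ch (0, 1) x) + Re (c2 * cnj (snd t) * ch (1, 0) x)"
  by (cases t) (simp add: emb_def inner_complex_def algebra_simps)

lemma conf_eq_inner: "1 - t \<bullet> emb c1 c2 x = conf (c1 * cnj (fst t)) (c2 * cnj (snd t)) x"
  unfolding inner_emb conf_def by simp

lemma norm_emb: "norm (emb c1 c2 x) = sqrt ((norm c1)\<^sup>2 + (norm c2)\<^sup>2)"
  by (simp add: emb_def norm_prod_def norm_mult)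

lemma avg_inner_emb: "avg (\<lambda>x. t \<bullet> emb c1 c2 x) = 0"
proof -
  have z: "avg (\<lambda>x. Re (c * ch k x)) = 0" if "k \<noteq> 0" for c k
  proof -
    have "avg (\<lambda>x. Re (c * ch k x)) = Re (avg (\<lambda>x. c * ch k x))"
      by (intro avg_bounded_linear bounded_linear_Re continuous_intros)
    also have "avg (\<lambda>x. c * ch k x) = c * avg (ch k)" by (intro avg_cmult continuous_intros)
    finally show ?thesis using that by (simp add: avg_ch)
  qed
  have ne: "(0, 1) \<noteq> (0 :: int \<times> int)" "(1, 0) \<noteq> (0 :: int \<times> int)" by (simp_all add: zero_prod_def)
  have c: "continuous_on UNIV (\<lambda>x. Re (c * ch k x))" for c k by (intro continuous_intros)
  show ?thesis unfolding inner_emb avg_add[OF c c] z[OF ne(1)] z[OF ne(2)] by simp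
qed

end

text \<open>Cauchy-Schwarz; for |t| < 1 it keeps the amplitudes in the range where
  \<open>conf\<close> is positive.\<close>

lemma norm_weighted_le:
  fixes t :: "complex \<times> complex"
  assumes "p\<^sup>2 + q\<^sup>2 = 1" "0 < p" "0 < q"
  shows "norm (of_real p * cnj (fst t)) + norm (of_real q * cnj (snd t)) \<le> norm t"
proof -
  have "(p, q) \<bullet> (norm (fst t), norm (snd t)) \<le> norm (p, q) * norm (norm (fst t), norm (snd t))"
    by (rule norm_cauchy_schwarz)
  then show ?thesis using assms by (cases t) (simp add: norm_prod_def norm_mult)
qed

locale balanced_torus = conformal_factor +
  fixes p q :: real
  assumes pq: "p\<^sup>2 + q\<^sup>2 = 1" "0 < p" "0 < q"
begin

abbreviation \<phi> :: "real^2 \<Rightarrow> complex \<times> complex" where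
  "\<phi> \<equiv> emb (of_real p) (of_real q)"

definition X :: "complex \<times> complex \<Rightarrow> real^2 \<Rightarrow> real" where
  "X t x = 1 - t \<bullet> \<phi> x"

lemma norm_\<phi>: "norm (\<phi> x) = 1"
  using pq by (simp add: norm_emb)

lemma X_conf: "X t = conf (of_real p * cnj (fst t)) (of_real q * cnj (snd t))"
  unfolding X_def[abs_def] conf_eq_inner ..

lemma X_ge: "1 - norm t \<le> X t x"
  using norm_cauchy_schwarz[of t "\<phi> x"] by (simp add: X_def norm_\<phi>)

lemma X_pos: "norm t < 1 \<Longrightarrow> 0 < X t x"
  using X_ge[of t x] by simp

lemma X_continuous: "continuous_on T (X t)"
  unfolding X_def[abs_def] by (intro continuous_intros)

lemma X_periodic: "periodic \<Gamma> (X t)"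
  using periodic_emb by (simp add: X_def[abs_def] periodic_def)

text \<open>With x and y the squared amplitudes of the two cosines, N is 1 - x / P - y / Q, which
  links the averages to the algebra. The bound for the mean of 1 / X comes from D >= 4 P N
  Q.\<close>

lemma
  assumes t: "norm t < 1"
  defines "N \<equiv> 1 - (norm t)\<^sup>2"
  shows N_pos: "0 < N"
    and avg_inverse_X_le: "avg (\<lambda>x. 1 / X t x) \<le> 1 / sqrt (sqrt (4 * (p\<^sup>2 * N) * q\<^sup>2))"
    and avg_inverse_square_X_le: "N * avg (\<lambda>x. 1 / (X t x)\<^sup>2) \<le> 2 / (3 * sqrt 3 * p\<^sup>2 * q)"
    and avg_inverse_square_X_le': "p\<^sup>2 * N \<le> (q\<^sup>2)\<^sup>2 \<Longrightarrow> q\<^sup>2 \<le> 1 / 2 \<Longrightarrow>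
      N * avg (\<lambda>x. 1 / (X t x)\<^sup>2) \<le> 15 / 16 * (2 / (3 * sqrt 3 * p\<^sup>2 * q))"
proof -
  define A B where "A = of_real p * cnj (fst t)" and "B = of_real q * cnj (snd t)"
  have AB: "norm A + norm B < 1"
    using norm_weighted_le[OF pq, of t] t unfolding A_def B_def by linarith
  define x y where "x = (norm A)\<^sup>2" and "y = (norm B)\<^sup>2"
  have xy: "x = p\<^sup>2 * (norm (fst t))\<^sup>2" "y = q\<^sup>2 * (norm (snd t))\<^sup>2"
    unfolding x_def y_def A_def B_def by (simp_all add: norm_mult power_mult_distrib)
  have xy0: "0 \<le> x" "0 \<le> y" by (simp_all add: x_def y_def)
  have PQ: "0 < p\<^sup>2" "0 < q\<^sup>2" using pq by simp_all
  have N: "N = 1 - x / p\<^sup>2 - y / q\<^sup>2"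
    using PQ pq(2,3) unfolding N_def xy by (cases t) (simp add: norm_prod_def)
  have "(norm t)\<^sup>2 < 1\<^sup>2" using t by (intro power_strict_mono) auto
  then show Np: "0 < N" by (simp add: N_def)
  define S where "S = 1 - x - y"
  have S: "S = 1 - (norm A)\<^sup>2 - (norm B)\<^sup>2" by (simp add: S_def x_def y_def)
  note sd = SD[OF AB, folded S]
  have D: "S\<^sup>2 - 4 * (norm A)\<^sup>2 * (norm B)\<^sup>2 = S\<^sup>2 - 4 * x * y" by (simp add: x_def y_def)
  have D0: "4 * (p\<^sup>2 * N) * q\<^sup>2 \<le> S\<^sup>2 - 4 * x * y"
    using discriminant_identity(1)[OF pq(1) PQ(2,1) xy0] unfolding S_def N by simp
  have D1: "0 < 4 * (p\<^sup>2 * N) * q\<^sup>2" using PQ Np by simp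
  have "avg (\<lambda>x. 1 / X t x) \<le> 1 / sqrt (sqrt (S\<^sup>2 - 4 * x * y))"
    using avg_conf_inverse_le[OF AB, folded S] unfolding D X_conf A_def[symmetric] B_def[symmetric] .
  also have "\<dots> \<le> 1 / sqrt (sqrt (4 * (p\<^sup>2 * N) * q\<^sup>2))"
  proof -
    have "1 / sqrt (sqrt u) \<le> 1 / sqrt (sqrt v)" if "v \<le> u" "0 < v" for u v :: real
      using that by (intro divide_left_mono) auto
    then show ?thesis using D0 D1 .
  qed
  finally show "avg (\<lambda>x. 1 / X t x) \<le> 1 / sqrt (sqrt (4 * (p\<^sup>2 * N) * q\<^sup>2))" .
  have "avg (\<lambda>x. 1 / (X t x)\<^sup>2) \<le> sqrt S / (S\<^sup>2 - 4 * x * y)"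
    using avg_conf_inverse_square_le[OF AB, folded S] unfolding D X_conf A_def[symmetric] B_def[symmetric] .
  then have le: "N * avg (\<lambda>x. 1 / (X t x)\<^sup>2) \<le> N * (sqrt S / (S\<^sup>2 - 4 * x * y))"
    using Np by (intro mult_left_mono) auto
  have q: "sqrt (q\<^sup>2) = q" using pq by simp
  have D2: "0 < S\<^sup>2 - 4 * x * y" using D0 D1 by linarith
  note eb = energy_bound[OF pq(1) PQ(2,1) xy0, folded N S_def, OF Np D2 sd(1), unfolded q]
  show "N * avg (\<lambda>x. 1 / (X t x)\<^sup>2) \<le> 2 / (3 * sqrt 3 * p\<^sup>2 * q)"
    using le eb(1) by linarith
  show "N * avg (\<lambda>x. 1 / (X t x)\<^sup>2) \<le> 15 / 16 * (2 / (3 * sqrt 3 * p\<^sup>2 * q))"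
    if "p\<^sup>2 * N \<le> (q\<^sup>2)\<^sup>2" "q\<^sup>2 \<le> 1 / 2"
    using le eb(2)[OF that] by linarith
qed

text \<open>The weighted mean of ln (X / sqrt (1 - |t|^2)), which is the Busemann function of
  hyperbolic 4-space in the Klein model. A minimum is a conformal barycentre of the measure that
  \<open>w\<close> induces on the sphere.\<close>

definition \<Psi> :: "complex \<times> complex \<Rightarrow> real" where
  "\<Psi> t = avg (\<lambda>x. w x * ln (X t x)) / avg w - ln (1 - (norm t)\<^sup>2) / 2"

lemma ln_X_continuous: "norm t < 1 \<Longrightarrow> continuous_on T (\<lambda>x. ln (X t x))"
  by (intro continuous_on_ln X_continuous) (metis X_pos less_irrefl)

text \<open>Coercivity could fail only by concentration of the induced measure. The mean of 1 / X
  grows at most like N^(-1/4) with N = 1 - |t|^2, so the logarithmic term loses no more than |ln N|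
  / 4 up to a constant, against a gain of |ln N| / 2.\<close>

lemma \<Psi>_coercive: "\<exists>C. \<forall>t. norm t < 1 \<longrightarrow> - C - ln (1 - (norm t)\<^sup>2) / 4 \<le> \<Psi> t"
proof -
  obtain W where W: "0 < W" "\<And>x. w x \<le> W" using w_bounds by metis
  define k where "k = 4 * p\<^sup>2 * q\<^sup>2"
  define C where "C = W / sqrt (sqrt k) / avg w"
  have k: "0 < k" using pq by (simp add: k_def)
  have "- C - ln (1 - (norm t)\<^sup>2) / 4 \<le> \<Psi> t" if t: "norm t < 1" for t
  proof -
    define N where "N = 1 - (norm t)\<^sup>2"
    have N: "0 < N" unfolding N_def by (rule N_pos[OF t])
    \<comment> \<open>The scale at which the bound ln X >= 1 + ln r - r / X is useful:
      \<open>r\<close> times the mean of 1 / X stays bounded in \<open>t\<close>.\<close>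
    define r where "r = sqrt (sqrt N)"
    have r: "0 < r" "ln r = ln N / 4" using N by (simp_all add: r_def ln_sqrt)
    have low: "(1 + ln r) * w x + (- (W * r)) * (1 / X t x) \<le> w x * ln (X t x)" for x
    proof -
      have X: "0 < X t x" by (rule X_pos[OF t])
      have "ln (r / X t x) \<le> r / X t x - 1" using r X by (intro ln_le_minus_one) simp
      then have "1 + ln r - r / X t x \<le> ln (X t x)" using r X by (simp add: ln_div)
      then have "w x * (1 + ln r - r / X t x) \<le> w x * ln (X t x)"
        using w_pos[of x] by (intro mult_left_mono) auto
      moreover have "w x * (r / X t x) \<le> W * (r / X t x)"
        using W(2) r X by (intro mult_right_mono) auto
      moreover have "w x * (1 + ln r - r / X t x) = (1 + ln r) * w x - w x * (r / X t x)"
        by (simp add: algebra_simps)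
      ultimately show ?thesis by simp
    qed
    have Xinv: "continuous_on UNIV (\<lambda>x. 1 / X t x)"
      by (intro continuous_on_divide X_continuous continuous_on_const) (metis X_pos[OF t] less_irrefl)
    have "avg (\<lambda>x. \<alpha> * w x + \<beta> * (1 / X t x)) = \<alpha> * avg w + \<beta> * avg (\<lambda>x. 1 / X t x)" for \<alpha> \<beta>
      by (simp only: avg_add continuous_on_mult_left w_cont Xinv avg_cmult)
    then have "(1 + ln r) * avg w + (- (W * r)) * avg (\<lambda>x. 1 / X t x)
        = avg (\<lambda>x. (1 + ln r) * w x + (- (W * r)) * (1 / X t x))" by (rule sym)
    also have "\<dots> \<le> avg (\<lambda>x. w x * ln (X t x))"
      by (intro avg_mono low continuous_on_add continuous_on_mult w_cont Xinv continuous_on_const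
          ln_X_continuous[OF t])
    finally have 1: "(1 + ln r) * avg w - W * r * avg (\<lambda>x. 1 / X t x) \<le> avg (\<lambda>x. w x * ln (X t x))"
      by simp
    have "avg (\<lambda>x. 1 / X t x) \<le> 1 / (sqrt (sqrt k) * r)"
    proof -
      have "4 * (p\<^sup>2 * N) * q\<^sup>2 = k * N" by (simp add: k_def mult_ac)
      then show ?thesis
        using avg_inverse_X_le[OF t] unfolding N_def[symmetric] r_def
        by (simp only: real_sqrt_mult)
    qed
    then have "W * r * avg (\<lambda>x. 1 / X t x) \<le> W * r * (1 / (sqrt (sqrt k) * r))"
      using W(1) r by (intro mult_left_mono) auto
    also have "\<dots> = W / sqrt (sqrt k)" using r by simp
    finally have "(1 + ln r) * avg w - W / sqrt (sqrt k) \<le> avg (\<lambda>x. w x * ln (X t x))"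
      using 1 by linarith
    then have "((1 + ln r) * avg w - W / sqrt (sqrt k)) / avg w \<le> avg (\<lambda>x. w x * ln (X t x)) / avg w"
      using avg_w_pos by (intro divide_right_mono) auto
    moreover have "((1 + ln r) * avg w - W / sqrt (sqrt k)) / avg w = 1 + ln r - C"
      using avg_w_pos by (simp add: C_def diff_divide_distrib)
    ultimately have "1 + ln N / 4 - C \<le> avg (\<lambda>x. w x * ln (X t x)) / avg w"
      by (simp add: r(2))
    then show ?thesis unfolding \<Psi>_def N_def[symmetric] by simp
  qed
  then show ?thesis by blast
qed

lemma \<Psi>_continuous: "continuous_on (ball 0 1) \<Psi>"
proof -
  have "continuous_on (ball 0 1 \<times> cbox (0, 0) (1, 1)) (\<lambda>(t, z). w (pt z) * ln (X t (pt z)))"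
  proof -
    have "continuous_on (ball 0 1 \<times> cbox (0, 0) (1, 1)) (\<lambda>u. w (pt (snd u)) * ln (1 - fst u \<bullet> \<phi> (pt (snd u))))"
    proof (intro continuous_on_mult continuous_on_ln ballI)
      show "continuous_on (ball 0 1 \<times> cbox (0, 0) (1, 1)) (\<lambda>u. w (pt (snd u)))"
        by (rule continuous_on_compose2[OF w_cont[of UNIV]]) (auto intro!: continuous_intros)
      show "continuous_on (ball 0 1 \<times> cbox (0, 0) (1, 1)) (\<lambda>u. 1 - fst u \<bullet> \<phi> (pt (snd u)))"
        by (intro continuous_intros continuous_on_compose2[OF continuous_emb[of UNIV]]) auto
      fix u assume "u \<in> ball (0 :: complex \<times> complex) 1 \<times> cbox (0 :: real, 0 :: real) (1, 1)"
      then show "1 - fst u \<bullet> \<phi> (pt (snd u)) \<noteq> 0"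
        using X_pos[of "fst u" "pt (snd u)"] by (auto simp: X_def)
    qed
    then show ?thesis by (simp add: case_prod_beta' X_def)
  qed
  from integral_continuous_on_param[OF this]
  have "continuous_on (ball 0 1) (\<lambda>t. avg (\<lambda>x. w x * ln (X t x)))"
    by (simp add: avg_def)
  moreover have "continuous_on (ball 0 1) (\<lambda>t :: complex \<times> complex. ln (1 - (norm t)\<^sup>2))"
    using N_pos by (intro continuous_intros) (metis dist_0_norm less_irrefl mem_ball)
  ultimately show ?thesis
    unfolding \<Psi>_def[abs_def] using avg_w_pos
    by (intro continuous_on_diff continuous_on_divide continuous_on_const) auto
qed

lemma \<Psi>_min: obtains t where "norm t < 1" "\<And>t'. norm t' < 1 \<Longrightarrow> \<Psi> t \<le> \<Psi> t'"
proof -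
  obtain C where C: "\<And>t. norm t < 1 \<Longrightarrow> - C - ln (1 - (norm t)\<^sup>2) / 4 \<le> \<Psi> t"
    using \<Psi>_coercive by blast
  \<comment> \<open>Makes the coercive lower bound exceed 0 = \<Psi> 0 outside the ball of radius
    \<open>\<rho>\<close>; the absolute value allows either sign of \<open>C\<close>.\<close>
  define N0 where "N0 = exp (- (4 * \<bar>C\<bar> + 1))"
  have N0: "0 < N0" "N0 < 1" by (simp_all add: N0_def)
  define \<rho> where "\<rho> = sqrt (1 - N0)"
  have \<rho>: "0 \<le> \<rho>" "\<rho> < 1" using N0 by (simp_all add: \<rho>_def)
  have \<Psi>0: "\<Psi> 0 = 0" by (simp add: \<Psi>_def X_def)
  have outside: "0 < \<Psi> t" if t: "norm t < 1" "\<rho> < norm t" for t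
  proof -
    have "\<rho>\<^sup>2 < (norm t)\<^sup>2" using t \<rho> by (intro power_strict_mono) auto
    then have "1 - (norm t)\<^sup>2 < N0" using N0 by (simp add: \<rho>_def)
    then have "ln (1 - (norm t)\<^sup>2) < ln N0" using N_pos[OF t(1)] N0 by simp
    also have "ln N0 = - (4 * \<bar>C\<bar> + 1)" by (simp add: N0_def)
    finally show ?thesis using C[OF t(1)] by (simp add: field_simps abs_if split: if_splits)
  qed
  have "continuous_on (cball 0 \<rho>) \<Psi>"
    by (rule continuous_on_subset[OF \<Psi>_continuous]) (use \<rho> in auto)
  moreover have "cball (0 :: complex \<times> complex) \<rho> \<noteq> {}" using \<rho> by simp
  ultimately obtain t where t: "t \<in> cball 0 \<rho>" "\<And>t'. t' \<in> cball 0 \<rho> \<Longrightarrow> \<Psi> t \<le> \<Psi> t'"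
    using continuous_attains_inf[OF compact_cball] by blast
  have "\<Psi> t \<le> \<Psi> t'" if "norm t' < 1" for t'
  proof (cases "norm t' \<le> \<rho>")
    case True
    then show ?thesis using t(2) by simp
  next
    case False
    then have "0 < \<Psi> t'" using outside that by simp
    moreover have "\<Psi> t \<le> \<Psi> 0" using t(2) \<rho> by simp
    ultimately show ?thesis using \<Psi>0 by simp
  qed
  moreover have "norm t < 1" using t(1) \<rho> by simp
  ultimately show ?thesis using that by blast
qed

text \<open>By concavity of the logarithm, \<open>ln (X - s \<delta>) \<le> ln X - s \<delta> / X\<close>; hence the difference quotients
  of \<open>\<Psi>\<close> at the minimum are bounded by those of an explicit function of \<open>s\<close>, and no
  differentiation under the integral sign is needed.\<close>

lemma balanced_point:
  obtains t where "norm t < 1"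
    "\<And>e. avg (\<lambda>x. w x * ((e \<bullet> \<phi> x) / X t x)) = avg w * ((t \<bullet> e) / (1 - (norm t)\<^sup>2))"
proof -
  obtain t where t: "norm t < 1" "\<And>t'. norm t' < 1 \<Longrightarrow> \<Psi> t \<le> \<Psi> t'" using \<Psi>_min by blast
  note Np = N_pos[OF t(1)]
  have "avg (\<lambda>x. w x * ((e \<bullet> \<phi> x) / X t x)) = avg w * ((t \<bullet> e) / (1 - (norm t)\<^sup>2))" for e
  proof -
    define I where "I = avg (\<lambda>x. w x * ((e \<bullet> \<phi> x) / X t x))"
    define h where "h s = s * (- I / avg w) - ln (1 - (t + s *\<^sub>R e) \<bullet> (t + s *\<^sub>R e)) / 2" for s
    define d where "d = (1 - norm t) / (1 + norm e)"
    have d: "0 < d" using t(1) by (simp add: d_def add_pos_nonneg)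
    have small: "norm (t + s *\<^sub>R e) < 1" if "\<bar>s\<bar> < d" for s
    proof -
      have "norm (t + s *\<^sub>R e) \<le> norm t + \<bar>s\<bar> * norm e"
        by (metis norm_scaleR norm_triangle_ineq)
      also have "\<bar>s\<bar> * norm e \<le> \<bar>s\<bar> * (1 + norm e)" by (intro mult_left_mono) auto
      also have "\<bar>s\<bar> * (1 + norm e) < d * (1 + norm e)"
        using that by (intro mult_strict_right_mono) (auto simp: add_pos_nonneg)
      also have "d * (1 + norm e) = 1 - norm t"
        using norm_ge_zero[of e] by (simp add: d_def add_nonneg_eq_0_iff)
      finally show ?thesis by simp
    qed
    have Xne: "X t x \<noteq> 0" for x using X_pos[OF t(1), of x] by simp
    have quot: "continuous_on UNIV (\<lambda>x. w x * ((e \<bullet> \<phi> x) / X t x))"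
      by (intro continuous_intros w_cont X_continuous) (use Xne in auto)
    have min: "h 0 \<le> h s" if s: "\<bar>s\<bar> < d" for s
    proof -
      have le: "w x * ln (X (t + s *\<^sub>R e) x) \<le> w x * ln (X t x) - s * (w x * ((e \<bullet> \<phi> x) / X t x))" for x
      proof -
        have X: "0 < X t x" "0 < X (t + s *\<^sub>R e) x" using X_pos t(1) small[OF s] by blast+
        have "ln (X (t + s *\<^sub>R e) x / X t x) \<le> X (t + s *\<^sub>R e) x / X t x - 1"
          using X by (intro ln_le_minus_one) simp
        also have "X (t + s *\<^sub>R e) x / X t x - 1 = - s * ((e \<bullet> \<phi> x) / X t x)"
          using X by (simp add: field_simps) (simp add: X_def inner_add_left algebra_simps)
        finally have "ln (X (t + s *\<^sub>R e) x) \<le> ln (X t x) + (- s * ((e \<bullet> \<phi> x) / X t x))"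
          using X by (simp add: ln_div)
        then have "w x * ln (X (t + s *\<^sub>R e) x) \<le> w x * (ln (X t x) + (- s * ((e \<bullet> \<phi> x) / X t x)))"
          using w_pos[of x] by (intro mult_left_mono) auto
        then show ?thesis by (simp add: algebra_simps)
      qed
      have "avg (\<lambda>x. w x * ln (X (t + s *\<^sub>R e) x))
          \<le> avg (\<lambda>x. w x * ln (X t x) - s * (w x * ((e \<bullet> \<phi> x) / X t x)))"
        by (intro avg_mono le continuous_on_mult continuous_on_diff w_cont ln_X_continuous t(1) small s
            continuous_on_mult_left[OF quot])
      also have "\<dots> = avg (\<lambda>x. w x * ln (X t x)) - s * I"
        unfolding I_def
        by (simp only: avg_diff avg_cmult[OF quot] continuous_on_mult_left[OF quot]
            continuous_on_mult w_cont ln_X_continuous t(1))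
      finally have "avg (\<lambda>x. w x * ln (X (t + s *\<^sub>R e) x)) / avg w
          \<le> (avg (\<lambda>x. w x * ln (X t x)) - s * I) / avg w"
        using avg_w_pos by (intro divide_right_mono) auto
      moreover have "\<Psi> t \<le> \<Psi> (t + s *\<^sub>R e)" by (rule t(2)[OF small[OF s]])
      ultimately show ?thesis
        unfolding h_def \<Psi>_def power2_norm_eq_inner by (simp add: diff_divide_distrib)
    qed
    have der: "(h has_real_derivative - I / avg w + (t \<bullet> e) / (1 - (norm t)\<^sup>2)) (at 0)"
    proof -
      have eq: "h = (\<lambda>s. s * (- I / avg w) - ln (1 - t \<bullet> t - 2 * s * (t \<bullet> e) - s\<^sup>2 * (e \<bullet> e)) / 2)"
        unfolding h_def
        by (auto simp: inner_add_left inner_add_right inner_commute power2_eq_square algebra_simps)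
      have "0 < 1 - t \<bullet> t" using Np by (simp add: power2_norm_eq_inner)
      then show ?thesis unfolding eq power2_norm_eq_inner using avg_w_pos
        by (auto intro!: derivative_eq_intros simp: field_simps)
    qed
    have "- I / avg w + (t \<bullet> e) / (1 - (norm t)\<^sup>2) = 0"
      by (rule DERIV_local_min[OF der d]) (use min in auto)
    then show ?thesis unfolding I_def[symmetric] using avg_w_pos by (simp add: field_simps)
  qed
  with t(1) show ?thesis using that by blast
qed

end

section \<open>The energy of the balanced map\<close>

lemma
  assumes "smooth f" "smooth g"
  shows smooth_partial_mult: "partial_deriv i (\<lambda>x. f x * g x) = (\<lambda>x. partial_deriv i f x * g x + f x * partial_deriv i g x)"
    and smooth_partial_add: "partial_deriv i (\<lambda>x. f x + g x) = (\<lambda>x. partial_deriv i f x + partial_deriv i g x)"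
    and smooth_partial_diff: "partial_deriv i (\<lambda>x. f x - g x) = (\<lambda>x. partial_deriv i f x - partial_deriv i g x)"
  using assms by (auto intro!: partial_deriv_mult partial_deriv_add partial_deriv_diff smooth_differentiable)

text \<open>The point \<open>U\<close> is the image of the unit vector \<open>\<phi>\<close> under the Moebius transformation of the
  sphere belonging to \<open>v\<close>, and \<open>H\<close> is \<open>X\<^sup>3\<close> times the image of the tangent vector \<open>\<psi>\<close> under its
  differential; primes denote derivatives in one direction of the torus. The factor \<open>X\<^sup>3\<close> makes the
  average of \<open>U' \<bullet> H'\<close> independent of everything but \<open>\<sigma>\<close>.\<close>

context
  fixes \<phi> \<psi> \<phi>' \<psi>' t v U H U' H' :: "'z::real_inner" and \<sigma> g X \<tau> \<mu> \<mu>' :: real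
  assumes inner: "\<phi> \<bullet> \<phi> = 1" "\<psi> \<bullet> \<psi> = 1" "\<phi> \<bullet> \<psi> = 0" "\<phi>' \<bullet> \<phi> = 0" "\<phi>' \<bullet> \<psi> = 0" "\<psi>' \<bullet> \<phi> = 0"
    and \<sigma>: "0 < \<sigma>" "\<sigma>\<^sup>2 = 1 - t \<bullet> t" and g: "g = 1 / (1 + \<sigma>)" and v: "v = g *\<^sub>R t"
    and X: "X = 1 - t \<bullet> \<phi>" "0 < X"
    and coeffs: "\<tau> = t \<bullet> \<phi>'" "\<mu> = t \<bullet> \<psi>" "\<mu>' = t \<bullet> \<psi>'"
    and U: "U = (\<sigma> / X) *\<^sub>R (\<phi> - v) - v"
    and H: "H = \<sigma> *\<^sub>R (X\<^sup>2 *\<^sub>R \<psi> + (X * \<mu>) *\<^sub>R (\<phi> - v))"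
    and U': "U' = (\<sigma> / X) *\<^sub>R \<phi>' + (\<sigma> * \<tau> / X\<^sup>2) *\<^sub>R (\<phi> - v)"
    and H': "H' = \<sigma> *\<^sub>R (- (2 * X * \<tau>) *\<^sub>R \<psi> + X\<^sup>2 *\<^sub>R \<psi>' + (X * \<mu>' - \<tau> * \<mu>) *\<^sub>R (\<phi> - v) + (X * \<mu>) *\<^sub>R \<phi>')"
begin

text \<open>\<open>v\<close> is the point of the conformal ball model corresponding to
  \<open>t\<close> in the Klein model. Since \<open>d \<bullet> d = 2 * g * X\<close> and 1 - v
  \<bullet> v = 2 g \<sigma>, the factor \<sigma> / X in \<open>U\<close> is the usual (1 - |v|^2) /
  |\<phi> - v|^2.\<close>

lemma moebius_scalars:
  defines "d \<equiv> \<phi> - v"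
  shows "d \<bullet> d = 2 * g * X" "\<phi>' \<bullet> d = - g * \<tau>" "\<psi> \<bullet> d = - g * \<mu>" "\<psi>' \<bullet> d = - g * \<mu>'"
    "v \<bullet> d = g * (\<sigma> - X)" "v \<bullet> v = g * (1 - \<sigma>)" "v \<bullet> \<psi> = g * \<mu>" "g * (1 + \<sigma>) = 1"
proof -
  show g1: "g * (1 + \<sigma>) = 1" using \<sigma>(1) by (simp add: g)
  have tt: "t \<bullet> t = (1 + \<sigma>) * (1 - \<sigma>)" using \<sigma>(2) by (simp add: power2_eq_square algebra_simps)
  have t\<phi>: "t \<bullet> \<phi> = 1 - X" using X by simp
  have "v \<bullet> v = g * (g * (1 + \<sigma>)) * (1 - \<sigma>)" by (simp add: v tt)
  then show vv: "v \<bullet> v = g * (1 - \<sigma>)" by (simp add: g1)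
  have v\<phi>: "v \<bullet> \<phi> = g * (1 - X)" by (simp add: v t\<phi>)
  then show "v \<bullet> d = g * (\<sigma> - X)" by (simp add: d_def inner_diff_right vv algebra_simps)
  have "d \<bullet> d = 1 - 2 * (v \<bullet> \<phi>) + v \<bullet> v"
    by (simp add: d_def inner_diff_left inner_diff_right inner inner_commute)
  also have "\<dots> = g * (1 + \<sigma>) - 2 * g * (1 - X) + g * (1 - \<sigma>)" unfolding v\<phi> vv g1 by simp
  finally show "d \<bullet> d = 2 * g * X" by (simp add: algebra_simps)
  show "\<phi>' \<bullet> d = - g * \<tau>" "\<psi> \<bullet> d = - g * \<mu>" "\<psi>' \<bullet> d = - g * \<mu>'" "v \<bullet> \<psi> = g * \<mu>"
    using inner by (simp_all add: d_def inner_diff_right v coeffs inner_commute)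
qed

text \<open>The third identity is conformality: tangent lengths are multiplied by \<sigma> / X. In
  the fourth, X will have mean 1 and \<mu> mean 0, which leaves \<sigma>^2 (\<phi>' \<bullet>
  \<psi>').\<close>

lemma moebius_inner:
  shows "U \<bullet> U = 1" "U \<bullet> H = 0" "U' \<bullet> U' = \<sigma>\<^sup>2 * (\<phi>' \<bullet> \<phi>') * (1 / X\<^sup>2)"
    "U' \<bullet> H' = \<sigma>\<^sup>2 * (X * (\<phi>' \<bullet> \<psi>') + \<mu> * (\<phi>' \<bullet> \<phi>'))"
proof -
  define d where "d = \<phi> - v"
  note sc = moebius_scalars[folded d_def]
  have sc': "d \<bullet> \<phi>' = - g * \<tau>" "d \<bullet> \<psi> = - g * \<mu>" "d \<bullet> \<psi>' = - g * \<mu>'" "d \<bullet> v = g * (\<sigma> - X)" "\<psi> \<bullet> v = g * \<mu>" "\<psi> \<bullet> \<phi>' = 0"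
    using sc inner by (simp_all add: inner_commute)
  have Xne: "X \<noteq> 0" using X by simp
  have "U \<bullet> U = (\<sigma> / X) * (\<sigma> / X) * (2 * g * X) - 2 * ((\<sigma> / X) * (g * (\<sigma> - X))) + g * (1 - \<sigma>)"
    unfolding U d_def[symmetric]
    by (simp add: inner_diff_left inner_diff_right sc sc' algebra_simps diff_divide_distrib)
  also have "\<dots> = g * (1 + \<sigma>)" using Xne by (simp add: field_simps)
  finally show "U \<bullet> U = 1" by (simp add: sc(8))
  show "U \<bullet> H = 0"
    unfolding U H d_def[symmetric] using Xne
    by (simp add: inner_diff_left inner_add_right sc sc' field_simps power2_eq_square)
  show "U' \<bullet> U' = \<sigma>\<^sup>2 * (\<phi>' \<bullet> \<phi>') * (1 / X\<^sup>2)"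
    unfolding U' d_def[symmetric] using Xne
    by (simp add: inner_add_left inner_add_right sc sc' field_simps power2_eq_square)
  have 1: "\<phi>' \<bullet> H' = \<sigma> * (X\<^sup>2 * (\<phi>' \<bullet> \<psi>') + (X * \<mu>' - \<tau> * \<mu>) * (- g * \<tau>) + X * \<mu> * (\<phi>' \<bullet> \<phi>'))"
    unfolding H' d_def[symmetric]
    by (simp add: inner_add_right inner_diff_right inner sc sc' del: mult_minus_left mult_minus_right)
  have 2: "d \<bullet> H' = \<sigma> * (- (2 * X * \<tau>) * (- g * \<mu>) + X\<^sup>2 * (- g * \<mu>') + (X * \<mu>' - \<tau> * \<mu>) * (2 * g * X) + X * \<mu> * (- g * \<tau>))"
    unfolding H' d_def[symmetric]
    by (simp add: inner_add_right inner_diff_right sc sc' algebra_simps)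
  have "U' \<bullet> H' = (\<sigma> / X) * (\<phi>' \<bullet> H') + (\<sigma> * \<tau> / X\<^sup>2) * (d \<bullet> H')"
    unfolding U' d_def[symmetric] by (simp add: inner_add_left)
  also have "\<dots> = \<sigma>\<^sup>2 * (X * (\<phi>' \<bullet> \<psi>') + \<mu> * (\<phi>' \<bullet> \<phi>'))"
    unfolding 1 2 using Xne by (simp add: field_simps power2_eq_square)
  finally show "U' \<bullet> H' = \<sigma>\<^sup>2 * (X * (\<phi>' \<bullet> \<psi>') + \<mu> * (\<phi>' \<bullet> \<phi>'))" .
qed

text \<open>A bound free of \<open>t\<close>, as a gain uniform over the conformal class requires.
  The four terms of \<open>H'\<close> contribute 4k, 4k, 6k and 2k.\<close>

lemma norm_H'_le:
  assumes k: "norm \<phi>' \<le> k" "norm \<psi>' \<le> k"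
  shows "H' \<bullet> H' \<le> (16 * k)\<^sup>2"
proof -
  have n1: "norm \<phi> = 1" "norm \<psi> = 1" using inner by (simp_all add: norm_eq_sqrt_inner)
  have "t \<bullet> t < 1" using \<sigma> by (metis add.commute add_diff_cancel_left' diff_gt_0_iff_gt zero_less_power)
  then have nt: "norm t \<le> 1" by (simp add: norm_eq_sqrt_inner)
  have "\<sigma>\<^sup>2 \<le> 1\<^sup>2" using \<sigma>(2) by simp
  then have s1: "\<sigma> \<le> 1" using power2_le_imp_le[of \<sigma> 1] by simp
  have k0: "0 \<le> k" using k(1) norm_ge_zero[of \<phi>'] by linarith
  have cs: "\<bar>t \<bullet> y\<bar> \<le> norm y" for y
    using Cauchy_Schwarz_ineq2[of t y] mult_right_mono[OF nt norm_ge_zero[of y]] by simp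
  have "\<bar>t \<bullet> \<phi>\<bar> \<le> 1" using cs[of \<phi>] n1 by simp
  then have X2: "\<bar>X\<bar> \<le> 2" using X by linarith
  have c: "\<bar>\<tau>\<bar> \<le> k" "\<bar>\<mu>\<bar> \<le> 1" "\<bar>\<mu>'\<bar> \<le> k"
    using cs[of \<phi>'] cs[of \<psi>] cs[of \<psi>'] n1 k unfolding coeffs by linarith+
  have g01: "0 \<le> g" "g \<le> 1" using \<sigma>(1) by (simp_all add: g)
  have "norm v \<le> 1 * 1" unfolding v norm_scaleR using g01 nt by (intro mult_mono) auto
  then have nd: "norm (\<phi> - v) \<le> 2" using norm_triangle_ineq4[of \<phi> v] n1 by linarith
  have X4: "\<bar>X\<^sup>2\<bar> \<le> 2 * 2" unfolding power2_eq_square abs_mult using X2 by (intro mult_mono) auto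
  have f1: "norm (- (2 * X * \<tau>) *\<^sub>R \<psi>) \<le> (2 * 2 * k) * 1"
    unfolding norm_scaleR abs_minus_cancel abs_mult using X2 c n1 k0 by (intro mult_mono) auto
  have f2: "norm (X\<^sup>2 *\<^sub>R \<psi>') \<le> (2 * 2) * k"
    unfolding norm_scaleR using X4 k by (intro mult_mono) auto
  have f3: "norm ((X * \<mu>' - \<tau> * \<mu>) *\<^sub>R (\<phi> - v)) \<le> (2 * k + k * 1) * 2"
  proof -
    have "\<bar>X * \<mu>'\<bar> \<le> 2 * k" "\<bar>\<tau> * \<mu>\<bar> \<le> k * 1"
      unfolding abs_mult using X2 c k0 by (intro mult_mono; simp)+
    then have "\<bar>X * \<mu>' - \<tau> * \<mu>\<bar> \<le> 2 * k + k * 1" by linarith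
    then show ?thesis unfolding norm_scaleR using nd k0 by (intro mult_mono) auto
  qed
  have f4: "norm ((X * \<mu>) *\<^sub>R \<phi>') \<le> (2 * 1) * k"
    unfolding norm_scaleR abs_mult using X2 c k by (intro mult_mono) auto
  have le: "norm (- (2 * X * \<tau>) *\<^sub>R \<psi> + X\<^sup>2 *\<^sub>R \<psi>' + (X * \<mu>' - \<tau> * \<mu>) *\<^sub>R (\<phi> - v) + (X * \<mu>) *\<^sub>R \<phi>') \<le> 16 * k"
    using norm_triangle_mono[OF norm_triangle_mono[OF norm_triangle_mono[OF f1 f2] f3] f4] by simp
  have "norm H' \<le> 1 * (16 * k)"
    unfolding H' norm_scaleR using s1 \<sigma>(1) le by (intro mult_mono) auto
  then show ?thesis unfolding power2_norm_eq_inner[symmetric] by (intro power_mono) auto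
qed

end

context torus
begin

lemma
  shows smooth_Re_ch: "smooth (\<lambda>x. Re (c * ch k x))"
    and partial_deriv_Re_ch: "partial_deriv i (\<lambda>x. Re (c * ch k x)) = (\<lambda>x. Re (\<i> * of_real (2 * pi * freq k $ i) * c * ch k x))"
proof -
  have eq: "(\<lambda>x. Re (c * ch k x)) = (\<lambda>x. Re c * cos ((2 * pi) *\<^sub>R freq k \<bullet> x) + (- Im c) * sin ((2 * pi) *\<^sub>R freq k \<bullet> x))" for c
    by (simp add: ch_def)
  show "smooth (\<lambda>x. Re (c * ch k x))" unfolding eq by (rule smooth_trig)
  show "partial_deriv i (\<lambda>x. Re (c * ch k x)) = (\<lambda>x. Re (\<i> * of_real (2 * pi * freq k $ i) * c * ch k x))"
    unfolding eq[of c] eq[of "\<i> * of_real (2 * pi * freq k $ i) * c"] partial_deriv_trig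
    by (simp add: mult_ac)
qed

text \<open>\<open>al\<close> and \<open>be\<close> are the gradients of the two phases.\<close>

definition al :: "2 \<Rightarrow> real" where "al j = 2 * pi * freq (0, 1) $ j"
definition be :: "2 \<Rightarrow> real" where "be j = 2 * pi * freq (1, 0) $ j"

lemma smooth_inner_emb: "smooth (\<lambda>x. e \<bullet> emb c1 c2 x)"
  unfolding inner_emb by (intro smooth_add smooth_Re_ch)

lemma partial_deriv_inner_emb:
  "partial_deriv j (\<lambda>x. e \<bullet> emb c1 c2 x) = (\<lambda>x. e \<bullet> emb (\<i> * of_real (al j) * c1) (\<i> * of_real (be j) * c2) x)"
  unfolding inner_emb smooth_partial_add[OF smooth_Re_ch smooth_Re_ch] partial_deriv_Re_ch al_def be_def
  by (simp only: mult.assoc)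

lemma inner_emb_emb: "emb d1 d2 x \<bullet> emb c1 c2 x = Re (c1 * cnj d1) + Re (c2 * cnj d2)"
proof -
  have "ch k x * cnj (ch k x) = 1" for k by (simp add: complex_norm_square[symmetric])
  then have "c * cnj (d * ch k x) * ch k x = c * cnj d" for c d k
    by (metis complex_cnj_mult mult.assoc mult.commute mult.right_neutral)
  then show ?thesis unfolding inner_emb by (simp only: emb_def fst_conv snd_conv)
qed

end

context balanced_torus
begin

text \<open>The derivative of \<open>\<phi>\<close> under rotation of (p, q): the unit tangent field
  that changes the weights of the two circles.\<close>

abbreviation \<psi> :: "real^2 \<Rightarrow> complex \<times> complex" where
  "\<psi> \<equiv> emb (- of_real q) (of_real p)"
abbreviation \<phi>' :: "2 \<Rightarrow> real^2 \<Rightarrow> complex \<times> complex" where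
  "\<phi>' j \<equiv> emb (\<i> * of_real (al j) * of_real p) (\<i> * of_real (be j) * of_real q)"
abbreviation \<psi>' :: "2 \<Rightarrow> real^2 \<Rightarrow> complex \<times> complex" where
  "\<psi>' j \<equiv> emb (\<i> * of_real (al j) * - of_real q) (\<i> * of_real (be j) * of_real p)"

lemma emb_inner:
  "\<phi> x \<bullet> \<phi> x = 1" "\<psi> x \<bullet> \<psi> x = 1" "\<phi> x \<bullet> \<psi> x = 0" "\<phi>' j x \<bullet> \<phi> x = 0" "\<phi>' j x \<bullet> \<psi> x = 0" "\<psi>' j x \<bullet> \<phi> x = 0"
  "\<phi>' j x \<bullet> \<phi>' j x = p\<^sup>2 * (al j)\<^sup>2 + q\<^sup>2 * (be j)\<^sup>2" "\<phi>' j x \<bullet> \<psi>' j x = p * q * ((be j)\<^sup>2 - (al j)\<^sup>2)"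
  using pq(1) by (simp_all add: inner_emb_emb power2_eq_square algebra_simps)

lemma norm_emb': "norm (\<phi>' j x) \<le> \<bar>al j\<bar> + \<bar>be j\<bar>" "norm (\<psi>' j x) \<le> \<bar>al j\<bar> + \<bar>be j\<bar>"
proof -
  have "p\<^sup>2 \<le> 1" "q\<^sup>2 \<le> 1" using pq(1) zero_le_power2[of p] zero_le_power2[of q] by linarith+
  then have p1: "p \<le> 1" "q \<le> 1" using power2_le_imp_le[of _ "1 :: real"] by simp_all
  have *: "norm (emb c1 c2 x) \<le> norm c1 + norm c2" for c1 c2
    unfolding norm_emb by (rule sqrt_sum_squares_le_sum) auto
  have "\<bar>u\<bar> * r \<le> \<bar>u\<bar>" if "0 \<le> r" "r \<le> 1" for u r :: real
    using mult_left_mono[OF that(2), of "\<bar>u\<bar>"] by simp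
  then show "norm (\<phi>' j x) \<le> \<bar>al j\<bar> + \<bar>be j\<bar>" "norm (\<psi>' j x) \<le> \<bar>al j\<bar> + \<bar>be j\<bar>"
    using p1 pq by (intro order_trans[OF *] add_mono; simp add: norm_mult)+
qed

text \<open>\<open>Ebar\<close> is the energy density of \<open>\<phi>\<close>, and
  \<open>Cbar\<close> half its derivative under rotation of (p, q), zero exactly when the two phase
  gradients have equal length. \<open>Nbar\<close> will bound the energy of the variation.\<close>

definition Ebar :: real where "Ebar = p\<^sup>2 * ((al 1)\<^sup>2 + (al 2)\<^sup>2) + q\<^sup>2 * ((be 1)\<^sup>2 + (be 2)\<^sup>2)"
definition Cbar :: real where "Cbar = p * q * (((be 1)\<^sup>2 + (be 2)\<^sup>2) - ((al 1)\<^sup>2 + (al 2)\<^sup>2))"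
definition Nbar :: real where "Nbar = (16 * (\<bar>al 1\<bar> + \<bar>be 1\<bar>))\<^sup>2 + (16 * (\<bar>al 2\<bar> + \<bar>be 2\<bar>))\<^sup>2"

lemma sum_Basis_inner:
  fixes y z :: "complex \<times> complex"
  shows "(\<Sum>e\<in>Basis. (e \<bullet> y) * (e \<bullet> z)) = y \<bullet> z"
  by (subst euclidean_inner[of y z]) (simp add: inner_commute)

text \<open>Every coordinate of U + s H, centred with respect to \<open>w\<close>, enters the
  Rayleigh inequality, and the results are summed over an orthonormal basis. One \<open>t\<close>
  serves all \<open>s\<close>, so that \<open>s\<close> can be optimized afterwards.\<close>

lemma energy_estimate:
  "\<exists>t. norm t < 1 \<and> (\<forall>s. avg w \<le> \<kappa> * ((1 - (norm t)\<^sup>2) * Ebar * avg (\<lambda>x. 1 / (X t x)\<^sup>2)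
    + 2 * s * ((1 - (norm t)\<^sup>2) * Cbar) + s\<^sup>2 * Nbar))"
proof -
  obtain t where t: "norm t < 1"
    and bal: "\<And>e. avg (\<lambda>x. w x * ((e \<bullet> \<phi> x) / X t x)) = avg w * ((t \<bullet> e) / (1 - (norm t)\<^sup>2))"
    using balanced_point by blast
  define \<sigma> where "\<sigma> = sqrt (1 - (norm t)\<^sup>2)"
  have \<sigma>: "0 < \<sigma>" "\<sigma>\<^sup>2 = 1 - (norm t)\<^sup>2" "\<sigma>\<^sup>2 = 1 - t \<bullet> t"
    using N_pos[OF t] by (simp_all add: \<sigma>_def power2_norm_eq_inner)
  define g where "g = 1 / (1 + \<sigma>)"
  define v where "v = g *\<^sub>R t"
  have Xp: "0 < X t x" for x by (rule X_pos[OF t])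
  have Xne: "X t x \<noteq> 0" for x using Xp[of x] by simp
  define \<tau> \<mu> \<mu>' where "\<tau> j x = t \<bullet> \<phi>' j x" and "\<mu> x = t \<bullet> \<psi> x" and "\<mu>' j x = t \<bullet> \<psi>' j x" for j x
  define U where "U x = (\<sigma> / X t x) *\<^sub>R (\<phi> x - v) - v" for x
  define H where "H x = \<sigma> *\<^sub>R ((X t x)\<^sup>2 *\<^sub>R \<psi> x + (X t x * \<mu> x) *\<^sub>R (\<phi> x - v))" for x
  define U' where "U' j x = (\<sigma> / X t x) *\<^sub>R \<phi>' j x + (\<sigma> * \<tau> j x / (X t x)\<^sup>2) *\<^sub>R (\<phi> x - v)" for j x
  define H' where "H' j x = \<sigma> *\<^sub>R (- (2 * X t x * \<tau> j x) *\<^sub>R \<psi> x + (X t x)\<^sup>2 *\<^sub>R \<psi>' j x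
    + (X t x * \<mu>' j x - \<tau> j x * \<mu> x) *\<^sub>R (\<phi> x - v) + (X t x * \<mu> x) *\<^sub>R \<phi>' j x)" for j x
  note mi = moebius_inner[OF emb_inner(1-6) \<sigma>(1,3) g_def v_def X_def Xp \<tau>_def \<mu>_def \<mu>'_def U_def H_def U'_def H'_def]
  note nH = norm_H'_le[OF emb_inner(1-6) \<sigma>(1,3) g_def v_def X_def Xp \<tau>_def \<mu>_def \<mu>'_def U_def H_def U'_def H'_def norm_emb']

  define Y where "Y e x = e \<bullet> \<phi> x - e \<bullet> v" for e x
  have sY: "smooth (Y e)" for e unfolding Y_def[abs_def] by (intro smooth_diff smooth_inner_emb smooth_const)
  have sX: "smooth (X t)" unfolding X_def[abs_def] by (intro smooth_diff smooth_inner_emb smooth_const)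
  have sI: "smooth (\<lambda>x. inverse (X t x))" by (rule smooth_inverse[OF sX Xne])
  have s\<mu>: "smooth \<mu>" unfolding \<mu>_def[abs_def] by (rule smooth_inner_emb)
  have pY: "partial_deriv j (Y e) = (\<lambda>x. e \<bullet> \<phi>' j x)" for j e
    unfolding Y_def[abs_def] smooth_partial_diff[OF smooth_inner_emb smooth_const] partial_deriv_inner_emb by simp
  have pX: "partial_deriv j (X t) = (\<lambda>x. - \<tau> j x)" for j
    unfolding X_def[abs_def] smooth_partial_diff[OF smooth_const smooth_inner_emb] partial_deriv_inner_emb \<tau>_def by simp
  have p\<mu>: "partial_deriv j \<mu> = \<mu>' j" for j
    unfolding \<mu>_def[abs_def] \<mu>'_def[abs_def] partial_deriv_inner_emb ..
  have pI: "partial_deriv j (\<lambda>x. inverse (X t x)) = (\<lambda>x. \<tau> j x * (inverse (X t x) * inverse (X t x)))" for j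
    by (rule ext) (simp add: partial_deriv_inverse[OF smooth_differentiable[OF sX] Xne] pX)
  have Ueq: "(\<lambda>x. e \<bullet> U x) = (\<lambda>x. \<sigma> * (Y e x * inverse (X t x)) - e \<bullet> v)" for e
    by (auto simp: U_def Y_def inner_diff_right divide_inverse mult_ac)
  have Heq: "(\<lambda>x. e \<bullet> H x) = (\<lambda>x. \<sigma> * ((X t x * X t x) * (e \<bullet> \<psi> x) + X t x * (\<mu> x * Y e x)))" for e
    by (auto simp: H_def Y_def inner_diff_right inner_add_right power2_eq_square mult.assoc)
  have sU: "smooth (\<lambda>x. e \<bullet> U x)" for e
    unfolding Ueq by (intro smooth_diff smooth_mult smooth_const sY sI)
  have sH: "smooth (\<lambda>x. e \<bullet> H x)" for e
    unfolding Heq by (intro smooth_add smooth_mult smooth_const sY sX s\<mu> smooth_inner_emb)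
  have pU: "partial_deriv j (\<lambda>x. e \<bullet> U x) = (\<lambda>x. e \<bullet> U' j x)" for j e
  proof -
    have "partial_deriv j (\<lambda>x. e \<bullet> U x) = (\<lambda>x. \<sigma> * ((e \<bullet> \<phi>' j x) * inverse (X t x) + Y e x * (\<tau> j x * (inverse (X t x) * inverse (X t x)))))"
      unfolding Ueq smooth_partial_diff[OF smooth_mult[OF smooth_const smooth_mult[OF sY sI]] smooth_const]
        smooth_partial_mult[OF smooth_const smooth_mult[OF sY sI]] smooth_partial_mult[OF sY sI] pY pI by simp
    also have "\<dots> = (\<lambda>x. e \<bullet> U' j x)"
      by (auto simp: U'_def Y_def inner_diff_right inner_add_right divide_inverse power2_eq_square algebra_simps)
    finally show ?thesis .
  qed
  have pH: "partial_deriv j (\<lambda>x. e \<bullet> H x) = (\<lambda>x. e \<bullet> H' j x)" for j e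
  proof -
    note sXX = smooth_mult[OF sX sX] and s\<mu>Y = smooth_mult[OF s\<mu> sY]
    note sa = smooth_mult[OF sXX smooth_inner_emb] and sb = smooth_mult[OF sX s\<mu>Y]
    have "partial_deriv j (\<lambda>x. e \<bullet> H x) = (\<lambda>x. \<sigma> * ((((- \<tau> j x) * X t x + X t x * (- \<tau> j x)) * (e \<bullet> \<psi> x) + (X t x * X t x) * (e \<bullet> \<psi>' j x))
        + ((- \<tau> j x) * (\<mu> x * Y e x) + X t x * (\<mu>' j x * Y e x + \<mu> x * (e \<bullet> \<phi>' j x)))))"
      unfolding Heq smooth_partial_mult[OF smooth_const smooth_add[OF sa sb]] smooth_partial_add[OF sa sb]
        smooth_partial_mult[OF sXX smooth_inner_emb] smooth_partial_mult[OF sX s\<mu>Y] smooth_partial_mult[OF sX sX]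
        smooth_partial_mult[OF s\<mu> sY] pY pX p\<mu> partial_deriv_inner_emb by simp
    also have "\<dots> = (\<lambda>x. e \<bullet> H' j x)"
      by (auto simp: H'_def Y_def inner_diff_right inner_add_right power2_eq_square algebra_simps)
    finally show ?thesis .
  qed
  have U_per: "periodic \<Gamma> U"
    using X_periodic[of t] periodic_emb by (simp add: U_def[abs_def] periodic_def)
  have H_per: "periodic \<Gamma> H"
    using X_periodic[of t] periodic_emb by (simp add: H_def[abs_def] \<mu>_def periodic_def)
  note cont = smooth_continuous[OF sU] smooth_continuous[OF sH] w_cont
    smooth_continuous[OF smooth_partial_deriv[OF sU], unfolded pU]
    smooth_continuous[OF smooth_partial_deriv[OF sH], unfolded pH]
  have wInv: "continuous_on UNIV (\<lambda>x. w x * (1 / X t x))"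
    by (intro continuous_on_mult w_cont continuous_on_divide continuous_on_const X_continuous) (use Xne in auto)
  have wQuot: "continuous_on UNIV (\<lambda>x. w x * ((e \<bullet> \<phi> x) / X t x))" for e
    by (intro continuous_on_mult w_cont continuous_on_divide continuous_on_const X_continuous continuous_intros) (use Xne in auto)
  \<comment> \<open>The balancing equation in the direction \<open>t\<close> itself, using 1 / X = 1
    + (t \<bullet> \<phi>) / X.\<close>
  have avg_inv: "avg (\<lambda>x. w x * (1 / X t x)) = avg w / \<sigma>\<^sup>2"
  proof -
    have "w x * (1 / X t x) = w x + w x * ((t \<bullet> \<phi> x) / X t x)" for x
      using Xne[of x] by (simp add: field_simps) (simp add: X_def algebra_simps)
    then have "avg (\<lambda>x. w x * (1 / X t x)) = avg w + avg (\<lambda>x. w x * ((t \<bullet> \<phi> x) / X t x))"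
      by (simp only: avg_add w_cont wQuot)
    also have "\<dots> = avg w + avg w * ((1 - \<sigma>\<^sup>2) / \<sigma>\<^sup>2)" unfolding bal \<sigma>(2)[symmetric] using \<sigma>(3) by simp
    also have "\<dots> = avg w / \<sigma>\<^sup>2" using \<sigma>(1) by (simp add: field_simps)
    finally show ?thesis .
  qed
  \<comment> \<open>What the balancing equation leaves is cancelled by
    \<open>g = 1 / (1 + \<sigma>)\<close>, the relation between the two ball models.\<close>
  have wU: "avg (\<lambda>x. w x * (e \<bullet> U x)) = 0" for e
  proof -
    have "w x * (e \<bullet> U x) = \<sigma> * (w x * ((e \<bullet> \<phi> x) / X t x)) + (- (\<sigma> * (e \<bullet> v))) * (w x * (1 / X t x)) + (- (e \<bullet> v)) * w x" for x
      by (simp add: U_def inner_diff_right divide_inverse algebra_simps)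
    then have "avg (\<lambda>x. w x * (e \<bullet> U x)) = \<sigma> * (avg w * ((t \<bullet> e) / \<sigma>\<^sup>2)) + (- (\<sigma> * (e \<bullet> v))) * (avg w / \<sigma>\<^sup>2) + (- (e \<bullet> v)) * avg w"
      by (simp only: avg_add avg_cmult continuous_on_add continuous_on_mult_left wQuot wInv w_cont bal avg_inv \<sigma>(2))
    also have "\<dots> = avg w * (t \<bullet> e) * (1 / \<sigma> - g / \<sigma> - g)"
      using \<sigma>(1) by (simp add: v_def inner_commute field_simps power2_eq_square)
    also have "1 / \<sigma> - g / \<sigma> - g = 0" using \<sigma>(1) by (simp add: g_def field_simps)
    finally show ?thesis by simp
  qed
  define m where "m e = avg (\<lambda>x. w x * (e \<bullet> H x)) / avg w" for e
  have main: "avg w \<le> \<kappa> * ((1 - (norm t)\<^sup>2) * Ebar * avg (\<lambda>x. 1 / (X t x)\<^sup>2)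
    + 2 * s * ((1 - (norm t)\<^sup>2) * Cbar) + s\<^sup>2 * Nbar)" for s
  proof -
    define f where "f e x = e \<bullet> U x + s * (e \<bullet> H x)" for e x
    have sf: "smooth (f e)" for e
      unfolding f_def[abs_def] by (intro smooth_add smooth_mult smooth_const sU sH)
    have fper: "periodic \<Gamma> (f e)" for e
      using U_per H_per by (simp add: f_def[abs_def] periodic_def)
    have centre: "avg (\<lambda>x. w x * f e x) / avg w = s * m e" for e
    proof -
      have "avg (\<lambda>x. w x * f e x) = avg (\<lambda>x. w x * (e \<bullet> U x) + s * (w x * (e \<bullet> H x)))"
        by (simp add: f_def algebra_simps)
      also have "\<dots> = s * avg (\<lambda>x. w x * (e \<bullet> H x))"
        by (simp only: avg_add avg_cmult continuous_on_mult continuous_on_mult_left cont wU add_0_left)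
      finally show ?thesis by (simp add: m_def)
    qed
    have ray: "mass (\<lambda>x. f e x - s * m e) \<le> \<kappa> * (dir (\<lambda>x. e \<bullet> U x) + 2 * s * dirb (\<lambda>x. e \<bullet> U x) (\<lambda>x. e \<bullet> H x) + s\<^sup>2 * dir (\<lambda>x. e \<bullet> H x))" for e
      using rayleigh[OF adm_centre[OF sf fper, of e], unfolded centre dir_diff_const[OF sf]]
      unfolding f_def[abs_def] quadratic_expansion(1)[OF sU sH] .
    \<comment> \<open>\<open>H\<close> is not balanced, but removing its mean m is harmless: |U + s
      H - s m|^2 = 1 - 2 s (m \<bullet> U) + s^2 |H - m|^2, where the middle term has weighted mean
      zero and the last is dropped.\<close>
    have "avg w = avg (\<lambda>x. w x) - (\<Sum>e\<in>Basis. 2 * s * m e * avg (\<lambda>x. w x * (e \<bullet> U x)))"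
      unfolding wU by simp
    also have "\<dots> = avg (\<lambda>x. w x - (\<Sum>e\<in>Basis. 2 * s * m e * (w x * (e \<bullet> U x))))"
      by (simp only: avg_diff avg_sum finite_Basis avg_cmult continuous_on_sum continuous_on_mult
          continuous_on_mult_left cont)
    also have "\<dots> \<le> avg (\<lambda>x. \<Sum>e\<in>Basis. w x * (f e x - s * m e)\<^sup>2)"
    proof (rule avg_mono)
      show "continuous_on UNIV (\<lambda>x. w x - (\<Sum>e\<in>Basis. 2 * s * m e * (w x * (e \<bullet> U x))))"
        by (intro continuous_on_diff continuous_on_sum continuous_on_mult_left continuous_on_mult cont)
      show "continuous_on UNIV (\<lambda>x. \<Sum>e\<in>Basis. w x * (f e x - s * m e)\<^sup>2)"
        by (intro continuous_on_diff continuous_on_sum continuous_on_mult continuous_on_power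
            continuous_on_const w_cont smooth_continuous sf)
      fix x
      have "1 - (\<Sum>e\<in>Basis. 2 * s * m e * (e \<bullet> U x)) \<le> (\<Sum>e\<in>Basis. (f e x - s * m e)\<^sup>2)"
      proof -
        have "(\<Sum>e\<in>Basis. (e \<bullet> U x) * (e \<bullet> U x) + 2 * s * ((e \<bullet> U x) * (e \<bullet> H x)) - 2 * s * m e * (e \<bullet> U x))
            = 1 - (\<Sum>e\<in>Basis. 2 * s * m e * (e \<bullet> U x))"
          unfolding sum_subtractf sum.distrib sum_distrib_left[symmetric] sum_Basis_inner mi(1,2) by simp
        moreover have "(e \<bullet> U x) * (e \<bullet> U x) + 2 * s * ((e \<bullet> U x) * (e \<bullet> H x)) - 2 * s * m e * (e \<bullet> U x)
            \<le> (f e x - s * m e)\<^sup>2" for e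
        proof -
          have "(f e x - s * m e)\<^sup>2 = (e \<bullet> U x) * (e \<bullet> U x) + 2 * s * ((e \<bullet> U x) * (e \<bullet> H x)) - 2 * s * m e * (e \<bullet> U x)
              + (s * (e \<bullet> H x) - s * m e)\<^sup>2"
            by (simp add: f_def power2_eq_square algebra_simps)
          then show ?thesis by simp
        qed
        ultimately show ?thesis by (metis (no_types, lifting) sum_mono)
      qed
      then have "w x * (1 - (\<Sum>e\<in>Basis. 2 * s * m e * (e \<bullet> U x))) \<le> w x * (\<Sum>e\<in>Basis. (f e x - s * m e)\<^sup>2)"
        using w_pos[of x] by (intro mult_left_mono) auto
      then show "w x - (\<Sum>e\<in>Basis. 2 * s * m e * (w x * (e \<bullet> U x))) \<le> (\<Sum>e\<in>Basis. w x * (f e x - s * m e)\<^sup>2)"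
        by (simp add: right_diff_distrib sum_distrib_left mult_ac)
    qed
    also have "\<dots> = (\<Sum>e\<in>Basis. mass (\<lambda>x. f e x - s * m e))"
      unfolding mass_def
      by (intro avg_sum finite_Basis continuous_on_diff continuous_on_mult continuous_on_power
            continuous_on_const w_cont smooth_continuous sf)
    also have "\<dots> \<le> (\<Sum>e\<in>Basis. \<kappa> * (dir (\<lambda>x. e \<bullet> U x) + 2 * s * dirb (\<lambda>x. e \<bullet> U x) (\<lambda>x. e \<bullet> H x) + s\<^sup>2 * dir (\<lambda>x. e \<bullet> H x)))"
      by (intro sum_mono ray)
    also have "\<dots> = \<kappa> * ((\<Sum>e\<in>Basis. dir (\<lambda>x. e \<bullet> U x)) + 2 * s * (\<Sum>e\<in>Basis. dirb (\<lambda>x. e \<bullet> U x) (\<lambda>x. e \<bullet> H x)) + s\<^sup>2 * (\<Sum>e\<in>Basis. dir (\<lambda>x. e \<bullet> H x)))"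
      by (simp add: sum_distrib_left sum.distrib distrib_left mult.assoc)
    also have "(\<Sum>e\<in>Basis. dir (\<lambda>x. e \<bullet> U x)) = (1 - (norm t)\<^sup>2) * Ebar * avg (\<lambda>x. 1 / (X t x)\<^sup>2)"
    proof -
      have "(\<Sum>e\<in>Basis. dir (\<lambda>x. e \<bullet> U x)) = avg (\<lambda>x. \<Sum>e\<in>Basis. (e \<bullet> U' 1 x)\<^sup>2 + (e \<bullet> U' 2 x)\<^sup>2)"
        unfolding dir_def pU
        by (intro avg_sum[symmetric] finite_Basis continuous_on_add continuous_on_power cont)
      also have "(\<lambda>x. \<Sum>e\<in>Basis. (e \<bullet> U' 1 x)\<^sup>2 + (e \<bullet> U' 2 x)\<^sup>2) = (\<lambda>x. \<sigma>\<^sup>2 * Ebar * (1 / (X t x)\<^sup>2))"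
        unfolding power2_eq_square[of "_ \<bullet> _"] sum.distrib sum_Basis_inner mi(3) emb_inner(7) Ebar_def
        by (simp add: algebra_simps add_divide_distrib)
      also have "avg \<dots> = \<sigma>\<^sup>2 * Ebar * avg (\<lambda>x. 1 / (X t x)\<^sup>2)"
        by (intro avg_cmult continuous_on_divide continuous_on_const continuous_on_power X_continuous)
          (use Xne in auto)
      finally show ?thesis unfolding \<sigma>(2) .
    qed
    also have "(\<Sum>e\<in>Basis. dirb (\<lambda>x. e \<bullet> U x) (\<lambda>x. e \<bullet> H x)) = (1 - (norm t)\<^sup>2) * Cbar"
    proof -
      have "(\<Sum>e\<in>Basis. dirb (\<lambda>x. e \<bullet> U x) (\<lambda>x. e \<bullet> H x)) = avg (\<lambda>x. \<Sum>e\<in>Basis. (e \<bullet> U' 1 x) * (e \<bullet> H' 1 x) + (e \<bullet> U' 2 x) * (e \<bullet> H' 2 x))"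
        unfolding dirb_def pU pH
        by (intro avg_sum[symmetric] finite_Basis continuous_on_add continuous_on_mult cont)
      also have "(\<lambda>x. \<Sum>e\<in>Basis. (e \<bullet> U' 1 x) * (e \<bullet> H' 1 x) + (e \<bullet> U' 2 x) * (e \<bullet> H' 2 x))
          = (\<lambda>x. \<sigma>\<^sup>2 * Cbar + (- (\<sigma>\<^sup>2 * Cbar)) * (t \<bullet> \<phi> x) + \<sigma>\<^sup>2 * Ebar * (t \<bullet> \<psi> x))"
        unfolding sum.distrib sum_Basis_inner mi(4) emb_inner(7,8) Ebar_def Cbar_def X_def \<mu>_def
        by (simp add: algebra_simps)
      also have "avg \<dots> = \<sigma>\<^sup>2 * Cbar"
        by (subst avg_lin3) (auto intro!: continuous_intros simp: avg_inner_emb)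
      finally show ?thesis unfolding \<sigma>(2) .
    qed
    also have "(\<Sum>e\<in>Basis. dir (\<lambda>x. e \<bullet> H x)) \<le> Nbar"
    proof -
      have c: "continuous_on UNIV (\<lambda>x. \<Sum>e\<in>Basis. (e \<bullet> H' 1 x)\<^sup>2 + (e \<bullet> H' 2 x)\<^sup>2)"
        by (intro continuous_on_sum continuous_on_add continuous_on_power cont)
      have "(\<Sum>e\<in>Basis. dir (\<lambda>x. e \<bullet> H x)) = avg (\<lambda>x. \<Sum>e\<in>Basis. (e \<bullet> H' 1 x)\<^sup>2 + (e \<bullet> H' 2 x)\<^sup>2)"
        unfolding dir_def pH
        by (intro avg_sum[symmetric] finite_Basis continuous_on_add continuous_on_power cont)
      also have "\<dots> \<le> avg (\<lambda>x. Nbar)"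
        by (rule avg_mono[OF c continuous_on_const])
          (unfold power2_eq_square[of "_ \<bullet> _"] sum.distrib sum_Basis_inner Nbar_def, intro add_mono nH)
      finally show ?thesis by simp
    qed
    finally show ?thesis using \<kappa>_nonneg by (simp add: mult_left_mono)
  qed
  with t show ?thesis by blast
qed

text \<open>The quadratic in \<open>s\<close> has its minimum at \<open>- c / Nbar\<close>, with
  gain \<open>c\<^sup>2 / Nbar\<close>.\<close>

lemma energy_estimate_optimized:
  assumes N: "0 < Nbar"
  shows "\<exists>t. norm t < 1 \<and> avg w \<le> \<kappa> * ((1 - (norm t)\<^sup>2) * Ebar * avg (\<lambda>x. 1 / (X t x)\<^sup>2)
    - (1 - (norm t)\<^sup>2)\<^sup>2 * Cbar\<^sup>2 / Nbar)"
proof -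
  obtain t where t: "norm t < 1" and le: "\<And>s. avg w \<le> \<kappa> * ((1 - (norm t)\<^sup>2) * Ebar * avg (\<lambda>x. 1 / (X t x)\<^sup>2)
    + 2 * s * ((1 - (norm t)\<^sup>2) * Cbar) + s\<^sup>2 * Nbar)"
    using energy_estimate by blast
  define c where "c = (1 - (norm t)\<^sup>2) * Cbar"
  have "A + 2 * (- c / Nbar) * c + (- c / Nbar)\<^sup>2 * Nbar = A - c\<^sup>2 / Nbar" for A
    using N by (simp add: field_simps power2_eq_square)
  moreover have "c\<^sup>2 = (1 - (norm t)\<^sup>2)\<^sup>2 * Cbar\<^sup>2" by (simp add: c_def power_mult_distrib)
  ultimately show ?thesis
    using t le[of "- c / Nbar"] unfolding c_def[symmetric] by (intro exI[of _ t]) (simp only: simp_thms)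
qed

lemma Ebar_nonneg: "0 \<le> Ebar"
  by (simp add: Ebar_def)

text \<open>If \<open>t\<close> is close to the unit sphere, the energy is far below \<open>E\<close>; otherwise, the gain from
  varying along \<open>H\<close> is bounded away from zero.\<close>

lemma eigenvalue_bound:
  assumes q: "q\<^sup>2 \<le> 1 / 2" and N: "0 < Nbar"
  defines "E \<equiv> Ebar * (2 / (3 * sqrt 3 * p\<^sup>2 * q))"
  shows "avg w / \<kappa> \<le> max (15 / 16 * E) (E - (q ^ 4 / p\<^sup>2)\<^sup>2 * Cbar\<^sup>2 / Nbar)"
proof -
  obtain t where t: "norm t < 1" and le: "avg w \<le> \<kappa> * ((1 - (norm t)\<^sup>2) * Ebar * avg (\<lambda>x. 1 / (X t x)\<^sup>2)
    - (1 - (norm t)\<^sup>2)\<^sup>2 * Cbar\<^sup>2 / Nbar)"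
    using energy_estimate_optimized[OF N] by blast
  define M where "M = 1 - (norm t)\<^sup>2"
  define A where "A = M * avg (\<lambda>x. 1 / (X t x)\<^sup>2)"
  have M: "0 < M" unfolding M_def by (rule N_pos[OF t])
  have p2: "0 < p\<^sup>2" using pq by simp
  have wk: "avg w / \<kappa> \<le> Ebar * A - M\<^sup>2 * Cbar\<^sup>2 / Nbar"
    using le \<kappa>_pos unfolding M_def[symmetric] by (simp add: A_def field_simps)
  show ?thesis
  \<comment> \<open>The dividing line P N = Q^2 is the range of the inequality with factor 15/16;
    beyond it, \<open>M\<close> exceeds \<open>q ^ 4 / p\<^sup>2\<close>, which bounds the gain from
    below.\<close>
  proof (cases "p\<^sup>2 * M \<le> (q\<^sup>2)\<^sup>2")
    case True
    have "Ebar * A \<le> Ebar * (15 / 16 * (2 / (3 * sqrt 3 * p\<^sup>2 * q)))"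
      unfolding A_def M_def using avg_inverse_square_X_le'[OF t True[unfolded M_def] q]
      by (intro mult_left_mono Ebar_nonneg)
    moreover have "0 \<le> M\<^sup>2 * Cbar\<^sup>2 / Nbar" using N by simp
    ultimately have "avg w / \<kappa> \<le> 15 / 16 * E" using wk by (simp add: E_def)
    then show ?thesis by (rule order_trans[OF _ max.cobounded1])
  next
    case False
    then have "q ^ 4 / p\<^sup>2 \<le> M" using p2 by (simp add: field_simps)
    then have "(q ^ 4 / p\<^sup>2)\<^sup>2 \<le> M\<^sup>2" by (intro power_mono) auto
    then have "(q ^ 4 / p\<^sup>2)\<^sup>2 * Cbar\<^sup>2 / Nbar \<le> M\<^sup>2 * Cbar\<^sup>2 / Nbar"
      using N by (intro divide_right_mono mult_right_mono) auto
    moreover have "Ebar * A \<le> E"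
      unfolding A_def M_def E_def using avg_inverse_square_X_le[OF t]
      by (intro mult_left_mono Ebar_nonneg)
    ultimately have "avg w / \<kappa> \<le> E - (q ^ 4 / p\<^sup>2)\<^sup>2 * Cbar\<^sup>2 / Nbar" using wk by linarith
    then show ?thesis by (rule order_trans[OF _ max.cobounded2])
  qed
qed

end

theorem corollary1p2:
  fixes a b :: real
  assumes "(a, b) \<in> moduli_space"
  shows
    "let \<Lambda>\<^sub>1 = first_conformal_eigenvalue (vector [1, 0]) (vector [a, b]) flat_metric;
         L = sqrt ((a\<^sup>2 + b\<^sup>2) * (8 + a\<^sup>2 + b\<^sup>2));
         B = 8 * pi\<^sup>2 / (sqrt 6 * b) * (sqrt (2 + a\<^sup>2 + b\<^sup>2 + L) / (a\<^sup>2 + b\<^sup>2 + L))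
               * (a\<^sup>2 + b\<^sup>2 + L / 3)
     in \<Lambda>\<^sub>1 \<le> ereal B \<and> (a\<^sup>2 + b\<^sup>2 > 1 \<longrightarrow> \<Lambda>\<^sub>1 < ereal B)"
proof -
  have ab: "0 \<le> a" "a \<le> 1 / 2" "sqrt (1 - a\<^sup>2) \<le> b" using assms by (auto simp: moduli_space_def)
  have "a\<^sup>2 \<le> (1 / 2)\<^sup>2" using ab by (intro power_mono) auto
  then have a2: "0 < 1 - a\<^sup>2" by (simp add: power2_eq_square)
  then have b: "0 < b" using ab(3) real_sqrt_gt_zero[OF a2] by linarith
  have "(sqrt (1 - a\<^sup>2))\<^sup>2 \<le> b\<^sup>2" using ab(3) a2 by (intro power_mono) auto
  then have r1: "1 \<le> a\<^sup>2 + b\<^sup>2" using a2 by simp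
  define r where "r = a\<^sup>2 + b\<^sup>2"
  define L where "L = sqrt (r * (8 + r))"
  define T where "T = r + 2 + L"
  define p where "p = sqrt ((r + L) / T)"
  define q where "q = sqrt (2 / T)"
  have r: "1 \<le> r" using r1 by (simp add: r_def)
  have L: "0 < L" using r by (simp add: L_def)
  \<comment> \<open>At r = 1 one has L = 3 and T = 6, so q^2 = 1/3 is the largest weight that
    occurs; this is within the range q^2 <= 1/2 used near the sphere.\<close>
  have "3\<^sup>2 \<le> r * (8 + r)" using mult_mono[of 1 r 9 "8 + r"] r by simp
  then have L3: "3 \<le> L" unfolding L_def by (rule real_le_rsqrt)
  have T: "6 \<le> T" using r L3 by (simp add: T_def)
  have p2: "p\<^sup>2 = (r + L) / T" and q2: "q\<^sup>2 = 2 / T" using r L T by (simp_all add: p_def q_def)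
  have pq: "p\<^sup>2 + q\<^sup>2 = 1" "0 < p" "0 < q"
    using r L T unfolding p2 q2 by (simp_all add: p_def q_def add_divide_distrib[symmetric]) (simp add: T_def)
  have qhalf: "q\<^sup>2 \<le> 1 / 2" using T by (simp add: q2 field_simps)
  interpret torus a b by unfold_locales (rule b)
  have al: "(al 1)\<^sup>2 + (al 2)\<^sup>2 = 4 * pi\<^sup>2 / b\<^sup>2"
    by (simp add: al_def freq_def power_divide power_mult_distrib)
  have be: "(be 1)\<^sup>2 + (be 2)\<^sup>2 = 4 * pi\<^sup>2 / b\<^sup>2 * r"
    using b by (simp add: be_def freq_def r_def power_divide power_mult_distrib field_simps)
  \<comment> \<open>Copies of \<open>Ebar\<close>, \<open>Cbar\<close> and \<open>Nbar\<close>,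
    fixed before any metric is chosen: they do not depend on \<open>w\<close>, and hence neither
    does \<open>E'\<close>.\<close>
  define Eb where "Eb = p\<^sup>2 * ((al 1)\<^sup>2 + (al 2)\<^sup>2) + q\<^sup>2 * ((be 1)\<^sup>2 + (be 2)\<^sup>2)"
  define Cb where "Cb = p * q * (((be 1)\<^sup>2 + (be 2)\<^sup>2) - ((al 1)\<^sup>2 + (al 2)\<^sup>2))"
  define Nb where "Nb = (16 * (\<bar>al 1\<bar> + \<bar>be 1\<bar>))\<^sup>2 + (16 * (\<bar>al 2\<bar> + \<bar>be 2\<bar>))\<^sup>2"
  define E where "E = Eb * (2 / (3 * sqrt 3 * p\<^sup>2 * q))"
  define E' where "E' = max (15 / 16 * E) (E - (q ^ 4 / p\<^sup>2)\<^sup>2 * Cb\<^sup>2 / Nb)"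
  define B where "B = 8 * pi\<^sup>2 / (sqrt 6 * b) * (sqrt (2 + a\<^sup>2 + b\<^sup>2 + L) / (a\<^sup>2 + b\<^sup>2 + L)) * (a\<^sup>2 + b\<^sup>2 + L / 3)"
  have Nb: "0 < Nb"
  proof -
    have "0 < \<bar>be 1\<bar>" by (simp add: be_def freq_def)
    then have "0 < (16 * (\<bar>al 1\<bar> + \<bar>be 1\<bar>))\<^sup>2" by (intro zero_less_power) simp
    then show ?thesis unfolding Nb_def by (simp add: add_pos_nonneg)
  qed
  \<comment> \<open>Since p^2 T = r + L and q^2 T = 2, the sum p^2 + q^2 r is (3 r + L) / T.\<close>
  have Eb_eq: "Eb = 4 * pi\<^sup>2 / b\<^sup>2 * (3 * (r + L / 3) / T)"
  proof -
    have "T \<noteq> 0" "b \<noteq> 0" using T b by auto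
    then show ?thesis unfolding Eb_def al be p2 q2 by (simp add: field_simps)
  qed
  have E0: "0 < E"
    unfolding E_def Eb_eq using b r L T pq by (intro mult_pos_pos divide_pos_pos) auto
  have BE: "B = b * E"
  proof -
    define u where "u = sqrt T"
    have u: "0 < u" "T = u\<^sup>2" using T by (simp_all add: u_def)
    have eq: "8 * K / (s3 * s2 * b) * (u / R) * Z
        = b * (4 * K / b\<^sup>2 * (3 * Z / u\<^sup>2) * (2 / (3 * s3 * (R / u\<^sup>2) * (s2 / u))))"
      if "0 < s2" "0 < s3" "0 < R" for K Z R s2 s3 :: real
      using that u(1) b by (simp add: divide_simps power2_eq_square)
    have sqrt6: "sqrt 6 = sqrt 3 * sqrt 2" by (simp add: real_sqrt_mult[symmetric])
    have qu: "q = sqrt 2 / u" by (simp add: q_def u_def real_sqrt_divide)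
    have su: "sqrt (2 + a\<^sup>2 + b\<^sup>2 + L) = u" by (simp add: u_def T_def r_def add_ac)
    show ?thesis
      unfolding B_def su r_def[symmetric] E_def Eb_eq p2 sqrt6 unfolding qu u(2)
      by (rule eq) (use r L in auto)
  qed
  have bound: "first_conformal_eigenvalue (vector [1, 0]) (vector [a, b]) flat_metric \<le> ereal (b * E')"
    unfolding first_conformal_eigenvalue_def
  proof (rule SUP_least)
    fix h assume "h \<in> conformal_class (lattice (vector [1, 0]) (vector [a, b])) flat_metric"
    then obtain w where w: "smooth w" "periodic \<Gamma> w" "\<And>x. w x > 0" and h: "h = (\<lambda>x. w x *\<^sub>R mat 1)"
      unfolding conformal_class_def \<Gamma>_def flat_metric_def by auto
    interpret balanced_torus a b w p q
      by unfold_locales (use w pq in auto)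
    have "avg w / \<kappa> \<le> E'"
      using eigenvalue_bound[OF qhalf] Nb unfolding E'_def E_def Eb_def Cb_def Nb_def Ebar_def Cbar_def Nbar_def by simp
    then have "b * (avg w / \<kappa>) \<le> b * E'" using b by (intro mult_left_mono) auto
    moreover have "lambda1 (lattice (vector [1, 0]) (vector [a, b])) h = 1 / \<kappa>"
      using lambda1_eq unfolding h \<Gamma>_def .
    moreover have "area (vector [1, 0]) (vector [a, b]) h = b * avg w"
      unfolding h by (rule area_conformal[OF smooth_continuous[OF w(1)] w(3)])
    ultimately show "ereal (lambda1 (lattice (vector [1, 0]) (vector [a, b])) h
        * area (vector [1, 0]) (vector [a, b]) h) \<le> ereal (b * E')"
      by simp
  qed
  have "E' \<le> E" using E0 Nb by (simp add: E'_def)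
  then have le: "b * E' \<le> B" unfolding BE using b by simp
  \<comment> \<open>Cb > 0 because the squared phase gradients differ by the factor r > 1. As
    \<open>E'\<close> bounds the whole conformal class, E' < E makes the supremum itself strictly
    smaller.\<close>
  have less: "b * E' < B" if "1 < a\<^sup>2 + b\<^sup>2"
  proof -
    have "1 < r" using that by (simp add: r_def)
    then have "0 < Cb" unfolding Cb_def al be using pq b by (simp add: field_simps)
    then have "0 < (q ^ 4 / p\<^sup>2)\<^sup>2 * Cb\<^sup>2 / Nb" using pq Nb by simp
    then have "E' < E" using E0 by (simp add: E'_def)
    then show ?thesis unfolding BE using b by simp
  qed
  have "first_conformal_eigenvalue (vector [1, 0]) (vector [a, b]) flat_metric \<le> ereal B"
    using bound le by (meson ereal_less_eq(3) order_trans)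
  moreover have "first_conformal_eigenvalue (vector [1, 0]) (vector [a, b]) flat_metric < ereal B" if "1 < a\<^sup>2 + b\<^sup>2"
    using bound less[OF that] by (meson less_ereal.simps(1) order_le_less_trans)
  ultimately have "first_conformal_eigenvalue (vector [1, 0]) (vector [a, b]) flat_metric \<le> ereal B
      \<and> (a\<^sup>2 + b\<^sup>2 > 1 \<longrightarrow> first_conformal_eigenvalue (vector [1, 0]) (vector [a, b]) flat_metric < ereal B)"
    by blast
  moreover have "sqrt ((a\<^sup>2 + b\<^sup>2) * (8 + a\<^sup>2 + b\<^sup>2)) = L" by (simp add: L_def r_def add.assoc)
  ultimately show ?thesis unfolding Let_def B_def by simp
qed

end
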